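(* For every real $x>0$, \[ \sum_{n=1}^\infty e^{-\alpha_n^2 x}=-\frac{1}{2\sqrt{\pi x}}\sum_{n=2}^\infty \frac{\Lambda(n)}{\sqrt{n}}e^{-\frac{1}{4x}\log^2n}+e^{\frac{x}{4}}-\Phi(x), \] where \[ \Phi(x):=\frac{1}{2\pi}\int_0^{+\infty}e^{-xt^2}\Psi(t)\,dt,\qquad \Psi(t):=\log 2\pi+\frac{\pi}{2\cosh\pi t}-\Re\Bigl\{\frac{\Gamma'(\frac12+it)}{\Gamma(\frac12+it)}\Bigr\}, \] and moreover \[ \Phi(x)=\frac{C_0+\log 16\pi^2x}{8\sqrt{\pi x}}-\frac{1}{4\sqrt{\pi x}}\int_0^{+\infty}e^{-\frac{u^2}{16x}}\Bigl(\frac{1}{u}-\frac{e^{\frac34 u}}{e^u-1}\Bigr)\,du . \]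
   Context: Let the zeros $\rho$ of the Riemann zeta function $\zeta(s)$ with $\Im\rho>0$ be arranged in a sequence $(\rho_n)_{n\ge1}$ with $\Im\rho_{n+1}\ge\Im\rho_n$, each zero repeated according to its multiplicity, and write $\rho_n=\frac12+i\alpha_n$ (so $\alpha_n$ are complex numbers with $\Re\alpha_n>0$; the Riemann Hypothesis is not assumed). $\Lambda$ is the von Mangoldt function, $\Gamma$ is Euler's gamma function, and $C_0$ is Euler's constant. *)

theory Defs
  imports
    "HOL-Complex_Analysis.Complex_Analysis"
    "HOL-Number_Theory.Prime_Powers"
begin

text \<open>
  The Riemann zeta function, as the analytic continuation of its Dirichlet series to the
  complex plane without the pole 1. By the identity theorem the continuation is unique there;
  the clause on the value at 1 only makes it unique as a total function.
\<close>

definition riemann_zeta :: "complex \<Rightarrow> complex" where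
  "riemann_zeta = (THE f. f holomorphic_on (- {1}) \<and>
     (\<forall>s. Re s > 1 \<longrightarrow> (\<lambda>n. 1 / of_nat (Suc n) powr s) sums f s) \<and>
     f 1 = 0)"

text \<open>
  Sequences are indexed from 1, and \<open>\<rho> 0\<close> is irrelevant. As \<open>zorder\<close> is positive at a zero,
  the last clause also says that every zero in the upper half-plane occurs, and only finitely
  often.
\<close>

definition upper_zeta_zeros_seq :: "(nat \<Rightarrow> complex) \<Rightarrow> bool" where
  "upper_zeta_zeros_seq \<rho> \<longleftrightarrow>
     (\<forall>n\<ge>1. riemann_zeta (\<rho> n) = 0 \<and> Im (\<rho> n) > 0) \<and>
     (\<forall>n\<ge>1. Im (\<rho> (n + 1)) \<ge> Im (\<rho> n)) \<and>
     (\<forall>s. riemann_zeta s = 0 \<and> Im s > 0 \<longrightarrow>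
        int (card {n. n \<ge> 1 \<and> \<rho> n = s}) = zorder riemann_zeta s)"

definition Psi :: "real \<Rightarrow> real" where
  "Psi t = ln (2 * pi) + pi / (2 * cosh (pi * t))
     - Re (deriv Gamma (1 / 2 + \<i> * of_real t) / Gamma (1 / 2 + \<i> * of_real t))"

definition Phi :: "real \<Rightarrow> real" where
  "Phi x = 1 / (2 * pi) * (LBINT t:{0<..}. exp (- x * t\<^sup>2) * Psi t)"

end

theory Submission
  imports Defs "HOL-Probability.Probability" "HOL-Real_Asymp.Real_Asymp"
begin

text \<open>
  Write \<open>s = 1/2 + v\<close>. The completed zeta function is even in \<open>v\<close>, hence an entire function \<open>f\<close> of
  \<open>w = v\<^sup>2\<close>, and its zeros are the numbers \<open>- \<alpha>\<^sub>n\<^sup>2\<close>. Since \<open>f\<close> grows more slowly than every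
  \<open>exp (\<epsilon> \<bar>w\<bar>)\<close>, dividing out the zeros in a large disc and applying the Schwarz lemma to the
  logarithm of the quotient gives \<open>f' w / f w = (\<Sum>n. 1 / (w + \<alpha>\<^sub>n\<^sup>2))\<close>. For large real \<open>w\<close> this is
  the Laplace transform of \<open>\<Sum>n. exp (- \<alpha>\<^sub>n\<^sup>2 x)\<close>, while
  \<open>f w = s (s - 1) \<pi>\<^sup>-\<^sup>s\<^sup>/\<^sup>2 \<Gamma> (s / 2) \<zeta> s\<close> shows, term by term, that \<open>f' / f\<close> is also the Laplace
  transform of the right-hand side, because
  \<open>exp (- a\<^sup>2 / (4 x)) / \<surd>x\<close> has the transform \<open>\<surd>\<pi> exp (- v a) / v\<close> at \<open>v\<^sup>2\<close>. Both sides are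
  continuous in \<open>x\<close>, so they agree. The same uniqueness argument yields the functional equation of
  the theta series, and therefore that of zeta, from the partial fractions of the cotangent.
\<close>

section \<open>Gaussian integrals and uniqueness of Laplace transforms\<close>

text \<open>Passing to \<open>w = v^2\<close> halves the order of growth, which leaves no room for
  an exponential factor beside the zeros, and it identifies \<open>v\<close> with
  \<open>- v\<close>. Each zero of \<open>xi_sq\<close> then matches exactly one zero of zeta in the
  upper half-plane, with the same order, provided that no zero has real \<open>v\<close>; a crude
  size estimate of the theta integral excludes these. The main obstacle is convergence: the sum over
  zeros in discs converges only as a limit, while termwise Laplace transforms need absolute
  convergence, and the numbers \<open>z = v^2\<close> may be non-real. Since the zeros satisfy
  \<open>|Re v| \<le> 1/2\<close>, \<open>z\<close> stays in a region bounded by a parabola, and for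
  \<open>w \<ge> 5/4\<close> the real part of \<open>1 / (w - z)\<close> is at least half of
  \<open>1 / (w - Re z)\<close>. The convergent sum of positive real parts therefore bounds the
  absolute series, which in turn majorises the sum of exponentials. Zeta is given by a description
  only, so its continuation is constructed here, by Riemann's theta integral. The strip bound rests
  on the absence of zeros for \<open>Re s > 1\<close>, which is derived from the von Mangoldt
  series.\<close>

lemma FTC_Ioi_nonneg:
  fixes F f :: "real \<Rightarrow> real"
  assumes F: "\<And>x. x > 0 \<Longrightarrow> (F has_real_derivative f x) (at x)"
    and cont: "\<And>x. x > 0 \<Longrightarrow> isCont f x"
    and nonneg: "\<And>x. x > 0 \<Longrightarrow> f x \<ge> 0"
    and A: "(F \<longlongrightarrow> A) (at_right 0)" and B: "(F \<longlongrightarrow> B) at_top"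
  shows "set_integrable lborel {0<..} f" "(LBINT x:{0<..}. f x) = B - A"
proof -
  have *: "set_integrable lborel (einterval 0 \<infinity>) f" "(LBINT x=0..\<infinity>. f x) = B - A"
    using assms
    by (intro interval_integral_FTC_nonneg[where F = F];
        force simp: zero_ereal_def ereal_tendsto_simps)+
  have e: "einterval 0 \<infinity> = {0<..}" by (auto simp: einterval_def zero_ereal_def)
  show "set_integrable lborel {0<..} f" using *(1) by (simp add: e)
  show "(LBINT x:{0<..}. f x) = B - A"
    using *(2) by (simp add: interval_lebesgue_integral_def e)
qed

text \<open>This is \<open>sqrt pi / 2\<close> times the error function; it serves as the primitive
  from which \<open>laplace_gauss\<close> is computed.\<close>

definition gauss_primitive :: "real \<Rightarrow> real" where
  "gauss_primitive x = (LBINT t=0..x. exp (- t\<^sup>2))"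

lemma gauss_primitive_deriv:
  "(gauss_primitive has_real_derivative exp (- x\<^sup>2)) (at x)"
proof -
  \<comment> \<open>The interval contains both the base point 0 and, in its interior,
    \<open>x\<close>; the derivative within it is therefore the full derivative.\<close>
  let ?a = "min 0 x - 1" and ?b = "max 0 x + 1"
  have "((\<lambda>u. LBINT t=0..u. exp (- t\<^sup>2)) has_vector_derivative exp (- x\<^sup>2)) (at x within {?a..?b})"
    using interval_integral_FTC2[of ?a 0 ?b "\<lambda>t. exp (- t\<^sup>2)" x]
    by (force intro!: continuous_intros simp: zero_ereal_def)
  hence "(gauss_primitive has_vector_derivative exp (- x\<^sup>2)) (at x within {?a..?b})"
    unfolding gauss_primitive_def[abs_def] by (simp add: zero_ereal_def)
  thus ?thesis
    by (subst (asm) at_within_interior) (auto simp: has_real_derivative_iff_has_vector_derivative)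
qed

lemma gauss_primitive_minus: "gauss_primitive (- x) = - gauss_primitive x"
proof -
  have "((\<lambda>x. gauss_primitive (- x) + gauss_primitive x) has_real_derivative 0) (at x)" for x
    by (rule derivative_eq_intros gauss_primitive_deriv DERIV_chain2[of gauss_primitive] refl)+ auto
  hence "gauss_primitive (- x) + gauss_primitive x = gauss_primitive (- 0) + gauss_primitive 0"
    by (metis DERIV_isconst_all)
  thus ?thesis by (simp add: gauss_primitive_def zero_ereal_def)
qed

lemma gauss_primitive_at_top: "(gauss_primitive \<longlongrightarrow> sqrt pi / 2) at_top"
proof -
  have i: "has_bochner_integral lborel (\<lambda>x::real. indicator {0..} x *\<^sub>R exp (- x\<^sup>2)) (sqrt pi / 2)"
    by (rule gaussian_moment_0)
  hence si: "set_integrable lborel {0..} (\<lambda>x::real. exp (- x\<^sup>2))"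
    by (auto simp: set_integrable_def has_bochner_integral_iff)
  have "((\<lambda>b::real. LBINT x:{0..b}. exp (- x\<^sup>2)) \<longlongrightarrow> (LBINT x:{0::real..}. exp (- x\<^sup>2))) at_top"
    using si by (intro tendsto_set_lebesgue_integral_at_top) auto
  also have "(LBINT x:{0::real..}. exp (- x\<^sup>2)) = sqrt pi / 2"
    using i by (simp add: set_lebesgue_integral_def has_bochner_integral_iff)
  finally show ?thesis
  proof (rule Lim_transform_eventually)
    show "\<forall>\<^sub>F x in at_top. (LBINT x:{0..x}. exp (- x\<^sup>2)) = gauss_primitive x"
      using eventually_ge_at_top[of 0]
      by eventually_elim (simp add: gauss_primitive_def zero_ereal_def interval_integral_Icc)
  qed
qed

lemma gauss_primitive_at_bot: "(gauss_primitive \<longlongrightarrow> - (sqrt pi / 2)) at_bot"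
proof -
  have "((\<lambda>x. - gauss_primitive (- x)) \<longlongrightarrow> - (sqrt pi / 2)) at_bot"
    by (intro tendsto_minus filterlim_compose[OF gauss_primitive_at_top]
        filterlim_uminus_at_top_at_bot)
  thus ?thesis by (simp add: gauss_primitive_minus)
qed

text \<open>
  The primitive comes from completing the square in the two ways
  \<open>s\<^sup>2 x + a\<^sup>2 / (4 x) = (s \<surd>x \<minusplus> a / (2 \<surd>x))\<^sup>2 \<plusminus> s a\<close>.
\<close>

lemma laplace_gauss:
  fixes s a :: real
  assumes s: "s > 0" and a: "a \<ge> 0"
  shows "set_integrable lborel {0<..} (\<lambda>x. exp (- (s\<^sup>2 * x)) * (exp (- (a\<^sup>2 / (4 * x))) / sqrt x))"
    and "(LBINT x:{0<..}. exp (- (s\<^sup>2 * x)) * (exp (- (a\<^sup>2 / (4 * x))) / sqrt x))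
           = sqrt pi * exp (- (s * a)) / s"
proof -
  define F where "F = (\<lambda>x. (exp (- (s * a)) * gauss_primitive (s * sqrt x - a / (2 * sqrt x))
      + exp (s * a) * gauss_primitive (s * sqrt x + a / (2 * sqrt x))) / s)"
  let ?f = "\<lambda>x. exp (- (s\<^sup>2 * x)) * (exp (- (a\<^sup>2 / (4 * x))) / sqrt x)"
  have der: "(F has_real_derivative ?f x) (at x)" if x: "x > 0" for x
  proof -
    define D where "D = inverse (sqrt x) / 2"
    have D: "(sqrt has_real_derivative D) (at x)"
      unfolding D_def by (rule DERIV_real_sqrt[OF x])
    have D2: "((\<lambda>x. a / (2 * sqrt x)) has_real_derivative - (a * D / (2 * x))) (at x)"
      using x by (auto intro!: derivative_eq_intros D simp: power2_eq_square D_def)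
    have G1: "((\<lambda>x. gauss_primitive (s * sqrt x - a / (2 * sqrt x))) has_real_derivative
        exp (- (s * sqrt x - a / (2 * sqrt x))\<^sup>2) * (s * D + a * D / (2 * x))) (at x)"
      using x by (intro DERIV_chain2[OF gauss_primitive_deriv])
        (auto intro!: derivative_eq_intros simp: D_def power2_eq_square)
    have G2: "((\<lambda>x. gauss_primitive (s * sqrt x + a / (2 * sqrt x))) has_real_derivative
        exp (- (s * sqrt x + a / (2 * sqrt x))\<^sup>2) * (s * D - a * D / (2 * x))) (at x)"
      using x by (intro DERIV_chain2[OF gauss_primitive_deriv])
        (auto intro!: derivative_eq_intros simp: D_def power2_eq_square)
    have "(F has_real_derivative ((exp (- (s * a)) * (exp (- (s * sqrt x - a / (2 * sqrt x))\<^sup>2) *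
            (s * D + a * D / (2 * x)))
      + exp (s * a) * (exp (- (s * sqrt x + a / (2 * sqrt x))\<^sup>2) * (s * D - a * D / (2 * x)))) / s)) (at x)"
      unfolding F_def using s
      by (auto intro!: derivative_eq_intros G1 G2)
    moreover have "exp (- (s * a)) * exp (- (s * sqrt x - a / (2 * sqrt x))\<^sup>2) =
        exp (- (s\<^sup>2 * x)) * exp (- (a\<^sup>2 / (4 * x)))"
      using x unfolding exp_add[symmetric] by (simp add: power2_diff field_simps power_mult_distrib)
    moreover have "exp (s * a) * exp (- (s * sqrt x + a / (2 * sqrt x))\<^sup>2) =
        exp (- (s\<^sup>2 * x)) * exp (- (a\<^sup>2 / (4 * x)))"
      using x unfolding exp_add[symmetric] by (simp add: power2_sum field_simps power_mult_distrib)
    ultimately have "(F has_real_derivative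
        ((exp (- (s\<^sup>2 * x)) * exp (- (a\<^sup>2 / (4 * x)))) * (s * D + a * D / (2 * x)) +
         (exp (- (s\<^sup>2 * x)) * exp (- (a\<^sup>2 / (4 * x)))) * (s * D - a * D / (2 * x))) / s) (at x)"
      by (simp only: mult.assoc[symmetric])
    also have "((exp (- (s\<^sup>2 * x)) * exp (- (a\<^sup>2 / (4 * x)))) * (s * D + a * D / (2 * x)) +
         (exp (- (s\<^sup>2 * x)) * exp (- (a\<^sup>2 / (4 * x)))) * (s * D - a * D / (2 * x))) / s = ?f x"
      using s unfolding D_def by (simp add: algebra_simps divide_simps)
    finally show ?thesis .
  qed
  have cont: "isCont ?f x" if "x > 0" for x
    using that by (intro continuous_intros) auto
  have top: "(F \<longlongrightarrow> (exp (- (s * a)) * (sqrt pi / 2) + exp (s * a) * (sqrt pi / 2)) / s) at_top"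
  proof -
    have "filterlim (\<lambda>x. s * sqrt x - a / (2 * sqrt x)) at_top at_top"
      "filterlim (\<lambda>x. s * sqrt x + a / (2 * sqrt x)) at_top at_top"
      using s by real_asymp+
    thus ?thesis unfolding F_def using s
      by (intro tendsto_intros filterlim_compose[OF gauss_primitive_at_top]) auto
  qed
  have "\<exists>A. (F \<longlongrightarrow> A) (at_right 0) \<and> (exp (- (s * a)) * (sqrt pi / 2) + exp (s * a) * (sqrt pi / 2)) / s - A
     = sqrt pi * exp (- (s * a)) / s"
  \<comment> \<open>At 0 from the right the two arguments tend to minus and plus infinity if
    \<open>a > 0\<close>, but both tend to 0 if \<open>a = 0\<close>. Both cases lead to the same
    formula for the integral.\<close>
  proof (cases "a = 0")
    case True
    have "(gauss_primitive \<longlongrightarrow> gauss_primitive 0) (at 0)"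
      using DERIV_isCont[OF gauss_primitive_deriv] by (simp add: isCont_def)
    hence "(F \<longlongrightarrow> (exp (- (s * a)) * gauss_primitive 0 + exp (s * a) * gauss_primitive 0) / s) (at_right 0)"
      unfolding F_def using True s
      by (intro tendsto_intros isCont_tendsto_compose[OF DERIV_isCont[OF gauss_primitive_deriv]])
         (auto intro!: tendsto_eq_intros)
    moreover have "gauss_primitive 0 = 0" by (simp add: gauss_primitive_def zero_ereal_def)
    ultimately show ?thesis using True s by auto
  next
    case False
    hence a: "a > 0" using a by simp
    have "filterlim (\<lambda>x. s * sqrt x - a / (2 * sqrt x)) at_bot (at_right 0)"
      "filterlim (\<lambda>x. s * sqrt x + a / (2 * sqrt x)) at_top (at_right 0)"
      using s a by real_asymp+
    hence "(F \<longlongrightarrow> (exp (- (s * a)) * (- (sqrt pi / 2)) + exp (s * a) * (sqrt pi / 2)) / s) (at_right 0)"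
      unfolding F_def using s
      by (intro tendsto_intros filterlim_compose[OF gauss_primitive_at_top]
          filterlim_compose[OF gauss_primitive_at_bot]) auto
    moreover have "(exp (- (s * a)) * (sqrt pi / 2) + exp (s * a) * (sqrt pi / 2)) / s -
        (exp (- (s * a)) * (- (sqrt pi / 2)) + exp (s * a) * (sqrt pi / 2)) / s = sqrt pi * exp (- (s * a)) / s"
      using s by (simp add: field_simps)
    ultimately show ?thesis by blast
  qed
  then obtain A where A: "(F \<longlongrightarrow> A) (at_right 0)"
    "(exp (- (s * a)) * (sqrt pi / 2) + exp (s * a) * (sqrt pi / 2)) / s - A = sqrt pi * exp (- (s * a)) / s"
    by blast
  note * = FTC_Ioi_nonneg[OF der cont _ A(1) top]
  show "set_integrable lborel {0<..} ?f" by (rule *(1)) auto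
  show "(LBINT x:{0<..}. ?f x) = sqrt pi * exp (- (s * a)) / s"
    unfolding A(2)[symmetric] by (rule *(2)) auto
qed

text \<open>The set where \<open>f\<close> is positive is open by continuity and null by the
  vanishing integral, and a nonempty open set is not null.\<close>

lemma set_integral_eq_0_imp_eq_0:
  fixes f :: "real \<Rightarrow> real"
  assumes "set_integrable lborel {0<..} f" "(LBINT x:{0<..}. f x) = 0"
    and "continuous_on {0<..} f" "\<And>x. x > 0 \<Longrightarrow> f x \<ge> 0" "x > 0"
  shows "f x = 0"
proof (rule ccontr)
  assume "f x \<noteq> 0"
  with assms have fx: "f x > 0" by (simp add: order_less_le)
  have "AE x in lborel. indicator {0<..} x *\<^sub>R f x = 0"
    using assms unfolding set_integrable_def set_lebesgue_integral_def
    by (subst integral_nonneg_eq_0_iff_AE[symmetric]) (auto simp: indicator_def)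
  moreover have op: "open (f -` {0<..} \<inter> {0<..})"
    using assms(3) by (subst (asm) continuous_on_open_vimage) auto
  ultimately have "f -` {0<..} \<inter> {0<..} \<in> null_sets lborel"
    by (subst AE_iff_null_sets, force) (auto elim!: eventually_mono simp: indicator_def split: if_splits)
  hence "negligible (f -` {0<..} \<inter> {0<..})"
    by (simp add: negligible_iff_null_sets null_sets_completionI)
  with op have "f -` {0<..} \<inter> {0<..} = {}" using open_not_negligible by blast
  with fx assms(5) show False by auto
qed

text \<open>By Weierstrass approximation in the variable \<open>e\<^sup>-\<^sup>x\<close>, integer shifts of the transform already
  determine the function.\<close>

lemma laplace_eq_0_imp_eq_0_real:
  fixes g :: "real \<Rightarrow> real"
  assumes cont: "continuous_on {0<..} g"
    and int: "\<And>k::nat. set_integrable lborel {0<..} (\<lambda>x. exp (- ((c + k) * x)) * g x)"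
    and zero: "\<And>k::nat. (LBINT x:{0<..}. exp (- ((c + k) * x)) * g x) = 0"
    and x0: "x0 > 0"
  shows "g x0 = 0"
proof -
  let ?h = "\<lambda>x. exp (- (c * x)) * g x"
  have h_int: "set_integrable lborel {0<..} ?h"
    using int[of 0] by simp
  \<comment> \<open>The factor \<open>exp (- (k * x))\<close> is the \<open>k\<close>-th power of
    \<open>exp (- x)\<close>, so the hypotheses say that \<open>?h\<close> is orthogonal to every
    monomial, hence to every polynomial, in \<open>exp (- x)\<close>.\<close>
  have poly: "set_integrable lborel {0<..} (\<lambda>x. q (exp (- x)) * ?h x) \<and>
     (LBINT x:{0<..}. q (exp (- x)) * ?h x) = 0" if q: "real_polynomial_function q" for q
  proof -
    obtain a n where an: "q = (\<lambda>x. \<Sum>i\<le>n. a i * x ^ i)"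
      using real_polynomial_function_imp_sum[OF q] by auto
    have eq: "q (exp (- x)) * ?h x = (\<Sum>i\<le>n. a i * (exp (- ((c + real i) * x)) * g x))" for x
      unfolding an sum_distrib_right
      by (intro sum.cong) (auto simp: algebra_simps exp_add[symmetric] exp_of_nat_mult[symmetric])
    have i: "integrable lborel (\<lambda>x. indicator {0<..} x *\<^sub>R (exp (- ((c + real i) * x)) * g x))" for i
      using int[of i] by (simp add: set_integrable_def)
    have z: "(\<integral>x. indicator {0<..} x *\<^sub>R (exp (- ((c + real i) * x)) * g x) \<partial>lborel) = 0" for i
      using zero[of i] by (simp add: set_lebesgue_integral_def)
    have eq2: "(\<lambda>x. indicator {0<..} x *\<^sub>R (q (exp (- x)) * ?h x)) =
       (\<lambda>x. \<Sum>i\<le>n. a i * (indicator {0<..} x *\<^sub>R (exp (- ((c + real i) * x)) * g x)))"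
      unfolding eq by (auto simp: scaleR_sum_right sum_distrib_left mult_ac)
    show ?thesis unfolding set_integrable_def set_lebesgue_integral_def eq2
      using i z by (auto simp: Bochner_Integration.integral_sum)
  qed
  have cts: "(LBINT x:{0<..}. p (exp (- x)) * ?h x) = 0 \<and> set_integrable lborel {0<..} (\<lambda>x. p (exp (- x)) * ?h x)"
    if p: "continuous_on UNIV (p :: real \<Rightarrow> real)" "\<And>x. \<bar>p x\<bar> \<le> 1" for p
  proof
    have [measurable]: "p \<in> borel_measurable borel"
      using p(1) by (rule borel_measurable_continuous_onI)
    have [measurable]: "(\<lambda>x. indicator {0<..} x *\<^sub>R ?h x) \<in> borel_measurable lborel"
      using h_int by (auto simp: set_integrable_def)
    show int_p: "set_integrable lborel {0<..} (\<lambda>x. p (exp (- x)) * ?h x)"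
    proof (unfold set_integrable_def, rule Bochner_Integration.integrable_bound[OF h_int[unfolded set_integrable_def]])
      have "(\<lambda>x. p (exp (- x)) * (indicator {0<..} x *\<^sub>R ?h x)) \<in> borel_measurable lborel"
        by measurable
      thus "(\<lambda>x. indicator {0<..} x *\<^sub>R (p (exp (- x)) * ?h x)) \<in> borel_measurable lborel"
        by (simp add: mult_ac)
      show "AE x in lborel. norm (indicator {0<..} x *\<^sub>R (p (exp (- x)) * ?h x)) \<le> norm (indicator {0<..} x *\<^sub>R ?h x)"
        using p(2) by (intro AE_I2) (auto simp: abs_mult indicator_def intro!: mult_left_le_one_le)
    qed
    let ?N = "LBINT x:{0<..}. \<bar>?h x\<bar>"
    have N: "?N \<ge> 0" unfolding set_lebesgue_integral_def by (intro integral_nonneg_AE) auto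
    have small: "\<bar>LBINT x:{0<..}. p (exp (- x)) * ?h x\<bar> \<le> e" if e: "e > 0" for e
    proof -
      \<comment> \<open>As \<open>x\<close> runs over the positive reals, \<open>exp (- x)\<close>
        stays in the compact interval \<open>{0..1}\<close>, where polynomial approximation is
        uniform. The denominator \<open>?N + 1\<close> turns the uniform error into an error of at
        most \<open>e\<close> between the integrals, also when \<open>?N = 0\<close>.\<close>
      obtain q where q: "real_polynomial_function q" "\<And>x. x \<in> {0..1} \<Longrightarrow> \<bar>p x - q x\<bar> < e / (?N + 1)"
        using Stone_Weierstrass_real_polynomial_function[of "{0..1}" p "e / (?N + 1)"] e N p(1)
        using continuous_on_subset[OF p(1) subset_UNIV] by (auto simp: field_simps)
      note qi = poly[OF q(1)]
      have d: "set_integrable lborel {0<..} (\<lambda>x. (p (exp (- x)) * ?h x) - q (exp (- x)) * ?h x)"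
        using int_p qi by (intro set_integral_diff) auto
      have "\<bar>LBINT x:{0<..}. p (exp (- x)) * ?h x\<bar> = \<bar>LBINT x:{0<..}. (p (exp (- x)) * ?h x) - q (exp (- x)) * ?h x\<bar>"
        using int_p qi by (subst set_integral_diff) auto
      also have "\<dots> \<le> (LBINT x:{0<..}. \<bar>(p (exp (- x)) * ?h x) - q (exp (- x)) * ?h x\<bar>)"
        using set_integral_norm_bound[OF d] by simp
      also have "\<dots> \<le> (LBINT x:{0<..}. (e / (?N + 1)) * \<bar>?h x\<bar>)"
      proof (rule set_integral_mono)
        show "set_integrable lborel {0<..} (\<lambda>x. \<bar>p (exp (- x)) * ?h x - q (exp (- x)) * ?h x\<bar>)"
          by (rule set_integrable_abs[OF d])
        show "set_integrable lborel {0<..} (\<lambda>x. e / (?N + 1) * \<bar>?h x\<bar>)"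
          by (rule set_integrable_mult_right) (rule set_integrable_abs[OF h_int])
        fix x :: real assume "x \<in> {0<..}"
        hence le: "\<bar>p (exp (- x)) - q (exp (- x))\<bar> \<le> e / (?N + 1)" by (intro less_imp_le q) auto
        have "\<bar>p (exp (- x)) * ?h x - q (exp (- x)) * ?h x\<bar> = \<bar>p (exp (- x)) - q (exp (- x))\<bar> * \<bar>?h x\<bar>"
          by (simp only: left_diff_distrib[symmetric] abs_mult)
        also have "\<dots> \<le> e / (?N + 1) * \<bar>?h x\<bar>"
          by (rule mult_right_mono[OF le abs_ge_zero])
        finally show "\<bar>p (exp (- x)) * ?h x - q (exp (- x)) * ?h x\<bar> \<le> e / (?N + 1) * \<bar>?h x\<bar>" .
      qed
      also have "\<dots> = e / (?N + 1) * ?N" by (rule set_integral_mult_right)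
      also have "\<dots> \<le> e" using N e by (simp add: field_simps)
      finally show ?thesis .
    qed
    have "\<bar>LBINT x:{0<..}. p (exp (- x)) * ?h x\<bar> \<le> 0"
      by (rule field_le_epsilon, subst add_0_left, rule small)
    thus "(LBINT x:{0<..}. p (exp (- x)) * ?h x) = 0" by simp
  qed
  \<comment> \<open>The sign \<epsilon> lets one argument refute both \<open>g x0 > 0\<close> and
    \<open>g x0 < 0\<close>: a bump function in \<open>exp (- x)\<close> concentrated near
    \<open>x0\<close> would have a nonzero integral against \<open>?h\<close>.\<close>
  have main: "h0 \<le> 0" if h0: "h0 = \<epsilon> * g x0" and eps: "\<epsilon> \<in> {-1,1::real}" for h0 \<epsilon>
  proof (rule ccontr)
    assume "\<not> h0 \<le> 0"
    hence pos: "\<epsilon> * g x0 > 0" using h0 by simp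
    have "continuous_on {0<..} (\<lambda>x. \<epsilon> * g x)" using cont by (intro continuous_intros)
    hence "open ((\<lambda>x. \<epsilon> * g x) -` {0<..} \<inter> {0<..})"
      by (subst (asm) continuous_on_open_vimage) auto
    moreover have "x0 \<in> (\<lambda>x. \<epsilon> * g x) -` {0<..} \<inter> {0<..}" using pos x0 by auto
    ultimately obtain d where d: "d > 0" "ball x0 d \<subseteq> (\<lambda>x. \<epsilon> * g x) -` {0<..} \<inter> {0<..}"
      using open_contains_ball by blast
    \<comment> \<open>A radius around \<open>exp (- x0)\<close> so small that the bump, seen as a
      function of \<open>x\<close>, is supported in \<open>ball x0 d\<close>, where the sign of
      \<open>g\<close> is known.\<close>
    define r where "r = min (exp (- x0) - exp (- (x0 + d))) (exp (- (x0 - d)) - exp (- x0))"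
    have r: "r > 0" using d by (auto simp: r_def)
    define p where "p = (\<lambda>y. min 1 (max 0 (r - \<bar>y - exp (- x0)\<bar>)))"
    have pc: "continuous_on UNIV p" unfolding p_def by (intro continuous_intros)
    have p1: "\<bar>p x\<bar> \<le> 1" for x by (auto simp: p_def)
    note c = cts[OF pc p1]
    have nz: "p (exp (- x)) > 0 \<Longrightarrow> x \<in> ball x0 d" for x
    proof -
      assume "p (exp (- x)) > 0"
      hence "\<bar>exp (- x) - exp (- x0)\<bar> < r" by (auto simp: p_def)
      hence "exp (- x) > exp (- (x0 + d))" "exp (- x) < exp (- (x0 - d))"
        unfolding r_def by linarith+
      thus ?thesis by (auto simp: dist_real_def abs_if)
    qed
    have p0: "p x \<ge> 0" for x by (auto simp: p_def)
    have "\<epsilon> * (p (exp (- x0)) * ?h x0) = 0"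
    proof (rule set_integral_eq_0_imp_eq_0[where f = "\<lambda>x. \<epsilon> * (p (exp (- x)) * ?h x)"])
      show "set_integrable lborel {0<..} (\<lambda>x. \<epsilon> * (p (exp (- x)) * ?h x))"
        using c by (intro set_integrable_mult_right) auto
      show "(LBINT x:{0<..}. \<epsilon> * (p (exp (- x)) * ?h x)) = 0"
        using c by (subst set_integral_mult_right) auto
      show "continuous_on {0<..} (\<lambda>x. \<epsilon> * (p (exp (- x)) * ?h x))"
        unfolding p_def by (intro continuous_intros cont)
      fix x :: real assume "x > 0"
      show "\<epsilon> * (p (exp (- x)) * ?h x) \<ge> 0"
      proof (cases "p (exp (- x)) > 0")
        case True
        hence "\<epsilon> * g x > 0" using nz d by blast
        hence "(p (exp (- x)) * exp (- (c * x))) * (\<epsilon> * g x) \<ge> 0" using p0 by auto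
        thus ?thesis by (simp add: mult_ac)
      qed (use p0[of "exp (- x)"] in auto)
    qed (fact x0)
    moreover have "p (exp (- x0)) > 0" using r by (auto simp: p_def)
    ultimately show False using pos by auto
  qed
  show ?thesis using main[of "g x0" 1] main[of "- g x0" "-1"] by auto
qed

lemma laplace_eq_0_imp_eq_0:
  fixes g :: "real \<Rightarrow> complex"
  assumes cont: "continuous_on {0<..} g"
    and int: "\<And>k::nat. set_integrable lborel {0<..} (\<lambda>x. of_real (exp (- ((c + k) * x))) * g x)"
    and zero: "\<And>k::nat. (LBINT x:{0<..}. of_real (exp (- ((c + k) * x))) * g x) = 0"
    and x0: "x0 > 0"
  shows "g x0 = 0"
proof -
  have i: "integrable lborel (\<lambda>x. indicator {0<..} x *\<^sub>R (of_real (exp (- ((c + k) * x))) * g x))" for k :: nat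
    using int by (simp add: set_integrable_def)
  have "Re (g x0) = 0"
  proof (rule laplace_eq_0_imp_eq_0_real[OF _ _ _ x0])
    show "continuous_on {0<..} (\<lambda>x. Re (g x))" by (intro continuous_intros cont)
    fix k :: nat
    show "set_integrable lborel {0<..} (\<lambda>x. exp (- ((c + k) * x)) * Re (g x))"
      using integrable_Re[OF i[of k]] by (simp add: set_integrable_def)
    show "(LBINT x:{0<..}. exp (- ((c + k) * x)) * Re (g x)) = 0"
      using integral_Re[OF i[of k]] zero[of k] by (simp add: set_lebesgue_integral_def)
  qed
  moreover have "Im (g x0) = 0"
  proof (rule laplace_eq_0_imp_eq_0_real[OF _ _ _ x0])
    show "continuous_on {0<..} (\<lambda>x. Im (g x))" by (intro continuous_intros cont)
    fix k :: nat
    show "set_integrable lborel {0<..} (\<lambda>x. exp (- ((c + k) * x)) * Im (g x))"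
      using integrable_Im[OF i[of k]] by (simp add: set_integrable_def)
    show "(LBINT x:{0<..}. exp (- ((c + k) * x)) * Im (g x)) = 0"
      using integral_Im[OF i[of k]] zero[of k] by (simp add: set_lebesgue_integral_def)
  qed
  ultimately show ?thesis by (simp add: complex_eq_iff)
qed

section \<open>The functional equation of the theta series\<close>

lemma set_integral_suminf:
  fixes f :: "nat \<Rightarrow> 'a \<Rightarrow> 'b :: {banach, second_countable_topology}"
  assumes int: "\<And>n. set_integrable M A (f n)"
    and summ: "\<And>x. x \<in> A \<Longrightarrow> summable (\<lambda>n. norm (f n x))"
    and sums: "summable (\<lambda>n. LINT x:A|M. norm (f n x))"
  shows "set_integrable M A (\<lambda>x. \<Sum>n. f n x)"
    and "(\<lambda>n. LINT x:A|M. f n x) sums (LINT x:A|M. \<Sum>n. f n x)"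
proof -
  have eq: "(\<lambda>x. indicator A x *\<^sub>R (\<Sum>n. f n x)) = (\<lambda>x. \<Sum>n. indicator A x *\<^sub>R f n x)"
    by (auto simp: indicator_def fun_eq_iff)
  have 1: "integrable M (\<lambda>x. indicator A x *\<^sub>R f n x)" for n
    using int by (simp add: set_integrable_def)
  have 2: "AE x in M. summable (\<lambda>n. norm (indicator A x *\<^sub>R f n x))"
    using summ by (intro AE_I2) (auto simp: indicator_def)
  have 3: "summable (\<lambda>n. LINT x|M. norm (indicator A x *\<^sub>R f n x))"
    using sums by (simp add: set_lebesgue_integral_def)
  show "set_integrable M A (\<lambda>x. \<Sum>n. f n x)"
    unfolding set_integrable_def eq by (rule integrable_suminf[OF 1 2 3])
  show "(\<lambda>n. LINT x:A|M. f n x) sums (LINT x:A|M. \<Sum>n. f n x)"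
    unfolding set_lebesgue_integral_def eq by (rule sums_integral[OF 1 2 3])
qed

lemma continuous_on_Ioi_suminf:
  fixes f :: "nat \<Rightarrow> real \<Rightarrow> 'b :: banach"
  assumes cont: "\<And>n. continuous_on {0<..} (f n)"
    and bd: "\<And>a b. 0 < a \<Longrightarrow> a < b \<Longrightarrow> \<exists>M. summable M \<and> (\<forall>n. \<forall>x\<in>{a..b}. norm (f n x) \<le> M n)"
  shows "continuous_on {0<..} (\<lambda>x. \<Sum>n. f n x)"
proof (rule continuous_at_imp_continuous_on, safe)
  fix x :: real assume x: "x > 0"
  obtain M where M: "summable M" "\<And>n y. y \<in> {x/2..2*x} \<Longrightarrow> norm (f n y) \<le> M n"
    using bd[of "x/2" "2*x"] x by auto
  have "uniform_limit {x/2..2*x} (\<lambda>n x. \<Sum>i<n. f i x) (\<lambda>x. \<Sum>i. f i x) sequentially"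
    using M by (intro Weierstrass_m_test) auto
  hence "continuous_on {x/2..2*x} (\<lambda>x. \<Sum>i. f i x)"
    by (rule uniform_limit_theorem[rotated])
       (use x in \<open>auto intro!: always_eventually continuous_intros continuous_on_subset[OF cont]\<close>)
  thus "isCont (\<lambda>x. \<Sum>n. f n x) x"
    by (rule continuous_on_interior) (use x in auto)
qed

lemma integral_exp_Ioi:
  fixes a :: real
  assumes "a > 0"
  shows "set_integrable lborel {0<..} (\<lambda>x. exp (- (a * x)))" "(LBINT x:{0<..}. exp (- (a * x))) = 1 / a"
proof -
  have der: "((\<lambda>x. - exp (- (a * x)) / a) has_real_derivative exp (- (a * x))) (at x)" for x
    using assms by (auto intro!: derivative_eq_intros)
  have 0: "((\<lambda>x. - exp (- (a * x)) / a) \<longlongrightarrow> - 1 / a) (at_right 0)"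
    using assms by (auto intro!: tendsto_eq_intros)
  have top: "((\<lambda>x. - exp (- (a * x)) / a) \<longlongrightarrow> 0) at_top" using assms by real_asymp
  note * = FTC_Ioi_nonneg[OF der _ _ 0 top]
  show "set_integrable lborel {0<..} (\<lambda>x. exp (- (a * x)))" by (rule *(1)) auto
  show "(LBINT x:{0<..}. exp (- (a * x))) = 1 / a" by (subst *(2)) auto
qed

text \<open>Logarithmic derivative of Euler's reflection formula
  \<open>Gamma z * Gamma (1 - z) = pi / sin (pi * z)\<close>. It is used twice: for the partial
  fractions behind the theta series and for rewriting \<open>Psi\<close>.\<close>

lemma Digamma_reflection:
  fixes z :: complex
  assumes z: "z \<notin> \<int>"
  shows "Digamma (1 - z) - Digamma z = of_real pi * cot (of_real pi * z)"
proof -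
  have z': "1 - z \<notin> \<int>" using z by (metis Ints_1 Ints_diff diff_diff_eq2 add_diff_cancel_left')
  have nI: "z \<notin> \<int>\<^sub>\<le>\<^sub>0" "1 - z \<notin> \<int>\<^sub>\<le>\<^sub>0" using z z' nonpos_Ints_Int by blast+
  have s: "sin (of_real pi * z) \<noteq> 0"
    using z by (subst sin_eq_0) (auto simp: mult_ac)
  have "((\<lambda>z. Gamma z * Gamma (1 - z)) has_field_derivative
     Gamma z * Gamma (1 - z) * (Digamma z - Digamma (1 - z))) (at z)"
    using nI by (auto intro!: derivative_eq_intros simp: algebra_simps)
  moreover have "((\<lambda>z. of_real pi / sin (of_real pi * z)) has_field_derivative
     - (of_real pi ^ 2 * cos (of_real pi * z) / sin (of_real pi * z) ^ 2)) (at z)"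
    using s by (auto intro!: derivative_eq_intros simp: power2_eq_square)
  ultimately have "Gamma z * Gamma (1 - z) * (Digamma z - Digamma (1 - z)) =
      - (of_real pi ^ 2 * cos (of_real pi * z) / sin (of_real pi * z) ^ 2)"
    unfolding Gamma_reflection_complex by (rule DERIV_unique)
  hence "of_real pi / sin (of_real pi * z) * (Digamma z - Digamma (1 - z)) =
      - (of_real pi ^ 2 * cos (of_real pi * z) / sin (of_real pi * z) ^ 2)"
    unfolding Gamma_reflection_complex .
  hence "(of_real pi * sin (of_real pi * z)) * ((Digamma (1 - z) - Digamma z) * sin (of_real pi * z)) =
      (of_real pi * sin (of_real pi * z)) * (of_real pi * cos (of_real pi * z))"
    using s by (simp add: field_simps power2_eq_square)
  hence "(Digamma (1 - z) - Digamma z) * sin (of_real pi * z) = of_real pi * cos (of_real pi * z)"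
    using s by (subst (asm) mult_cancel_left) auto
  thus ?thesis using s by (simp add: cot_def field_simps)
qed

lemma Digamma_sums:
  assumes "z \<noteq> (0 :: 'a :: {real_normed_field,banach})"
  shows "(\<lambda>k. inverse (of_nat (Suc k)) - inverse (z + of_nat k)) sums (Digamma z + euler_mascheroni)"
  using summable_Digamma[OF assms] by (simp add: Digamma_def summable_sums)

text \<open>The reflection formula at \<open>z = \<i> * y\<close>: subtracting the digamma series at
  \<open>1 + z\<close> and \<open>1 - z\<close> cancels the terms \<open>1 / (k + 1)\<close> and
  combines the other two fractions over the real denominator \<open>(k + 1)^2 + y^2\<close>.\<close>

lemma coth_partial_fractions:
  fixes y :: real
  assumes y: "y > 0"
  shows "(\<lambda>k. 2 * y / (real (Suc k) ^ 2 + y ^ 2)) sums (pi * cosh (pi * y) / sinh (pi * y) - 1 / y)"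
proof -
  define z where "z = \<i> * of_real y"
  have nz: "1 + z \<noteq> 0" "1 - z \<noteq> 0" "z \<noteq> 0" using y by (auto simp: z_def complex_eq_iff)
  have "z \<notin> \<int>" using y by (auto simp: z_def elim!: Ints_cases simp: complex_eq_iff)
  note refl = Digamma_reflection[OF this]
  have "(\<lambda>k. inverse (1 + z + of_nat k) - inverse (1 - z + of_nat k)) sums (Digamma (1 - z) - Digamma (1 + z))"
    using sums_diff[OF Digamma_sums[OF nz(2)] Digamma_sums[OF nz(1)]] by simp
  \<comment> \<open>Reflection involves \<open>Digamma z\<close>; the shift to \<open>1 + z\<close>
    produces the term \<open>1 / z\<close>, which becomes the \<open>1 / y\<close> of the
    statement.\<close>
  also have "Digamma (1 - z) - Digamma (1 + z) = of_real pi * cot (of_real pi * z) - 1 / z"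
    using refl Digamma_plus1[OF nz(3)] by (simp add: add.commute algebra_simps)
  finally have "(\<lambda>k. \<i> * (inverse (1 + z + of_nat k) - inverse (1 - z + of_nat k))) sums
       (\<i> * (of_real pi * cot (of_real pi * z) - 1 / z))" by (rule sums_mult)
  also have "(\<lambda>k. \<i> * (inverse (1 + z + of_nat k) - inverse (1 - z + of_nat k))) =
     (\<lambda>k. of_real (2 * y / (real (Suc k) ^ 2 + y ^ 2)))"
  proof
    fix k
    have ne: "1 + z + of_nat k \<noteq> 0" "1 - z + of_nat k \<noteq> 0" using y by (auto simp: z_def complex_eq_iff)
    have "(1 + z + of_nat k) * (1 - z + of_nat k) = of_real (real (Suc k) ^ 2 + y ^ 2)"
      by (simp add: z_def algebra_simps power2_eq_square)
    moreover have "inverse (1 + z + of_nat k) - inverse (1 - z + of_nat k) =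
       - (2 * z) / ((1 + z + of_nat k) * (1 - z + of_nat k))"
      using ne by (simp add: field_simps)
    ultimately have "\<i> * (inverse (1 + z + of_nat k) - inverse (1 - z + of_nat k)) =
       (\<i> * - (2 * z)) / of_real (real (Suc k) ^ 2 + y ^ 2)" by simp
    also have "\<i> * - (2 * z) = of_real (2 * y)" by (simp add: z_def)
    finally show "\<i> * (inverse (1 + z + of_nat k) - inverse (1 - z + of_nat k)) = of_real (2 * y / (real (Suc k) ^ 2 + y ^ 2))"
      by simp
  qed
  also have "\<i> * (of_real pi * cot (of_real pi * z) - 1 / z) = of_real (pi * cosh (pi * y) / sinh (pi * y) - 1 / y)"
  proof -
    have "of_real pi * z = \<i> * of_real (pi * y)" by (simp add: z_def)
    moreover have "cos (\<i> * of_real (pi * y)) = of_real (cosh (pi * y))"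
      "sin (\<i> * of_real (pi * y)) = \<i> * of_real (sinh (pi * y))"
      by (simp_all add: cosh_conv_cos sinh_conv_sin cosh_def sinh_def cos_exp_eq sin_exp_eq exp_of_real[symmetric] exp_minus field_simps scaleR_conv_of_real)
    moreover have "sinh (pi * y) \<noteq> 0" using y by simp
    ultimately show ?thesis using y unfolding z_def by (simp add: cot_def field_simps)
  qed
  finally show ?thesis by (subst (asm) sums_of_real_iff)
qed

text \<open>Half of the Jacobi theta series without its constant term: the terms at \<open>n\<close>
  and \<open>- n\<close> agree, so the full sum over the integers is
  \<open>1 + 2 * theta_tail t\<close>. The index is shifted so that summation starts at 1.\<close>

definition theta_tail :: "real \<Rightarrow> real" where
  "theta_tail t = (\<Sum>n. exp (- (pi * real (Suc n) ^ 2 * t)))"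

lemma exp_square_le:
  assumes "t \<ge> 0"
  shows "exp (- (pi * real (Suc n) ^ 2 * t)) \<le> exp (- (pi * t)) * exp (- (pi * t)) ^ n"
proof -
  have "real (Suc n) \<le> real (Suc n) ^ 2" by (simp add: power2_eq_square)
  hence "pi * real (Suc n) * t \<le> pi * real (Suc n) ^ 2 * t" using assms
    by (intro mult_right_mono mult_left_mono) auto
  hence "exp (- (pi * real (Suc n) ^ 2 * t)) \<le> exp (- (pi * real (Suc n) * t))" by simp
  also have "\<dots> = exp (- (pi * t)) * exp (- (pi * t)) ^ n"
    by (simp add: exp_of_nat_mult[symmetric] exp_add[symmetric] algebra_simps)
  finally show ?thesis .
qed

lemma summable_theta_tail:
  assumes "t > 0" shows "summable (\<lambda>n. exp (- (pi * real (Suc n) ^ 2 * t)))"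
proof (rule summable_comparison_test')
  show "summable (\<lambda>n. exp (- (pi * t)) * exp (- (pi * t)) ^ n)"
    using assms by (intro summable_mult summable_geometric) auto
  show "norm (exp (- (pi * real (Suc n) ^ 2 * t))) \<le> exp (- (pi * t)) * exp (- (pi * t)) ^ n" for n
    using exp_square_le[of t n] assms by simp
qed

lemma theta_tail_nonneg: "t > 0 \<Longrightarrow> theta_tail t \<ge> 0"
  unfolding theta_tail_def by (intro suminf_nonneg summable_theta_tail) auto

text \<open>Since \<open>n^2 \<ge> n\<close>, the series is dominated by a geometric one, whose
  ratio \<open>exp (- (pi * t))\<close> is at most \<open>1 / 2\<close> for
  \<open>t \<ge> 1\<close>; hence the factor 2.\<close>

lemma theta_tail_le:
  assumes "t \<ge> 1" shows "theta_tail t \<le> 2 * exp (- (pi * t))"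
proof -
  have e: "exp (- (pi * t)) \<le> 1 / 2"
  proof -
    have "1 \<le> pi * t" using assms pi_ge_two by (smt (verit) mult_le_cancel_left1 mult_mono)
    hence "exp (- (pi * t)) \<le> exp (-1)" by simp
    also have "\<dots> \<le> 1 / 2" using exp_ge_add_one_self[of 1] by (simp add: exp_minus field_simps)
    finally show ?thesis .
  qed
  have "theta_tail t \<le> (\<Sum>n. exp (- (pi * t)) * exp (- (pi * t)) ^ n)"
    unfolding theta_tail_def using assms
    by (intro suminf_le exp_square_le summable_theta_tail summable_mult summable_geometric) auto
  also have "\<dots> = exp (- (pi * t)) * (1 / (1 - exp (- (pi * t))))"
    using assms by (subst suminf_mult) (auto intro!: summable_geometric simp: suminf_geometric)
  also have "\<dots> \<le> exp (- (pi * t)) * 2" using e assms by (intro mult_left_mono) (auto simp: divide_le_eq mult_less_0_iff)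
  finally show ?thesis by simp
qed

lemma continuous_on_theta_tail: "continuous_on {0<..} theta_tail"
  unfolding theta_tail_def[abs_def]
proof (rule continuous_on_Ioi_suminf)
  fix a b :: real assume ab: "0 < a" "a < b"
  show "\<exists>M. summable M \<and> (\<forall>n. \<forall>x\<in>{a..b}. norm (exp (- (pi * real (Suc n) ^ 2 * x))) \<le> M n)"
    by (rule exI[of _ "\<lambda>n. exp (- (pi * real (Suc n) ^ 2 * a))"])
       (use ab in \<open>auto intro!: summable_theta_tail[of a, simplified] mult_left_mono\<close>)
qed (intro continuous_intros)

text \<open>Both sides have the Laplace transform \<open>\<surd>\<pi> coth (\<surd>\<pi> s) / s\<close> at \<open>s\<^sup>2\<close>: on the left by
  the partial fractions of the hyperbolic cotangent, on the right by a geometric series.\<close>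

theorem theta_tail_functional_equation:
  assumes t: "t > 0"
  shows "1 + 2 * theta_tail t = (1 + 2 * theta_tail (1 / t)) / sqrt t"
proof -
  define L where "L = (\<lambda>s::real. sqrt pi * cosh (sqrt pi * s) / sinh (sqrt pi * s) / s)"
  have left: "set_integrable lborel {0<..} (\<lambda>x. exp (- (s\<^sup>2 * x)) * (1 + 2 * theta_tail x)) \<and>
      (LBINT x:{0<..}. exp (- (s\<^sup>2 * x)) * (1 + 2 * theta_tail x)) = L s" if s: "s > 0" for s
  proof -
    let ?f = "\<lambda>n x. exp (- ((s\<^sup>2 + pi * real (Suc n) ^ 2) * x))"
    have eq: "?f n x = exp (- (s\<^sup>2 * x)) * exp (- (pi * real (Suc n) ^ 2 * x))" for n x
      by (simp add: exp_add[symmetric] algebra_simps)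
    have pos: "s\<^sup>2 + pi * real (Suc n) ^ 2 > 0" for n using s by (intro add_pos_nonneg) auto
    have sm: "(\<lambda>n. 1 / (s\<^sup>2 + pi * real (Suc n) ^ 2)) sums ((L s - 1 / s\<^sup>2) / 2)"
    proof -
      \<comment> \<open>Rescaling by \<open>sqrt pi\<close> makes
        \<open>pi * ((n + 1)^2 + ?y^2)\<close> the denominator \<open>s^2 + pi * (n + 1)^2\<close>,
        and \<open>pi * ?y\<close> the argument \<open>sqrt pi * s\<close> in
        \<open>L\<close>.\<close>
      let ?y = "s / sqrt pi"
      have py: "pi * ?y = sqrt pi * s" by (simp add: real_div_sqrt field_simps)
      have "(\<lambda>n. 1 / (2 * s * sqrt pi) * (2 * ?y / (real (Suc n) ^ 2 + ?y ^ 2))) sums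
         (1 / (2 * s * sqrt pi) * (pi * cosh (pi * ?y) / sinh (pi * ?y) - 1 / ?y))"
        using s by (intro sums_mult coth_partial_fractions) auto
      also have "(\<lambda>n. 1 / (2 * s * sqrt pi) * (2 * ?y / (real (Suc n) ^ 2 + ?y ^ 2))) =
         (\<lambda>n. 1 / (s\<^sup>2 + pi * real (Suc n) ^ 2))"
      proof
        fix n
        have "1 / (2 * s * sqrt pi) * (2 * ?y / (real (Suc n) ^ 2 + ?y ^ 2)) = 1 / (pi * (real (Suc n) ^ 2 + ?y ^ 2))"
          using s by (simp add: divide_simps)
        also have "pi * (real (Suc n) ^ 2 + ?y ^ 2) = s\<^sup>2 + pi * real (Suc n) ^ 2"
          by (simp add: power_divide algebra_simps)
        finally show "1 / (2 * s * sqrt pi) * (2 * ?y / (real (Suc n) ^ 2 + ?y ^ 2)) = 1 / (s\<^sup>2 + pi * real (Suc n) ^ 2)" .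
      qed
      also have "1 / (2 * s * sqrt pi) * (pi * cosh (pi * ?y) / sinh (pi * ?y) - 1 / ?y) = (L s - 1 / s\<^sup>2) / 2"
      proof -
        have "pi = sqrt pi * sqrt pi" by simp
        hence "1 / (2 * s * sqrt pi) * (pi * c - 1 / ?y) = (sqrt pi * c / s - 1 / s\<^sup>2) / 2" for c
          using s by (simp add: field_simps power2_eq_square)
        from this[of "cosh (sqrt pi * s) / sinh (sqrt pi * s)"] show ?thesis unfolding py L_def by simp
      qed
      finally show ?thesis .
    qed
    have i: "(LBINT x:{0<..}. ?f n x) = 1 / (s\<^sup>2 + pi * real (Suc n) ^ 2)" for n
      by (rule integral_exp_Ioi(2)[OF pos])
    have A: "set_integrable lborel {0<..} (\<lambda>x. \<Sum>n. ?f n x)"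
      "(\<lambda>n. LBINT x:{0<..}. ?f n x) sums (LBINT x:{0<..}. \<Sum>n. ?f n x)"
    proof -
      have 1: "set_integrable lborel {0<..} (?f n)" for n by (rule integral_exp_Ioi(1)[OF pos])
      have 2: "summable (\<lambda>n. norm (?f n x))" if "x \<in> {0<..}" for x
        unfolding eq using that by (auto intro!: summable_mult summable_theta_tail[simplified])
      have 3: "summable (\<lambda>n. LBINT x:{0<..}. norm (?f n x))"
        using sm by (simp only: real_norm_def abs_exp_cancel i) (rule sums_summable)
      show "set_integrable lborel {0<..} (\<lambda>x. \<Sum>n. ?f n x)"
      "(\<lambda>n. LBINT x:{0<..}. ?f n x) sums (LBINT x:{0<..}. \<Sum>n. ?f n x)"
        using set_integral_suminf[of lborel "{0<..}" ?f, OF 1 2 3] by blast+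
    qed
    have S: "(\<Sum>n. ?f n x) = exp (- (s\<^sup>2 * x)) * theta_tail x" if "x > 0" for x
      unfolding eq theta_tail_def using that by (intro suminf_mult summable_theta_tail)
    have B: "set_integrable lborel {0<..} (\<lambda>x. exp (- (s\<^sup>2 * x)) * theta_tail x)"
      using A(1) by (rule set_integrable_cong[THEN iffD1, rotated -1]) (auto simp: S simp del: of_nat_Suc)
    have C: "(LBINT x:{0<..}. exp (- (s\<^sup>2 * x)) * theta_tail x) = (L s - 1 / s\<^sup>2) / 2"
    proof -
      have "(LBINT x:{0<..}. exp (- (s\<^sup>2 * x)) * theta_tail x) = (LBINT x:{0<..}. \<Sum>n. ?f n x)"
        by (rule set_lebesgue_integral_cong) (auto simp: S simp del: of_nat_Suc)
      thus ?thesis using sums_unique2[OF A(2)] sm unfolding i by simp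
    qed
    have s2: "s\<^sup>2 > 0" using s by simp
    note D = integral_exp_Ioi[OF s2]
    have eq3: "(\<lambda>x. exp (- (s\<^sup>2 * x)) * (1 + 2 * theta_tail x)) =
       (\<lambda>x. exp (- (s\<^sup>2 * x)) + 2 * (exp (- (s\<^sup>2 * x)) * theta_tail x))" by (auto simp: algebra_simps)
    show ?thesis unfolding eq3 using B C D by (auto simp: set_integral_add)
  qed
  have right: "set_integrable lborel {0<..} (\<lambda>x. exp (- (s\<^sup>2 * x)) * ((1 + 2 * theta_tail (1 / x)) / sqrt x)) \<and>
      (LBINT x:{0<..}. exp (- (s\<^sup>2 * x)) * ((1 + 2 * theta_tail (1 / x)) / sqrt x)) = L s" if s: "s > 0" for s
  proof -
    \<comment> \<open>Chosen so that \<open>(a n)^2 / (4 * x)\<close> is the exponent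
      \<open>pi * (n + 1)^2 / x\<close> of the series at \<open>1 / x\<close>; the transforms then
      form a geometric series of ratio \<open>exp (- (2 * sqrt pi * s))\<close>.\<close>
    define a where "a = (\<lambda>n. 2 * sqrt pi * real (Suc n))"
    have a0: "a n \<ge> 0" for n by (simp add: a_def)
    let ?f = "\<lambda>n x. exp (- (s\<^sup>2 * x)) * (exp (- ((a n)\<^sup>2 / (4 * x))) / sqrt x)"
    have aeq: "(a n)\<^sup>2 / (4 * x) = pi * real (Suc n) ^ 2 * (1 / x)" for n x
      by (simp add: a_def power_mult_distrib)
    note L1 = laplace_gauss[OF s a0]
    define q where "q = exp (- (2 * sqrt pi * s))"
    have q: "0 < q" "q < 1" using s by (auto simp: q_def)
    have qn: "exp (- (s * a n)) = q * q ^ n" for n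
      by (simp add: q_def a_def exp_of_nat_mult[symmetric] exp_add[symmetric] algebra_simps)
    have sm: "(\<lambda>n. sqrt pi * exp (- (s * a n)) / s) sums (sqrt pi / s * (q * (1 / (1 - q))))"
    proof -
      have "(\<lambda>n. sqrt pi / s * (q * q ^ n)) sums (sqrt pi / s * (q * (1 / (1 - q))))"
        using q by (intro sums_mult geometric_sums) auto
      thus ?thesis unfolding qn by (simp add: mult_ac)
    qed
    have S: "(\<lambda>n. ?f n x) sums (exp (- (s\<^sup>2 * x)) * (theta_tail (1 / x) / sqrt x))" if "x > 0" for x
      unfolding theta_tail_def aeq using that
      by (intro sums_mult sums_divide summable_sums summable_theta_tail) auto
    have A: "set_integrable lborel {0<..} (\<lambda>x. \<Sum>n. ?f n x)"
      "(\<lambda>n. LBINT x:{0<..}. ?f n x) sums (LBINT x:{0<..}. \<Sum>n. ?f n x)"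
    proof -
      have nn: "(LBINT x:{0<..}. norm (?f n x)) = (LBINT x:{0<..}. ?f n x)" for n
        by (rule set_lebesgue_integral_cong) auto
      have 2: "summable (\<lambda>n. norm (?f n x))" if "x \<in> {0<..}" for x
        using S[of x] that by (simp add: sums_iff)
      have 3: "summable (\<lambda>n. LBINT x:{0<..}. norm (?f n x))"
        using sm unfolding nn L1(2) by (rule sums_summable)
      show "set_integrable lborel {0<..} (\<lambda>x. \<Sum>n. ?f n x)"
      "(\<lambda>n. LBINT x:{0<..}. ?f n x) sums (LBINT x:{0<..}. \<Sum>n. ?f n x)"
        using set_integral_suminf[of lborel "{0<..}" ?f, OF L1(1) 2 3] by blast+
    qed
    have B: "set_integrable lborel {0<..} (\<lambda>x. exp (- (s\<^sup>2 * x)) * (theta_tail (1 / x) / sqrt x))"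
      using A(1) by (rule set_integrable_cong[THEN iffD1, rotated -1]) (use S in \<open>auto simp: sums_iff\<close>)
    have C: "(LBINT x:{0<..}. exp (- (s\<^sup>2 * x)) * (theta_tail (1 / x) / sqrt x)) = sqrt pi / s * (q * (1 / (1 - q)))"
    proof -
      have "(LBINT x:{0<..}. exp (- (s\<^sup>2 * x)) * (theta_tail (1 / x) / sqrt x)) = (LBINT x:{0<..}. \<Sum>n. ?f n x)"
        by (rule set_lebesgue_integral_cong) (use S in \<open>auto simp: sums_iff\<close>)
      thus ?thesis using sums_unique2[OF A(2)] sm unfolding L1(2) by simp
    qed
    note D = laplace_gauss[OF s order_refl, simplified]
    have eq3: "(\<lambda>x. exp (- (s\<^sup>2 * x)) * ((1 + 2 * theta_tail (1 / x)) / sqrt x)) =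
       (\<lambda>x. exp (- (s\<^sup>2 * x)) / sqrt x + 2 * (exp (- (s\<^sup>2 * x)) * (theta_tail (1 / x) / sqrt x)))"
      by (auto simp: algebra_simps add_divide_distrib)
    \<comment> \<open>This is \<open>1 + 2 * q / (1 - q) = coth (sqrt pi * s)\<close>, where the
      summand 1 comes from the constant term of the theta series.\<close>
    have fin: "sqrt pi / s + 2 * (sqrt pi / s * (q * (1 / (1 - q)))) = L s"
    proof -
      define p where "p = exp (sqrt pi * s)"
      have p: "p > 1" using s by (auto simp: p_def)
      have qp: "q = 1 / p ^ 2"
        by (simp add: q_def p_def exp_minus inverse_eq_divide exp_double[symmetric] mult_ac)
      have "p ^ 2 > 1" "p * p \<noteq> 1" using p less_1_mult[of p p] by auto
      have ch: "cosh (sqrt pi * s) = (p + 1 / p) / 2" "sinh (sqrt pi * s) = (p - 1 / p) / 2"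
        by (simp_all add: cosh_def sinh_def p_def exp_minus inverse_eq_divide)
      have "L s = sqrt pi * ((p + 1 / p) / (p - 1 / p)) / s"
        unfolding L_def ch by simp
      also have "(p + 1 / p) / (p - 1 / p) = 1 + 2 * (q * (1 / (1 - q)))"
        unfolding qp using p \<open>p ^ 2 > 1\<close> \<open>p * p \<noteq> 1\<close> by (simp add: divide_simps) (auto simp: power2_eq_square algebra_simps)
      finally show ?thesis by (simp add: distrib_left add_divide_distrib mult_ac)
    qed
    have B2: "set_integrable lborel {0<..} (\<lambda>x. 2 * (exp (- (s\<^sup>2 * x)) * (theta_tail (1 / x) / sqrt x)))"
      by (rule set_integrable_mult_right) (rule B)
    show ?thesis unfolding eq3
      using set_integral_add(1)[OF D(1) B2] set_integral_add(2)[OF D(1) B2] C D(2) fin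
      unfolding set_integral_mult_right by (simp only: simp_thms)
  qed
  have sq: "sqrt (1 + real k) ^ 2 = 1 + real k" for k by simp
  have "(1 + 2 * theta_tail t) - (1 + 2 * theta_tail (1 / t)) / sqrt t = 0"
  \<comment> \<open>The transforms are known at \<open>s^2\<close> for \<open>s > 0\<close>; the
    sampling points \<open>1 + k\<close> are reached with \<open>s = sqrt (1 + k)\<close>.\<close>
  proof (rule laplace_eq_0_imp_eq_0_real[where c = 1, OF _ _ _ t])
    have "continuous_on {0<..} (\<lambda>x::real. theta_tail (1 / x))"
      by (rule continuous_on_compose2[OF continuous_on_theta_tail]) (auto intro!: continuous_intros)
    thus "continuous_on {0<..} (\<lambda>x. 1 + 2 * theta_tail x - (1 + 2 * theta_tail (1 / x)) / sqrt x)"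
      by (intro continuous_intros continuous_on_theta_tail) auto
    fix k :: nat
    have s: "sqrt (1 + real k) > 0" by simp
    note lr = left[OF s, unfolded sq] right[OF s, unfolded sq]
    show "set_integrable lborel {0<..} (\<lambda>x. exp (- ((1 + real k) * x)) *
        (1 + 2 * theta_tail x - (1 + 2 * theta_tail (1 / x)) / sqrt x))"
      unfolding right_diff_distrib[of "exp _"] by (intro set_integral_diff conjunct1[OF lr(1)] conjunct1[OF lr(2)])
    show "(LBINT x:{0<..}. exp (- ((1 + real k) * x)) *
        (1 + 2 * theta_tail x - (1 + 2 * theta_tail (1 / x)) / sqrt x)) = 0"
      unfolding right_diff_distrib[of "exp _"]
      by (subst set_integral_diff(2)[OF conjunct1[OF lr(1)] conjunct1[OF lr(2)]])
         (simp only: conjunct2[OF lr(1)] conjunct2[OF lr(2)] diff_self)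
  qed
  thus ?thesis by simp
qed

section \<open>Logarithmic derivatives of entire functions of exponential type zero\<close>

text \<open>Induction on \<open>Z\<close>, one zero at a time: the quotient by
  \<open>(u - z)^m\<close> has a removable singularity at \<open>z\<close>. The point
  \<open>w\<close> with \<open>f w \<noteq> 0\<close> excludes the zero function, so that every
  order is finite.\<close>

lemma holomorphic_factor_out_zeros:
  fixes f :: "complex \<Rightarrow> complex"
  assumes f: "f holomorphic_on UNIV" and nz: "f w \<noteq> 0" and "finite Z"
  shows "\<exists>g. g holomorphic_on UNIV \<and> (\<forall>u. f u = (\<Prod>z\<in>Z. (u - z) ^ nat (zorder f z)) * g u) \<and>
    (\<forall>z\<in>Z. g z \<noteq> 0)"
  using \<open>finite Z\<close>
proof (induction Z rule: finite_induct)
  case empty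
  show ?case using f by (intro exI[of _ f]) auto
next
  case (insert z Z)
  define P where "P = (\<lambda>u. \<Prod>z\<in>Z. (u - z) ^ nat (zorder f z))"
  define m where "m = nat (zorder f z)"
  from insert.IH obtain g where g: "g holomorphic_on UNIV" "\<And>u. f u = P u * g u" "\<And>z. z \<in> Z \<Longrightarrow> g z \<noteq> 0"
    unfolding P_def by blast
  define h where "h = zor_poly f z"
  obtain r where r: "r > 0" "h holomorphic_on cball z r"
    "\<And>u. u \<in> cball z r \<Longrightarrow> f u = h u * (u - z) ^ m" "\<And>u. u \<in> cball z r \<Longrightarrow> h u \<noteq> 0"
  proof -
    have "\<exists>w\<in>UNIV. f w \<noteq> 0" using nz by blast
    from zorder_exist_zero[OF f open_UNIV connected_UNIV UNIV_I this, of z] show ?thesis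
      using that unfolding m_def h_def by blast
  qed
  have P: "P holomorphic_on A" for A unfolding P_def by (intro holomorphic_intros)
  have P0: "P u = 0 \<Longrightarrow> u \<in> Z" for u using insert.hyps unfolding P_def by auto
  have Pz: "P z \<noteq> 0" using P0 insert.hyps by blast
  \<comment> \<open>Near \<open>z\<close> the local factorisation gives
    \<open>P u * g u = h u * (u - z)^m\<close>, so the quotient continues as \<open>h / P\<close>,
    whose value at \<open>z\<close> is nonzero.\<close>
  define g' where "g' = (\<lambda>u. if u = z then h z / P z else g u / (u - z) ^ m)"
  have "g' holomorphic_on UNIV"
  proof (rule no_isolated_singularity'[where K = "{z}"])
    have "(\<lambda>u. g u / (u - z) ^ m) holomorphic_on UNIV - {z}"
      by (intro holomorphic_intros holomorphic_on_subset[OF g(1)]) auto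
    thus "g' holomorphic_on UNIV - {z}"
      by (rule holomorphic_transform) (auto simp: g'_def)
    fix x assume "x \<in> {z}"
    hence x: "x = z" by simp
    have "isCont P z"
      using P[of UNIV] by (metis UNIV_I continuous_on_eq_continuous_at holomorphic_on_imp_continuous_on open_UNIV)
    moreover have "isCont h z"
      using r holomorphic_on_imp_continuous_on continuous_on_interior[of "cball z r" h z] by auto
    ultimately have lim: "((\<lambda>u. h u / P u) \<longlongrightarrow> h z / P z) (at z)"
      using Pz by (intro tendsto_intros) (auto simp: isCont_def)
    have "\<forall>\<^sub>F u in at z. u \<in> ball z r - {z}"
      using r(1) by (intro eventually_at_in_open) auto
    moreover have "\<forall>\<^sub>F u in at z. P u \<noteq> 0"
      using \<open>isCont P z\<close> Pz by (auto simp: isCont_def intro: tendsto_imp_eventually_ne)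
    ultimately have "\<forall>\<^sub>F u in at z. h u / P u = g' u"
    proof eventually_elim
      case (elim u)
      hence "P u * g u = h u * (u - z) ^ m" using r(3)[of u] g(2)[of u] by auto
      thus ?case using elim by (auto simp: g'_def field_simps)
    qed
    with lim show "(g' \<longlongrightarrow> g' x) (at x within UNIV)"
      unfolding x by (auto simp: g'_def intro: Lim_transform_eventually)
  qed auto
  moreover have "f u = (\<Prod>z\<in>insert z Z. (u - z) ^ nat (zorder f z)) * g' u" for u
  proof (cases "u = z")
    case True
    have "(\<Prod>z'\<in>Z. (z - z') ^ nat (zorder f z')) = P z" by (simp add: P_def)
    thus ?thesis using r(1) r(3)[of z] Pz insert.hyps True by (auto simp: g'_def m_def)
  next
    case False
    have "(\<Prod>z'\<in>Z. (u - z') ^ nat (zorder f z')) = P u" by (simp add: P_def)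
    thus ?thesis using g(2)[of u] insert.hyps False by (auto simp: g'_def m_def)
  qed
  moreover have "g' x \<noteq> 0" if "x \<in> insert z Z" for x
    using that g(3)[of x] r(4)[of z] r(1) Pz insert.hyps by (auto simp: g'_def)
  ultimately show ?case by blast
qed

text \<open>A Borel-Caratheodory estimate at the centre. On the disc \<open>g\<close> has a
  logarithm \<open>h\<close>, and \<open>F v = h (w + R * v) - h w\<close> maps the unit disc to the
  half-plane \<open>Re < A\<close> with \<open>F 0 = 0\<close>. The Schwarz lemma then bounds the
  derivative of \<open>F\<close> at 0, which is \<open>R\<close> times the logarithmic derivative of
  \<open>g\<close> at \<open>w\<close>.\<close>

lemma norm_logderiv_le:
  fixes g :: "complex \<Rightarrow> complex"
  assumes g: "g holomorphic_on ball w R" and R: "R > 0"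
    and nz: "\<And>u. u \<in> ball w R \<Longrightarrow> g u \<noteq> 0"
    and bd: "\<And>u. u \<in> ball w R \<Longrightarrow> norm (g u) < norm (g w) * exp A"
  shows "norm (deriv g w / g w) \<le> 2 * A / R"
proof -
  have gw: "g w \<noteq> 0" using nz R by auto
  have "norm (g w) < norm (g w) * exp A" using bd[of w] R by auto
  hence A: "A > 0" using gw by simp
  obtain h where h: "h holomorphic_on ball w R" "\<And>u. u \<in> ball w R \<Longrightarrow> exp (h u) = g u"
    using holomorphic_logarithm_exists[OF _ _ g nz, of w] R by auto
  define F where "F = (\<lambda>v. h (w + of_real R * v) - h w)"
  have sub: "w + of_real R * v \<in> ball w R" if "norm v < 1" for v
    using that R by (simp add: dist_norm norm_mult)
  have F: "F holomorphic_on ball 0 1"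
    unfolding F_def using sub
    by (intro holomorphic_intros holomorphic_on_compose_gen[OF _ h(1), unfolded o_def]) auto
  have ReF: "Re (F v) < A" if "norm v < 1" for v
  proof -
    have "norm (exp (h (w + of_real R * v))) < norm (exp (h w)) * exp A"
      using bd[OF sub[OF that]] h(2)[OF sub[OF that]] h(2)[of w] R by simp
    thus ?thesis unfolding F_def norm_exp_eq_Re exp_add[symmetric] exp_less_cancel_iff by simp
  qed
  have ne: "2 * of_real A - F v \<noteq> 0" if "norm v < 1" for v
    using ReF[OF that] A by (auto simp: complex_eq_iff)
  \<comment> \<open>The Moebius map \<open>y / (2 * A - y)\<close> carries the half-plane
    \<open>Re y < A\<close> into the unit disc and fixes 0.\<close>
  define \<phi> where "\<phi> = (\<lambda>v. F v / (2 * of_real A - F v))"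
  have phi: "\<phi> holomorphic_on ball 0 1"
    unfolding \<phi>_def using ne by (intro holomorphic_intros F) auto
  have F0: "F 0 = 0" by (simp add: F_def)
  have "norm (deriv \<phi> 0) \<le> 1"
  proof (rule Schwarz_Lemma(2)[OF phi, of 0])
    show "\<phi> 0 = 0" by (simp add: \<phi>_def F0)
    fix v :: complex assume v: "norm v < 1"
    have "(Re (F v))\<^sup>2 < (2 * A - Re (F v))\<^sup>2"
    proof -
      have "(2 * A - Re (F v))\<^sup>2 - (Re (F v))\<^sup>2 = 4 * A * (A - Re (F v))"
        by (simp add: power2_eq_square algebra_simps)
      also have "\<dots> > 0" using A ReF[OF v] by simp
      finally show ?thesis by simp
    qed
    hence "norm (F v) < norm (2 * of_real A - F v)"
      unfolding cmod_def by (intro real_sqrt_less_mono) simp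
    thus "norm (\<phi> v) < 1" using ne[OF v] by (simp add: \<phi>_def norm_divide divide_less_eq_1)
  qed auto
  moreover have "(\<phi> has_field_derivative of_real R * (deriv g w / g w) / (2 * of_real A)) (at 0)"
  proof -
    have dg: "(g has_field_derivative deriv g w) (at w)"
      using g R by (intro holomorphic_derivI[OF g]) auto
    have dh: "(h has_field_derivative deriv h w) (at w)"
      using R by (intro holomorphic_derivI[OF h(1)]) auto
    have "((\<lambda>u. exp (h u)) has_field_derivative exp (h w) * deriv h w) (at w)"
      by (auto intro!: derivative_eq_intros dh)
    moreover have "\<forall>\<^sub>F u in nhds w. exp (h u) = g u"
      using eventually_nhds_in_open[of "ball w R" w] R h(2) by (auto elim: eventually_mono)
    ultimately have "(g has_field_derivative exp (h w) * deriv h w) (at w)"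
      using DERIV_cong_ev[of w w "\<lambda>u. exp (h u)" g] by blast
    with dg have "deriv g w = g w * deriv h w" using DERIV_unique h(2)[of w] R by fastforce
    hence dh': "deriv h w = deriv g w / g w" using gw by simp
    have "(F has_field_derivative deriv h w * of_real R) (at 0)"
      unfolding F_def using dh
      by (auto intro!: derivative_eq_intros DERIV_chain2[where f = h])
    hence "(\<phi> has_field_derivative (deriv h w * of_real R) / (2 * of_real A)) (at 0)"
      unfolding \<phi>_def using A by (auto intro!: derivative_eq_intros simp: F0 field_simps)
    thus ?thesis unfolding dh' by (simp add: mult_ac)
  qed
  ultimately have "norm (of_real R * (deriv g w / g w) / (2 * of_real A)) \<le> 1"
    by (simp add: DERIV_imp_deriv)
  thus ?thesis using A R gw by (simp add: norm_mult norm_divide field_simps)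
qed

lemma has_field_derivative_prod_log:
  fixes p :: "'b \<Rightarrow> complex" and m :: "'b \<Rightarrow> nat"
  assumes "finite Z" "\<And>z. z \<in> Z \<Longrightarrow> w \<noteq> p z"
  shows "((\<lambda>u. \<Prod>z\<in>Z. (u - p z) ^ m z) has_field_derivative
     (\<Prod>z\<in>Z. (w - p z) ^ m z) * (\<Sum>z\<in>Z. of_nat (m z) / (w - p z))) (at w)"
  using assms
proof (induction Z rule: finite_induct)
  case (insert z Z)
  have "((\<lambda>u. (u - p z) ^ m z) has_field_derivative (w - p z) ^ m z * (of_nat (m z) / (w - p z))) (at w)"
  proof -
    have "((\<lambda>u. (u - p z) ^ m z) has_field_derivative of_nat (m z) * (1 * (w - p z) ^ (m z - Suc 0))) (at w)"
      by (rule DERIV_power) (auto intro!: derivative_eq_intros)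
    moreover have "of_nat (m z) * (1 * (w - p z) ^ (m z - Suc 0)) = (w - p z) ^ m z * (of_nat (m z) / (w - p z))"
      using insert.prems by (cases "m z") auto
    ultimately show ?thesis by simp
  qed
  from DERIV_mult[OF this insert.IH] show ?case using insert by (simp add: algebra_simps)
qed auto

text \<open>Remove the zeros in \<open>cball w R\<close>. On the circle of radius
  \<open>2 * R\<close> each removed factor is at least as large as at \<open>w\<close>, so the
  quotient grows no faster there, relative to its value at \<open>w\<close>, than \<open>f\<close>
  does; its logarithmic derivative at \<open>w\<close> is then at most about
  \<open>4 * \<epsilon>\<close>, for every \<epsilon>. The family \<open>a\<close> lists each zero
  as often as its order. The sum over discs is a limit only; absolute convergence has to come from
  elsewhere.\<close>

lemma logderiv_eq_sum_zeros:
  fixes f :: "complex \<Rightarrow> complex" and a :: "'b \<Rightarrow> complex"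
  assumes f: "f holomorphic_on UNIV" and fw: "f w \<noteq> 0"
    and growth: "\<And>\<epsilon>. \<epsilon> > 0 \<Longrightarrow> \<exists>C. \<forall>u. norm (f u) \<le> C * exp (\<epsilon> * norm u)"
    and nonconst: "\<not> f constant_on UNIV"
    and zero: "\<And>n. n \<in> I \<Longrightarrow> f (a n) = 0"
    and mult: "\<And>z. f z = 0 \<Longrightarrow> int (card {n\<in>I. a n = z}) = zorder f z"
  shows "\<And>R. finite {n\<in>I. a n \<in> cball w R}"
    and "((\<lambda>R. \<Sum>n | n \<in> I \<and> a n \<in> cball w R. 1 / (w - a n)) \<longlongrightarrow> deriv f w / f w) at_top"
proof -
  let ?Z = "\<lambda>R. {z \<in> cball w R. f z = 0}"
  have finZ: "finite (?Z R)" for R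
    by (rule holomorphic_compact_finite_zeros[OF f _ _ _ _ nonconst]) auto
  have pos: "zorder f z > 0" if "f z = 0" for z
    using zorder_exist_zero[OF f open_UNIV connected_UNIV, of z] that fw by auto
  have fin1: "finite {n\<in>I. a n = z}" if "f z = 0" for z
    using mult[OF that] pos[OF that] by (intro card_ge_0_finite) auto
  have Un: "{n\<in>I. a n \<in> cball w R} = (\<Union>z\<in>?Z R. {n\<in>I. a n = z})" for R
    using zero by auto
  show fin: "finite {n\<in>I. a n \<in> cball w R}" for R
    unfolding Un using finZ fin1 by (intro finite_UN_I) auto
  have sum_eq: "(\<Sum>n | n \<in> I \<and> a n \<in> cball w R. 1 / (w - a n)) = (\<Sum>z\<in>?Z R. of_nat (nat (zorder f z)) / (w - z))" for R
  proof -
    have "(\<Sum>n\<in>(\<Union>z\<in>?Z R. {n\<in>I. a n = z}). 1 / (w - a n)) = (\<Sum>z\<in>?Z R. \<Sum>n\<in>{n\<in>I. a n = z}. 1 / (w - a n))"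
      using finZ fin1 by (intro sum.UNION_disjoint) auto
    also have "\<dots> = (\<Sum>z\<in>?Z R. of_nat (nat (zorder f z)) / (w - z))"
    proof (intro sum.cong refl)
      fix z assume "z \<in> ?Z R"
      hence "nat (zorder f z) = card {n\<in>I. a n = z}" using mult[of z] by auto
      thus "(\<Sum>n\<in>{n\<in>I. a n = z}. 1 / (w - a n)) = of_nat (nat (zorder f z)) / (w - z)" by simp
    qed
    finally show ?thesis unfolding Un[symmetric] by simp
  qed
  \<comment> \<open>The strict \<open>A' < A\<close> supplies the strict inequality required by
    \<open>norm_logderiv_le\<close>.\<close>
  have bound: "norm ((\<Sum>n | n \<in> I \<and> a n \<in> cball w R. 1 / (w - a n)) - deriv f w / f w) \<le> 2 * A / R"
    if R: "R > 0" and A: "\<And>u. norm (u - w) = 2 * R \<Longrightarrow> norm (f u) \<le> norm (f w) * exp A'" and A': "A' < A" for R A A'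
  proof -
    define m where "m = (\<lambda>z. nat (zorder f z))"
    obtain g where g: "g holomorphic_on UNIV" "\<And>u. f u = (\<Prod>z\<in>?Z R. (u - z) ^ m z) * g u"
      "\<And>z. z \<in> ?Z R \<Longrightarrow> g z \<noteq> 0"
      using holomorphic_factor_out_zeros[OF f fw finZ[of R]] unfolding m_def by blast
    have gnz: "g u \<noteq> 0" if "u \<in> cball w R" for u
      using g(2)[of u] g(3)[of u] that by auto
    have wz: "w \<noteq> z" if "z \<in> ?Z R" for z using that fw by auto
    define c where "c = (\<Prod>z\<in>?Z R. (w - z) ^ m z)"
    have c: "c \<noteq> 0" unfolding c_def using wz finZ by auto
    have fwc: "f w = c * g w" unfolding c_def by (rule g(2))
    \<comment> \<open>If \<open>u\<close> has distance \<open>2 * R\<close> from \<open>w\<close>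
      and \<open>z\<close> has distance at most \<open>R\<close> from \<open>w\<close>, then
      \<open>u\<close> and \<open>z\<close> are at least \<open>R\<close> apart, hence at least as
      far apart as \<open>w\<close> and \<open>z\<close>.\<close>
    have sphere: "norm (c * g u) \<le> norm (f w) * exp A'" if u: "u \<in> sphere w (2 * R)" for u
    proof -
      have "norm c \<le> norm (\<Prod>z\<in>?Z R. (u - z) ^ m z)"
        unfolding c_def prod_norm[symmetric] norm_power
      proof (intro prod_mono conjI power_mono)
        fix z assume z: "z \<in> ?Z R"
        have "2 * R = norm (u - w)" using u by (simp add: dist_norm norm_minus_commute)
        also have "\<dots> \<le> norm (u - z) + norm (w - z)"
          using norm_triangle_ineq4[of "u - z" "w - z"] by simp
        finally show "norm (w - z) \<le> norm (u - z)" using z by (simp add: dist_norm)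
      qed auto
      hence "norm (c * g u) \<le> norm (f u)" unfolding g(2)[of u] norm_mult by (rule mult_right_mono) auto
      also have "\<dots> \<le> norm (f w) * exp A'" using A[of u] u by (simp add: dist_norm norm_minus_commute)
      finally show ?thesis .
    qed
    have "norm (deriv (\<lambda>u. c * g u) w / (c * g w)) \<le> 2 * A / R"
    proof (rule norm_logderiv_le[OF _ R])
      show "(\<lambda>u. c * g u) holomorphic_on ball w R"
        by (intro holomorphic_intros holomorphic_on_subset[OF g(1)]) auto
      fix u assume u: "u \<in> ball w R"
      show "c * g u \<noteq> 0" using c gnz[of u] u by auto
      have "norm (c * g u) \<le> norm (f w) * exp A'"
      proof (rule maximum_modulus_frontier[where S = "ball w (2 * R)" and f = "\<lambda>u. c * g u"])
        show "(\<lambda>u. c * g u) holomorphic_on interior (ball w (2 * R))"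
          by (intro holomorphic_intros holomorphic_on_subset[OF g(1)]) auto
        show "continuous_on (closure (ball w (2 * R))) (\<lambda>u. c * g u)"
          by (intro continuous_intros continuous_on_subset[OF holomorphic_on_imp_continuous_on[OF g(1)]]) auto
        show "norm (c * g z) \<le> norm (f w) * exp A'" if "z \<in> frontier (ball w (2 * R))" for z
          using that R by (intro sphere) auto
      qed (use u R in auto)
      also have "\<dots> < norm (f w) * exp A" using fw A' by simp
      finally show "norm (c * g u) < norm (c * g w) * exp A" by (simp add: fwc)
    qed
    moreover have dg: "(g has_field_derivative deriv g w) (at w)"
      by (rule holomorphic_derivI[OF g(1)]) auto
    have "deriv (\<lambda>u. c * g u) w = c * deriv g w"
      by (intro DERIV_imp_deriv) (auto intro!: derivative_eq_intros dg)
    moreover have "deriv f w / f w = (\<Sum>z\<in>?Z R. of_nat (m z) / (w - z)) + deriv g w / g w"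
    proof -
      have "((\<lambda>u. (\<Prod>z\<in>?Z R. (u - z) ^ m z) * g u) has_field_derivative
        (\<Prod>z\<in>?Z R. (w - z) ^ m z) * (\<Sum>z\<in>?Z R. of_nat (m z) / (w - z)) * g w +
         deriv g w * (\<Prod>z\<in>?Z R. (w - z) ^ m z)) (at w)"
        using finZ wz by (intro DERIV_mult has_field_derivative_prod_log dg) auto
      hence "(f has_field_derivative c * (\<Sum>z\<in>?Z R. of_nat (m z) / (w - z)) * g w + deriv g w * c) (at w)"
        unfolding c_def by (subst ext[OF g(2), of "\<lambda>x. x"])
      hence "deriv f w = c * (\<Sum>z\<in>?Z R. of_nat (m z) / (w - z)) * g w + deriv g w * c"
        by (rule DERIV_imp_deriv)
      thus ?thesis using c gnz[of w] R unfolding fwc by (simp add: field_simps)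
    qed
    ultimately show ?thesis using c unfolding sum_eq by (simp add: m_def)
  qed
  show "((\<lambda>R. \<Sum>n | n \<in> I \<and> a n \<in> cball w R. 1 / (w - a n)) \<longlongrightarrow> deriv f w / f w) at_top"
  proof (rule tendstoI)
    fix e :: real assume e: "e > 0"
    \<comment> \<open>The factor 2 of \<open>norm_logderiv_le\<close> and the radius
      \<open>2 * R\<close> lead to the limit \<open>4 * \<epsilon> = e / 2\<close>.\<close>
    define \<epsilon> where "\<epsilon> = e / 8"
    have eps: "\<epsilon> > 0" using e by (simp add: \<epsilon>_def)
    obtain C where C: "\<And>u. norm (f u) \<le> C * exp (\<epsilon> * norm u)" using growth[OF eps] by blast
    have "C > 0" using C[of w] fw by (metis exp_gt_zero less_le_trans zero_less_mult_pos2 zero_less_norm_iff)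
    define A' where "A' = (\<lambda>R. ln (C / norm (f w)) + \<epsilon> * (norm w + 2 * R))"
    have le: "norm ((\<Sum>n | n \<in> I \<and> a n \<in> cball w R. 1 / (w - a n)) - deriv f w / f w) \<le> 2 * (A' R + 1) / R"
      if R: "R > 0" for R
    proof (rule bound[OF R])
      fix u assume u: "norm (u - w) = 2 * R"
      have "norm u \<le> norm w + 2 * R" using norm_triangle_ineq[of w "u - w"] u by simp
      hence "C * exp (\<epsilon> * norm u) \<le> C * exp (\<epsilon> * (norm w + 2 * R))" using eps \<open>C > 0\<close> by simp
      also have "\<dots> = norm (f w) * exp (A' R)"
        using fw \<open>C > 0\<close> by (simp add: A'_def exp_add)
      finally show "norm (f u) \<le> norm (f w) * exp (A' R)" using C[of u] by linarith
    qed auto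
    have "((\<lambda>R. 2 * (A' R + 1) / R) \<longlongrightarrow> 4 * \<epsilon>) at_top"
      unfolding A'_def by real_asymp
    hence "\<forall>\<^sub>F R in at_top. 2 * (A' R + 1) / R < e"
      by (rule order_tendstoD) (use e in \<open>auto simp: \<epsilon>_def\<close>)
    moreover note eventually_gt_at_top[of "0::real"]
    ultimately show "\<forall>\<^sub>F R in at_top. dist (\<Sum>n | n \<in> I \<and> a n \<in> cball w R. 1 / (w - a n)) (deriv f w / f w) < e"
    proof eventually_elim
      case (elim R)
      thus ?case unfolding dist_norm by (intro le_less_trans[OF le])
    qed
  qed
qed

section \<open>The completed zeta function\<close>

text \<open>With \<open>s = 1/2 + v\<close> the two exponentials times
  \<open>t powr (- 3 / 4)\<close> are the powers with exponents \<open>s / 2 - 1\<close> and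
  \<open>(1 - s) / 2 - 1\<close> in Riemann's integral for zeta. Exponentials of \<open>ln t\<close>
  make the evenness and the holomorphy in \<open>v\<close> evident.\<close>

definition xi_kernel :: "complex \<Rightarrow> real \<Rightarrow> complex" where
  "xi_kernel v t = of_real (theta_tail t * t powr (- 3 / 4)) *
     (exp (v / 2 * of_real (ln t)) + exp (- (v / 2) * of_real (ln t)))"

definition xi_int :: "complex \<Rightarrow> complex" where
  "xi_int v = (LBINT t:{1..}. xi_kernel v t)"

text \<open>With \<open>y\<close> the fourth root of \<open>t\<close>,
  \<open>ln t \<le> 4 * y\<close>, so \<open>(ln t)^2\<close> is at most \<open>16 * y^2\<close>;
  the inequality of the means \<open>y^2 / \<epsilon> \<le> y^4 + 1 / (4 * \<epsilon>^2)\<close>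
  finishes. It absorbs the logarithm in the kernel estimate that follows.\<close>

lemma ln_squared_le:
  fixes t \<epsilon> :: real
  assumes "t \<ge> 1" "\<epsilon> > 0"
  shows "(ln t)\<^sup>2 / (16 * \<epsilon>) \<le> t + 1 / (4 * \<epsilon>\<^sup>2)"
proof -
  define y where "y = sqrt (sqrt t)"
  have "y ^ 4 = (y\<^sup>2)\<^sup>2" by (simp flip: power_mult)
  hence y: "y > 0" "y ^ 4 = t" using assms by (auto simp: y_def)
  have "ln t = 4 * ln y" using y by (simp add: ln_realpow flip: y(2))
  also have "\<dots> \<le> 4 * y" using ln_le_minus_one[OF y(1)] by simp
  finally have "(ln t)\<^sup>2 \<le> (4 * y)\<^sup>2" using assms by (intro power_mono) auto
  hence "(ln t)\<^sup>2 / (16 * \<epsilon>) \<le> y\<^sup>2 / \<epsilon>" using assms by (simp add: field_simps power2_eq_square)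
  also have "\<dots> \<le> (y\<^sup>2)\<^sup>2 + (1 / (2 * \<epsilon>))\<^sup>2"
    using sum_squares_bound[of "y\<^sup>2" "1 / (2 * \<epsilon>)"] by simp
  also have "\<dots> = t + 1 / (4 * \<epsilon>\<^sup>2)" using y by (simp add: power_divide power_mult_distrib flip: power_mult)
  finally show ?thesis .
qed

text \<open>The exponentials have size at most \<open>exp (norm v * ln t / 2)\<close>. The
  inequality of the means splits this exponent into \<open>\<epsilon> * norm v^2\<close> and a
  multiple of \<open>(ln t)^2\<close>, which costs at most \<open>t\<close> plus a constant; the
  decay \<open>exp (- (pi * t))\<close> pays for it because \<open>pi \<ge> 2\<close>. The freedom
  in \<epsilon> is what yields growth below every exponential in \<open>w\<close>.\<close>

lemma norm_xi_kernel_le: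
  assumes t: "t \<ge> 1" and eps: "\<epsilon> > 0"
  shows "norm (xi_kernel v t) \<le> 4 * exp (\<epsilon> * norm v ^ 2 + 1 / (4 * \<epsilon>\<^sup>2)) * exp (- t)"
proof -
  have ex: "norm (exp (c * of_real (ln t))) \<le> exp (\<epsilon> * norm v ^ 2 + t + 1 / (4 * \<epsilon>\<^sup>2))"
    if c: "norm c = norm v / 2" for c :: complex
  proof -
    have "Re (c * of_real (ln t)) \<le> norm (c * of_real (ln t))" by (rule complex_Re_le_cmod)
    also have "\<dots> = norm v * (ln t / 2)" using t c by (simp add: norm_mult)
    also have "\<dots> \<le> \<epsilon> * norm v ^ 2 + (ln t)\<^sup>2 / (16 * \<epsilon>)"
    proof -
      have "0 \<le> (norm v * sqrt \<epsilon> - ln t / (4 * sqrt \<epsilon>))\<^sup>2" by simp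
      also have "\<dots> = \<epsilon> * norm v ^ 2 + (ln t)\<^sup>2 / (16 * \<epsilon>) - norm v * (ln t / 2)"
        using eps by (simp add: power2_diff power_mult_distrib power_divide field_simps)
      finally show ?thesis by simp
    qed
    also have "\<dots> \<le> \<epsilon> * norm v ^ 2 + t + 1 / (4 * \<epsilon>\<^sup>2)" using ln_squared_le[OF t eps] by simp
    finally show ?thesis by simp
  qed
  have "norm (xi_kernel v t) = (theta_tail t * t powr (-3/4)) *
     norm (exp (v / 2 * of_real (ln t)) + exp (- (v / 2) * of_real (ln t)))"
    using theta_tail_nonneg[of t] t unfolding xi_kernel_def by (simp add: norm_mult)
  also have "\<dots> \<le> (2 * exp (- (pi * t)) * 1) * (2 * exp (\<epsilon> * norm v ^ 2 + t + 1 / (4 * \<epsilon>\<^sup>2)))"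
  proof (intro mult_mono)
    show "theta_tail t \<le> 2 * exp (- (pi * t))" by (rule theta_tail_le[OF t])
    show "t powr (-3/4) \<le> 1" using t using powr_mono[of "-3/4" 0 t] by simp
    have "norm (exp (v / 2 * of_real (ln t)) + exp (- (v / 2) * of_real (ln t))) \<le>
       norm (exp (v / 2 * of_real (ln t))) + norm (exp (- (v / 2) * of_real (ln t)))" by (rule norm_triangle_ineq)
    also have "\<dots> \<le> exp (\<epsilon> * norm v ^ 2 + t + 1 / (4 * \<epsilon>\<^sup>2)) + exp (\<epsilon> * norm v ^ 2 + t + 1 / (4 * \<epsilon>\<^sup>2))"
      by (intro add_mono ex) (auto simp: norm_divide)
    finally show "norm (exp (v / 2 * of_real (ln t)) + exp (- (v / 2) * of_real (ln t))) \<le> 2 * exp (\<epsilon> * norm v ^ 2 + t + 1 / (4 * \<epsilon>\<^sup>2))"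
      by simp
  qed (use t theta_tail_nonneg[of t] in auto)
  also have "\<dots> = 4 * exp (\<epsilon> * norm v ^ 2 + 1 / (4 * \<epsilon>\<^sup>2)) * exp (t - pi * t)"
    by (simp add: exp_add exp_diff exp_minus field_simps)
  also have "t - pi * t \<le> - t"
    using t pi_ge_two mult_right_mono[of 2 pi t] by simp
  finally show ?thesis by (simp add: mult_left_mono)
qed

lemma continuous_on_xi_kernel: "continuous_on (UNIV \<times> {0<..}) (\<lambda>(v, t). xi_kernel v t)"
proof -
  have [continuous_intros]: "continuous_on (UNIV \<times> {0<..}) (\<lambda>x :: complex \<times> real. theta_tail (snd x))"
    by (rule continuous_on_compose2[OF continuous_on_theta_tail]) (auto intro!: continuous_intros)
  show ?thesis unfolding xi_kernel_def case_prod_unfold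
    by (intro continuous_intros) auto
qed

lemma set_borel_measurable_xi_kernel: "set_borel_measurable borel {1..} (xi_kernel v)"
  unfolding set_borel_measurable_def
  by (rule borel_measurable_continuous_on_indicator)
     (auto intro!: continuous_on_compose2[OF continuous_on_xi_kernel, of _ "\<lambda>t. (v, t)", simplified] continuous_intros)

lemma integrable_exp_Ici: "set_integrable lborel {1..} (\<lambda>t::real. exp (- t))"
  using set_integrable_subset[OF integral_exp_Ioi(1)[of 1], of "{1..}"] by (simp add: subset_iff)

lemma set_integrable_xi_kernel: "set_integrable lborel {1..} (xi_kernel v)"
proof (rule set_integrable_bound)
  show "set_integrable lborel {1..} (\<lambda>t. 4 * exp (1 * norm v ^ 2 + 1 / (4 * 1\<^sup>2)) * exp (- t))"
    by (intro set_integrable_mult_right integrable_exp_Ici)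
  show "AE t in lborel. t \<in> {1..} \<longrightarrow> norm (xi_kernel v t) \<le> norm (4 * exp (1 * norm v ^ 2 + 1 / (4 * 1\<^sup>2)) * exp (- t))"
    using norm_xi_kernel_le[of _ 1 v] by (intro AE_I2) auto
  show "set_borel_measurable lborel {1..} (xi_kernel v)"
    using set_borel_measurable_xi_kernel by (simp add: set_borel_measurable_def)
qed

lemma norm_xi_int_le:
  assumes eps: "\<epsilon> > 0"
  shows "norm (xi_int v) \<le> 4 * exp (1 / (4 * \<epsilon>\<^sup>2)) * exp (\<epsilon> * norm v ^ 2)"
proof -
  let ?C = "4 * exp (\<epsilon> * norm v ^ 2 + 1 / (4 * \<epsilon>\<^sup>2))"
  have "norm (xi_int v) \<le> (LBINT t:{1..}. norm (xi_kernel v t))"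
    unfolding xi_int_def by (rule set_integral_norm_bound[OF set_integrable_xi_kernel])
  also have "\<dots> \<le> (LBINT t:{1..}. ?C * exp (- t))"
  proof (rule set_integral_mono)
    show "set_integrable lborel {1..} (\<lambda>t. norm (xi_kernel v t))"
      by (rule set_integrable_norm[OF set_integrable_xi_kernel])
    show "set_integrable lborel {1..} (\<lambda>t. ?C * exp (- t))"
      by (intro set_integrable_mult_right integrable_exp_Ici)
  qed (use norm_xi_kernel_le[OF _ eps] in auto)
  also have "\<dots> = ?C * (LBINT t:{1..}. exp (- t))" by simp
  also have "\<dots> \<le> ?C * (LBINT t:{0<..}. exp (- t))"
  proof (rule mult_left_mono)
    have i: "set_integrable lborel {0::real<..} (\<lambda>t. exp (- t))" using integral_exp_Ioi(1)[of 1] by simp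
    show "(LBINT t:{1::real..}. exp (- t)) \<le> (LBINT t:{0<..}. exp (- t))"
      unfolding set_lebesgue_integral_def using i integrable_exp_Ici
      by (intro integral_mono) (auto simp: set_integrable_def indicator_def)
  qed auto
  also have "(LBINT t:{0<..}. exp (- t)) = (1::real)" using integral_exp_Ioi(2)[of 1] by simp
  finally show ?thesis by (simp add: exp_add mult_ac)
qed

lemma xi_int_even: "xi_int (- v) = xi_int v"
proof -
  have "xi_kernel (- v) = xi_kernel v"
    unfolding xi_kernel_def by (simp add: add.commute)
  thus ?thesis unfolding xi_int_def by simp
qed

text \<open>The truncated integrals over \<open>{1..n}\<close> are holomorphic by differentiation
  under the integral sign and converge locally uniformly in \<open>v\<close>, by the majorant from
  \<open>norm_xi_kernel_le\<close> with \<epsilon> equal to 1.\<close>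

lemma xi_int_holomorphic: "xi_int holomorphic_on UNIV"
proof (rule holomorphic_uniform_sequence)
  define K' where "K' = (\<lambda>(v::complex) t. of_real (theta_tail t * t powr (- 3 / 4)) * (of_real (ln t / 2) *
     (exp (v / 2 * of_real (ln t)) - exp (- (v / 2) * of_real (ln t)))))"
  define F where "F = (\<lambda>n v. LBINT t:{1..real n}. xi_kernel v t)"
  fix n :: nat
  have "(\<lambda>v. integral (cbox 1 (real n)) (xi_kernel v)) holomorphic_on UNIV"
  proof (rule leibniz_rule_holomorphic[where fx = K'])
    show "((\<lambda>v. xi_kernel v t) has_field_derivative K' v t) (at v within UNIV)" for v t
      unfolding xi_kernel_def[abs_def] K'_def by (auto intro!: derivative_eq_intros simp: algebra_simps)
    show "xi_kernel v integrable_on cbox 1 (real n)" for v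
      by (rule integrable_continuous)
         (auto intro!: continuous_on_compose2[OF continuous_on_xi_kernel, of _ "\<lambda>t. (v, t)", simplified] continuous_intros)
    have [continuous_intros]: "continuous_on (UNIV \<times> cbox 1 (real n)) (\<lambda>x :: complex \<times> real. theta_tail (snd x))"
      by (rule continuous_on_compose2[OF continuous_on_theta_tail]) (auto intro!: continuous_intros)
    show "continuous_on (UNIV \<times> cbox 1 (real n)) (\<lambda>(v, t). K' v t)"
      unfolding K'_def case_prod_unfold by (intro continuous_intros) auto
  qed auto
  also have "(\<lambda>v. integral (cbox 1 (real n)) (xi_kernel v)) = F n"
  proof
    fix v
    have "set_integrable lborel {1..real n} (xi_kernel v)"
      by (rule set_integrable_subset[OF set_integrable_xi_kernel]) auto
    from set_borel_integral_eq_integral(2)[OF this]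
    show "integral (cbox 1 (real n)) (xi_kernel v) = F n v" by (simp add: F_def)
  qed
  finally show "F n holomorphic_on UNIV" .
next
  define F where "F = (\<lambda>n v. LBINT t:{1..real n}. xi_kernel v t)"
  fix x :: complex
  have "uniform_limit (cball x 1) (\<lambda>b v. LBINT t:{1..b}. xi_kernel v t) (\<lambda>v. LBINT t:{1..}. xi_kernel v t) at_top"
  proof (rule uniform_limit_set_lebesgue_integral_at_top)
    show "norm (xi_kernel v t) \<le> 4 * exp (1 * (norm x + 1) ^ 2 + 1 / (4 * 1\<^sup>2)) * exp (- t)"
      if "v \<in> cball x 1" "t \<ge> 1" for v t
    proof -
      have "norm v \<le> norm x + 1" using that norm_triangle_ineq[of x "v - x"] by (simp add: dist_norm norm_minus_commute)
      hence "norm v ^ 2 \<le> (norm x + 1) ^ 2" by (intro power_mono) auto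
      hence "exp (1 * norm v ^ 2 + 1 / (4 * 1\<^sup>2)) \<le> exp (1 * (norm x + 1) ^ 2 + 1 / (4 * 1\<^sup>2))" by simp
      thus ?thesis using norm_xi_kernel_le[OF that(2), of 1 v]
        by (smt (verit, best) exp_gt_zero mult_right_mono mult_left_mono)
    qed
    show "set_integrable lborel {1..} (\<lambda>t. 4 * exp (1 * (norm x + 1) ^ 2 + 1 / (4 * 1\<^sup>2)) * exp (- t))"
      by (intro set_integrable_mult_right integrable_exp_Ici)
    show "set_borel_measurable lborel {1..} (xi_kernel v)" for v
      using set_borel_measurable_xi_kernel by (simp add: set_borel_measurable_def)
  qed auto
  hence "uniform_limit (cball x 1) (\<lambda>n v. LBINT t:{1..real n}. xi_kernel v t) xi_int sequentially"
    unfolding xi_int_def[abs_def] by (rule filterlim_compose[OF _ filterlim_real_sequentially, unfolded o_def])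
  thus "\<exists>d>0. cball x d \<subseteq> UNIV \<and> uniform_limit (cball x d) (\<lambda>n v. LBINT t:{1..real n}. xi_kernel v t) xi_int sequentially"
    by (intro exI[of _ 1]) auto
qed auto

text \<open>The function \<open>s (s - 1) \<pi>\<^sup>-\<^sup>s\<^sup>/\<^sup>2 \<Gamma> (s/2) \<zeta> (s)\<close>, which is even around \<open>1/2\<close>, as a function
  of \<open>w = (s - 1/2)\<^sup>2\<close>.\<close>

definition xi_sq :: "complex \<Rightarrow> complex" where
  "xi_sq w = 1 + (w - 1 / 4) * xi_int (csqrt w)"

text \<open>Whichever square root \<open>csqrt\<close> picks, \<open>xi_int\<close> takes the same
  value there, being even.\<close>

lemma xi_sq_square: "xi_sq (v\<^sup>2) = 1 + (v\<^sup>2 - 1 / 4) * xi_int v"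
proof -
  have "csqrt (v\<^sup>2) ^ 2 = v ^ 2" by simp
  hence "csqrt (v\<^sup>2) = v \<or> csqrt (v\<^sup>2) = - v" by (simp only: power2_eq_iff)
  thus ?thesis unfolding xi_sq_def using xi_int_even[of v] by auto
qed

text \<open>\<open>csqrt\<close> is holomorphic off the nonpositive reals. Off the nonnegative reals
  the root \<open>\<i> * csqrt (- w)\<close> represents the same function, by evenness. The two
  regions cover everything except 0, where continuity removes the singularity.\<close>

lemma xi_sq_holomorphic: "xi_sq holomorphic_on UNIV"
proof -
  have comp: "(\<lambda>w. xi_int (g w)) holomorphic_on A" if "g holomorphic_on A" for g A
    using holomorphic_on_compose_gen[OF that xi_int_holomorphic] by (simp add: o_def)
  have 1: "xi_sq holomorphic_on - \<real>\<^sub>\<le>\<^sub>0"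
    unfolding xi_sq_def[abs_def] by (intro holomorphic_intros comp) auto
  have "(\<lambda>w. xi_sq ((\<i> * csqrt (- w))\<^sup>2)) holomorphic_on uminus -` (- \<real>\<^sub>\<le>\<^sub>0)"
    unfolding xi_sq_square by (intro holomorphic_intros comp holomorphic_on_compose_gen[where g = csqrt and t = "- \<real>\<^sub>\<le>\<^sub>0", unfolded o_def]) auto
  hence 2: "xi_sq holomorphic_on uminus -` (- \<real>\<^sub>\<le>\<^sub>0)"
    by (simp add: power_mult_distrib)
  have op: "open (- \<real>\<^sub>\<le>\<^sub>0 :: complex set)" by (simp add: open_Compl)
  have "xi_sq holomorphic_on (- \<real>\<^sub>\<le>\<^sub>0) \<union> (uminus -` (- \<real>\<^sub>\<le>\<^sub>0))"
    by (intro holomorphic_on_Un 1 2 op open_vimage[OF op]) (intro continuous_intros)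
  hence "xi_sq holomorphic_on UNIV - {0}"
    by (rule holomorphic_on_subset) (auto simp: complex_nonpos_Reals_iff complex_eq_iff)
  thus ?thesis
  proof (rule no_isolated_singularity'[rotated])
    fix z :: complex assume "z \<in> {0}"
    have "isCont xi_int 0"
      using xi_int_holomorphic by (meson UNIV_I continuous_on_eq_continuous_at holomorphic_on_imp_continuous_on open_UNIV)
    hence xi0: "(xi_int \<longlongrightarrow> xi_int 0) (nhds 0)" by (simp add: isCont_def tendsto_at_iff_tendsto_nhds)
    have "((\<lambda>w. norm (csqrt w)) \<longlongrightarrow> 0) (nhds 0)"
    proof -
      have "((\<lambda>w::complex. sqrt (norm w)) \<longlongrightarrow> sqrt (norm (0::complex))) (nhds 0)"
        by (intro tendsto_intros) (simp add: filterlim_ident)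
      moreover have "norm (csqrt w) = sqrt (norm w)" for w
        by (rule sym, rule real_sqrt_unique) (simp_all flip: norm_power)
      ultimately show ?thesis by simp
    qed
    hence "(csqrt \<longlongrightarrow> 0) (nhds 0)" by (rule tendsto_norm_zero_cancel)
    hence "((\<lambda>w. xi_int (csqrt w)) \<longlongrightarrow> xi_int 0) (nhds 0)"
      using filterlim_compose[OF xi0] by blast
    hence "((\<lambda>w. xi_int (csqrt w)) \<longlongrightarrow> xi_int 0) (at 0)"
      by (rule tendsto_mono[rotated]) (simp add: at_within_def)
    hence "(xi_sq \<longlongrightarrow> 1 + (0 - 1 / 4) * xi_int 0) (at 0)"
      unfolding xi_sq_def[abs_def] by (intro tendsto_intros)
    with \<open>z \<in> {0}\<close> show "(xi_sq \<longlongrightarrow> xi_sq z) (at z within UNIV)"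
      by (simp add: xi_sq_def)
  qed auto
qed

text \<open>The bound for \<open>xi_int\<close> at \<open>csqrt u\<close> is exponential in
  \<open>norm u\<close>, as \<open>norm (csqrt u) ^ 2 = norm u\<close>. One half of \<epsilon> is
  spent on \<open>xi_int\<close>, the other on the linear factor.\<close>

lemma xi_sq_growth:
  assumes eps: "\<epsilon> > 0"
  shows "\<exists>C. \<forall>u. norm (xi_sq u) \<le> C * exp (\<epsilon> * norm u)"
proof -
  define K where "K = 4 * exp (1 / (4 * (\<epsilon> / 2)\<^sup>2))"
  show ?thesis
  proof (intro exI allI)
    fix u :: complex
    have ncs: "norm (csqrt u) ^ 2 = norm u" by (simp flip: norm_power)
    have "norm (xi_int (csqrt u)) \<le> K * exp (\<epsilon> / 2 * norm u)"
      using norm_xi_int_le[of "\<epsilon> / 2" "csqrt u"] eps by (simp add: K_def ncs)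
    moreover have "norm (u - 1 / 4) \<le> (2 / \<epsilon> + 1 / 4) * exp (\<epsilon> / 2 * norm u)"
    proof -
      have "norm (u - 1 / 4) \<le> norm u + 1 / 4" using norm_triangle_ineq4[of u "1/4"] by simp
      also have "norm u = 2 / \<epsilon> * (\<epsilon> / 2 * norm u)" using eps by simp
      also have "\<dots> \<le> 2 / \<epsilon> * exp (\<epsilon> / 2 * norm u)"
      proof (rule mult_left_mono)
        show "\<epsilon> / 2 * norm u \<le> exp (\<epsilon> / 2 * norm u)"
          using exp_ge_add_one_self[of "\<epsilon> / 2 * norm u"] by linarith
      qed (use eps in auto)
      also have "2 / \<epsilon> * exp (\<epsilon> / 2 * norm u) + 1 / 4 \<le> (2 / \<epsilon> + 1 / 4) * exp (\<epsilon> / 2 * norm u)"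
        using eps by (simp add: algebra_simps)
      finally show ?thesis by simp
    qed
    ultimately have "norm ((u - 1 / 4) * xi_int (csqrt u)) \<le>
       ((2 / \<epsilon> + 1 / 4) * exp (\<epsilon> / 2 * norm u)) * (K * exp (\<epsilon> / 2 * norm u))"
      unfolding norm_mult using eps by (intro mult_mono) auto
    also have "\<dots> = (2 / \<epsilon> + 1 / 4) * K * exp (\<epsilon> * norm u)"
      by (simp add: mult_ac flip: exp_add)
    finally have "norm (xi_sq u) \<le> 1 + (2 / \<epsilon> + 1 / 4) * K * exp (\<epsilon> * norm u)"
      unfolding xi_sq_def using norm_triangle_ineq[of 1 "(u - 1 / 4) * xi_int (csqrt u)"] by simp
    also have "\<dots> \<le> exp (\<epsilon> * norm u) + (2 / \<epsilon> + 1 / 4) * K * exp (\<epsilon> * norm u)" using eps by simp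
    finally show "norm (xi_sq u) \<le> (1 + (2 / \<epsilon> + 1 / 4) * K) * exp (\<epsilon> * norm u)" by (simp add: algebra_simps)
  qed
qed

section \<open>The Mellin transform of the theta series and the continuation of zeta\<close>

lemma
  fixes f :: "real \<Rightarrow> real"
  assumes "set_borel_measurable borel A f"
  shows set_integrable_lborel_iff: "set_integrable lborel A f \<longleftrightarrow> f absolutely_integrable_on A"
    and set_integral_lborel_eq: "set_integrable lborel A f \<Longrightarrow> (LBINT x:A. f x) = integral A f"
proof -
  have m: "(\<lambda>x. indicator A x *\<^sub>R f x) \<in> borel_measurable lborel"
    using assms by (simp add: set_borel_measurable_def)
  show iff: "set_integrable lborel A f \<longleftrightarrow> f absolutely_integrable_on A"
    unfolding set_integrable_def using integrable_completion[OF m] by simp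
  assume "set_integrable lborel A f"
  hence "f absolutely_integrable_on A" using iff by simp
  from set_lebesgue_integral_eq_integral(2)[OF this]
  show "(LBINT x:A. f x) = integral A f"
    unfolding set_lebesgue_integral_def using integral_completion[OF m] by simp
qed

text \<open>The substitution \<open>t = 1 / u\<close> folds the unit interval onto the half-line
  beyond 1. The change of variables is done for the absolute gauge integral, to which the preceding
  lemma translates.\<close>

lemma set_integral_reciprocal:
  fixes f :: "real \<Rightarrow> real"
  assumes cont: "continuous_on {0<..} f"
    and int: "set_integrable lborel {1<..} (\<lambda>u. f (1 / u) / u\<^sup>2)"
  shows "set_integrable lborel {0<..<1} f" "(LBINT t:{0<..<1}. f t) = (LBINT u:{1<..}. f (1 / u) / u\<^sup>2)"
proof -
  have m1: "set_borel_measurable borel {0<..<1} f"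
    unfolding set_borel_measurable_def
    by (rule borel_measurable_continuous_on_indicator) (auto intro: continuous_on_subset[OF cont])
  have m2: "set_borel_measurable borel {1<..} (\<lambda>u. f (1 / u) / u\<^sup>2)"
    unfolding set_borel_measurable_def
    by (rule borel_measurable_continuous_on_indicator)
       (auto intro!: continuous_intros continuous_on_compose2[OF cont])
  have im: "(\<lambda>u::real. 1 / u) ` {1<..} = {0<..<1}"
  proof safe
    fix x :: real assume "x \<in> {0<..<1}"
    thus "x \<in> (\<lambda>u. 1 / u) ` {1<..}" by (intro image_eqI[of _ _ "1 / x"]) auto
  qed auto
  have "(\<lambda>u. \<bar>- (1 / u\<^sup>2)\<bar> * f (1 / u)) absolutely_integrable_on {1<..} \<and>
         integral {1<..} (\<lambda>u. \<bar>- (1 / u\<^sup>2)\<bar> * f (1 / u)) = b \<longleftrightarrow>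
        f absolutely_integrable_on ((\<lambda>u. 1 / u) ` {1<..}) \<and> integral ((\<lambda>u. 1 / u) ` {1<..}) f = b" for b
    by (rule has_absolute_integral_change_of_variables_1')
       (auto intro!: derivative_eq_intros inj_onI simp: power2_eq_square)
  moreover have "(\<lambda>u. \<bar>- (1 / u\<^sup>2)\<bar> * f (1 / u)) = (\<lambda>u. f (1 / u) / u\<^sup>2)" by (auto simp: fun_eq_iff)
  ultimately have eq: "(\<lambda>u. f (1 / u) / u\<^sup>2) absolutely_integrable_on {1<..} \<and>
         integral {1<..} (\<lambda>u. f (1 / u) / u\<^sup>2) = b \<longleftrightarrow>
        f absolutely_integrable_on {0<..<1} \<and> integral {0<..<1} f = b" for b
    unfolding im by simp
  have "(\<lambda>u. f (1 / u) / u\<^sup>2) absolutely_integrable_on {1<..}"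
    using int set_integrable_lborel_iff[OF m2] by simp
  hence *: "f absolutely_integrable_on {0<..<1}" "integral {0<..<1} f = integral {1<..} (\<lambda>u. f (1 / u) / u\<^sup>2)"
    using eq[of "integral {1<..} (\<lambda>u. f (1 / u) / u\<^sup>2)"] by auto
  show i: "set_integrable lborel {0<..<1} f" using * set_integrable_lborel_iff[OF m1] by simp
  show "(LBINT t:{0<..<1}. f t) = (LBINT u:{1<..}. f (1 / u) / u\<^sup>2)"
    using * set_integral_lborel_eq[OF m1 i] set_integral_lborel_eq[OF m2 int] by simp
qed

lemma integral_powr_Ioo:
  fixes p :: real
  assumes "p > -1"
  shows "set_integrable lborel {0<..<1} (\<lambda>t. t powr p)" "(LBINT t:{0<..<1}. t powr p) = 1 / (p + 1)"
proof -
  have m: "set_borel_measurable borel {0<..<1} (\<lambda>t. t powr p)"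
    unfolding set_borel_measurable_def by measurable
  have hi: "((\<lambda>t. t powr p) has_integral (1 / (p + 1))) {0..1}"
    using has_integral_powr_from_0[OF assms, of 1] by simp
  hence hi': "((\<lambda>t. t powr p) has_integral (1 / (p + 1))) {0<..<1}"
    using has_integral_open_interval[of "\<lambda>t. t powr p" _ 0 "1::real"] by (simp add: box_real)
  hence "(\<lambda>t. t powr p) absolutely_integrable_on {0<..<1}"
    by (intro nonnegative_absolutely_integrable_1) auto
  thus i: "set_integrable lborel {0<..<1} (\<lambda>t. t powr p)" using set_integrable_lborel_iff[OF m] by simp
  show "(LBINT t:{0<..<1}. t powr p) = 1 / (p + 1)"
    using set_integral_lborel_eq[OF m i] hi' by (simp add: integral_unique)
qed

lemma integral_Gamma_scaled:
  fixes a c :: real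
  assumes a: "a > 0" and c: "c > 0"
  shows "set_integrable lborel {0<..} (\<lambda>t. t powr (a - 1) * exp (- (c * t)))"
    "(LBINT t:{0<..}. t powr (a - 1) * exp (- (c * t))) = Gamma a * c powr (- a)"
proof -
  let ?f = "\<lambda>t. indicator {0<..} t * t powr (a - 1) * exp (- t)"
  have "nn_integral lborel (\<lambda>t. ennreal (?f t)) = nn_integral lborel (\<lambda>t. ennreal (indicator {0..} t * t powr (a - 1) / exp t))"
    by (intro nn_integral_cong) (auto simp: indicator_def exp_minus field_simps)
  also have "\<dots> = ennreal (Gamma a)" using Gamma_conv_nn_integral_real[OF a] by simp
  finally have f: "integrable lborel ?f" "integral\<^sup>L lborel ?f = Gamma a"
    using a by (subst (asm) nn_integral_eq_integrable; auto)+
  have eq: "?f (0 + c * t) = c powr (a - 1) * (indicator {0<..} t *\<^sub>R (t powr (a - 1) * exp (- (c * t))))" for t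
    using c by (auto simp: indicator_def powr_mult zero_less_mult_iff)
  have cp: "c powr (a - 1) \<noteq> 0" using c by simp
  have "integrable lborel (\<lambda>t. ?f (0 + c * t))"
    using c f(1) by (intro lborel_integrable_real_affine) auto
  hence i: "integrable lborel (\<lambda>t. indicator {0<..} t *\<^sub>R (t powr (a - 1) * exp (- (c * t))))"
    unfolding eq using integrable_mult_right[of "1 / c powr (a - 1)" lborel
       "\<lambda>t. c powr (a - 1) * (indicator {0<..} t *\<^sub>R (t powr (a - 1) * exp (- (c * t))))"] cp by simp
  thus "set_integrable lborel {0<..} (\<lambda>t. t powr (a - 1) * exp (- (c * t)))" by (simp add: set_integrable_def)
  have "Gamma a = \<bar>c\<bar> *\<^sub>R (LINT t|lborel. ?f (0 + c * t))"
    using c f(2) lborel_integral_real_affine[of c ?f 0] by simp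
  also have "\<dots> = c * c powr (a - 1) * (LBINT t:{0<..}. t powr (a - 1) * exp (- (c * t)))"
    unfolding eq set_lebesgue_integral_def using c by simp
  also have "c * c powr (a - 1) = c powr a" using c by (simp add: powr_diff)
  finally show "(LBINT t:{0<..}. t powr (a - 1) * exp (- (c * t))) = Gamma a * c powr (- a)"
    using c by (simp add: powr_minus field_simps)
qed

lemma square_powr:
  fixes x b :: real
  assumes "x > 0"
  shows "(x\<^sup>2) powr (- (b / 2)) = x powr (- b)"
  using powr_powr[of x 2 "- (b / 2)"] assms by simp

text \<open>Riemann's computation. The Mellin transform of \<open>theta_tail\<close>, integrated
  term by term, is the series on the left. Splitting it at 1 and reflecting the lower part by the
  theta functional equation gives the two powers in \<open>xi_kernel\<close> and the elementary
  remainder \<open>1 / (\<sigma> - 1) - 1 / \<sigma>\<close>. The identity theorem later extends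
  this from real \<sigma> to the half-plane.\<close>

lemma mellin_theta_tail:
  fixes \<sigma> :: real
  assumes sigma: "\<sigma> > 1"
  shows "(\<lambda>n. complex_of_real (Gamma (\<sigma> / 2) * (pi * real (Suc n) ^ 2) powr (- (\<sigma> / 2)))) sums
     (xi_int (of_real \<sigma> - 1 / 2) + of_real (1 / (\<sigma> - 1) - 1 / \<sigma>))"
proof -
  define a where "a = \<sigma> / 2"
  have a: "a > 1 / 2" using sigma by (simp add: a_def)
  let ?p1 = "\<lambda>t. theta_tail t * t powr (a - 1)" and ?p2 = "\<lambda>t. theta_tail t * t powr (- a - 1 / 2)"
  have K: "xi_kernel (of_real \<sigma> - 1 / 2) t = of_real (?p1 t + ?p2 t)" if t: "t \<ge> 1" for t
  proof -
    have e: "exp ((of_real \<sigma> - 1 / 2) / 2 * complex_of_real (ln t)) = of_real (t powr (a - 1 / 4))"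
      "exp (- ((of_real \<sigma> - 1 / 2) / 2) * complex_of_real (ln t)) = of_real (t powr (1 / 4 - a))"
      using t by (simp_all add: powr_def a_def exp_of_real[symmetric] algebra_simps diff_divide_distrib)
    have p: "t powr (a - 1) = t powr (-3/4) * t powr (a - 1 / 4)"
       "t powr (- a - 1 / 2) = t powr (-3/4) * t powr (1 / 4 - a)"
      by (simp_all add: algebra_simps flip: powr_add)
    show ?thesis unfolding xi_kernel_def e p by (simp add: algebra_simps)
  qed
  have pint: "set_integrable lborel {1..} p" if p: "p = ?p1 \<or> p = ?p2" for p
  proof (rule set_integrable_bound)
    show "set_integrable lborel {1..} (xi_kernel (of_real \<sigma> - 1 / 2))" by (rule set_integrable_xi_kernel)
    show "set_borel_measurable lborel {1..} p"
    proof -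
      have "continuous_on {1..} p" using p
        by (auto intro!: continuous_intros continuous_on_subset[OF continuous_on_theta_tail])
      thus ?thesis unfolding set_borel_measurable_def
        using borel_measurable_continuous_on_indicator[of "{1..}" p] by simp
    qed
    show "AE t in lborel. t \<in> {1..} \<longrightarrow> norm (p t) \<le> norm (xi_kernel (of_real \<sigma> - 1 / 2) t)"
      using p theta_tail_nonneg by (intro AE_I2) (auto simp: K simp del: of_real_add)
  qed
  have p1: "set_integrable lborel {1..} ?p1" and p2: "set_integrable lborel {1..} ?p2"
    by (rule pint; blast)+
  have xi: "xi_int (of_real \<sigma> - 1 / 2) = of_real ((LBINT t:{1..}. ?p1 t) + (LBINT t:{1..}. ?p2 t))"
  proof -
    have "xi_int (of_real \<sigma> - 1 / 2) = (LBINT t:{1..}. complex_of_real (?p1 t + ?p2 t))"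
      unfolding xi_int_def by (rule set_lebesgue_integral_cong) (auto simp: K)
    also have "\<dots> = of_real (LBINT t:{1..}. ?p1 t + ?p2 t)" by (rule set_integral_complex_of_real)
    finally show ?thesis using p1 p2 by (simp add: set_integral_add)
  qed
  \<comment> \<open>The counterpart of \<open>?p2\<close> under \<open>t = 1 / u\<close>, and what
    the functional equation makes of \<open>?p1\<close> below 1, up to elementary powers.\<close>
  let ?q = "\<lambda>t. theta_tail (1 / t) * t powr (a - 3 / 2)"
  have qeq: "?q (1 / u) / u\<^sup>2 = ?p2 u" if "u > 1" for u
  proof -
    have "(1 / u) powr (a - 3 / 2) / u\<^sup>2 = u powr (- a - 1 / 2)"
      using that powr_realpow[of u 2] by (simp add: powr_divide powr_diff powr_minus field_simps flip: powr_add)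
    thus ?thesis by (simp flip: times_divide_eq_right)
  qed
  have p2': "set_integrable lborel {1<..} ?p2" by (rule set_integrable_subset[OF p2]) auto
  have qi: "set_integrable lborel {1<..} (\<lambda>u. ?q (1 / u) / u\<^sup>2)"
    using p2' by (rule set_integrable_cong[THEN iffD1, rotated -1]) (use qeq in auto)
  have qc: "continuous_on {0<..} ?q"
    by (auto intro!: continuous_intros continuous_on_compose2[OF continuous_on_theta_tail])
  note q = set_integral_reciprocal[OF qc qi]
  have q2: "(LBINT t:{0<..<1}. ?q t) = (LBINT t:{1..}. ?p2 t)"
  proof -
    have "(LBINT t:{0<..<1}. ?q t) = (LBINT t:{1<..}. ?p2 t)"
      unfolding q(2) by (rule set_lebesgue_integral_cong) (use qeq in auto)
    also have "\<dots> = (LBINT t:{1..}. ?p2 t)"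
      unfolding set_lebesgue_integral_def
    proof (rule integral_cong_AE)
      show "AE t in lborel. indicator {1<..} t *\<^sub>R ?p2 t = indicator {1..} t *\<^sub>R ?p2 t"
        using AE_lborel_singleton[of "1::real"] by eventually_elim (auto simp: indicator_def)
    qed (use p2 p2' in \<open>auto simp: set_integrable_def\<close>)
    finally show ?thesis .
  qed
  have w1: "?p1 t = ?q t + (1 / 2) * (t powr (a - 3 / 2) - t powr (a - 1))" if t: "t > 0" for t
  proof -
    have "theta_tail t = theta_tail (1 / t) / sqrt t + (1 / sqrt t - 1) / 2"
      using theta_tail_functional_equation[OF t] t by (simp add: field_simps)
    moreover have "t powr (a - 3 / 2) = t powr (a - 1) / sqrt t"
      using t by (simp add: powr_half_sqrt[symmetric] flip: powr_diff)
    moreover have "(b / r + (1 / r - 1) / 2) * y = b * (y / r) + 1 / 2 * (y / r - y)" for b r y :: real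
      by (simp add: algebra_simps add_divide_distrib diff_divide_distrib)
    ultimately show ?thesis by (simp only:)
  qed
  note pw = integral_powr_Ioo[of "a - 3 / 2"] integral_powr_Ioo[of "a - 1"]
  \<comment> \<open>The constant term of the theta series leaves these two powers; integrated over
    the unit interval they become the poles at 1 and 0.\<close>
  let ?d = "\<lambda>t::real. (1 / 2) * (t powr (a - 3 / 2) - t powr (a - 1))"
  have d: "set_integrable lborel {0<..<1} ?d" "(LBINT t:{0<..<1}. ?d t) = 1 / (\<sigma> - 1) - 1 / \<sigma>"
  proof -
    show "set_integrable lborel {0<..<1} ?d" using pw a by (intro set_integrable_mult_right set_integral_diff) auto
    have "(LBINT t:{0<..<1}. ?d t) = (1 / 2) * (1 / (a - 3 / 2 + 1) - 1 / (a - 1 + 1))"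
      unfolding set_integral_mult_right using pw a by (subst set_integral_diff) auto
    also have "\<dots> = 1 / (\<sigma> - 1) - 1 / \<sigma>" using sigma by (simp add: a_def field_simps)
    finally show "(LBINT t:{0<..<1}. ?d t) = 1 / (\<sigma> - 1) - 1 / \<sigma>" .
  qed
  have lo: "set_integrable lborel {0<..<1} ?p1" "(LBINT t:{0<..<1}. ?p1 t) = (LBINT t:{1..}. ?p2 t) + (1 / (\<sigma> - 1) - 1 / \<sigma>)"
  proof -
    show "set_integrable lborel {0<..<1} ?p1"
      using set_integral_add(1)[OF q(1) d(1)]
      by (rule set_integrable_cong[THEN iffD1, rotated -1]) (use w1 in auto)
    have "(LBINT t:{0<..<1}. ?p1 t) = (LBINT t:{0<..<1}. ?q t + ?d t)"
      by (rule set_lebesgue_integral_cong) (use w1 in auto)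
    also have "\<dots> = (LBINT t:{0<..<1}. ?q t) + (LBINT t:{0<..<1}. ?d t)" by (rule set_integral_add(2)[OF q(1) d(1)])
    finally show "(LBINT t:{0<..<1}. ?p1 t) = (LBINT t:{1..}. ?p2 t) + (1 / (\<sigma> - 1) - 1 / \<sigma>)"
      unfolding q2 d(2) .
  qed
  have un: "{0<..} = {0<..<1} \<union> {1::real..}" by auto
  have tot: "(LBINT t:{0<..}. ?p1 t) = (LBINT t:{1..}. ?p1 t) + (LBINT t:{1..}. ?p2 t) + (1 / (\<sigma> - 1) - 1 / \<sigma>)"
    unfolding un using lo p1 by (subst set_integral_Un) auto
  let ?f = "\<lambda>n t. t powr (a - 1) * exp (- ((pi * real (Suc n) ^ 2) * t))"
  have G: "set_integrable lborel {0<..} (?f n)" "(LBINT t:{0<..}. ?f n t) = Gamma a * (pi * real (Suc n) ^ 2) powr (- a)" for n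
    using integral_Gamma_scaled[of a "pi * real (Suc n) ^ 2"] a by auto
  have S: "(\<lambda>n. ?f n t) sums ?p1 t" if t: "t > 0" for t
    unfolding theta_tail_def using sums_mult[OF summable_sums[OF summable_theta_tail[OF t]], of "t powr (a - 1)"]
    by (simp add: mult_ac)
  have nrm: "(LBINT t:{0<..}. norm (?f n t)) = (LBINT t:{0<..}. ?f n t)" for n
    by (rule set_lebesgue_integral_cong) auto
  have "summable (\<lambda>n. real (Suc n) powr (- \<sigma>))"
    using sigma by (subst summable_Suc_iff) (simp add: summable_real_powr_iff)
  hence "summable (\<lambda>n. (Gamma a * pi powr (- a)) * real (Suc n) powr (- \<sigma>))" by (rule summable_mult)
  also have "(\<lambda>n. (Gamma a * pi powr (- a)) * real (Suc n) powr (- \<sigma>)) = (\<lambda>n. Gamma a * (pi * real (Suc n) ^ 2) powr (- a))"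
  proof
    fix n
    have "(real (Suc n) ^ 2) powr (- a) = real (Suc n) powr (- \<sigma>)"
      unfolding a_def by (rule square_powr) auto
    thus "(Gamma a * pi powr (- a)) * real (Suc n) powr (- \<sigma>) = Gamma a * (pi * real (Suc n) ^ 2) powr (- a)"
      by (subst powr_mult) auto
  qed
  finally have sm: "summable (\<lambda>n. LBINT t:{0<..}. norm (?f n t))" unfolding nrm G(2) .
  have s2: "summable (\<lambda>n. norm (?f n t))" if "t \<in> {0<..}" for t
    using S[of t] that by (simp add: sums_iff)
  have "(\<lambda>n. LBINT t:{0<..}. ?f n t) sums (LBINT t:{0<..}. \<Sum>n. ?f n t)"
    by (rule set_integral_suminf(2)[OF G(1) s2 sm])
  also have "(LBINT t:{0<..}. \<Sum>n. ?f n t) = (LBINT t:{0<..}. ?p1 t)"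
    by (rule set_lebesgue_integral_cong) (use S in \<open>auto simp: sums_iff\<close>)
  finally have "(\<lambda>n. Gamma a * (pi * real (Suc n) ^ 2) powr (- a)) sums
     ((LBINT t:{1..}. ?p1 t) + (LBINT t:{1..}. ?p2 t) + (1 / (\<sigma> - 1) - 1 / \<sigma>))"
    unfolding G(2) tot .
  hence "(\<lambda>n. complex_of_real (Gamma a * (pi * real (Suc n) ^ 2) powr (- a))) sums
     of_real ((LBINT t:{1..}. ?p1 t) + (LBINT t:{1..}. ?p2 t) + (1 / (\<sigma> - 1) - 1 / \<sigma>))"
    by (rule sums_of_real)
  thus ?thesis unfolding xi a_def by simp
qed

text \<open>Near \<open>s\<close> the terms are dominated by
  \<open>(n + 1) powr (- (1 + d))\<close>, with \<open>d\<close> half the distance of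
  \<open>Re s\<close> from 1; by Weierstrass the series may be differentiated term by term.\<close>

lemma dirichlet_series_properties:
  obtains g g' where
    "\<And>s. Re s > 1 \<Longrightarrow> (\<lambda>n. 1 / of_nat (Suc n) powr s) sums g s"
    "\<And>s. Re s > 1 \<Longrightarrow> (\<lambda>n. - (of_real (ln (real (Suc n))) / of_nat (Suc n) powr s)) sums g' s"
    "\<And>s. Re s > 1 \<Longrightarrow> (g has_field_derivative g' s) (at s)"
proof -
  have "\<exists>g g'. \<forall>s\<in>{s. Re s > 1}. ((\<lambda>n. 1 / of_nat (Suc n) powr s) sums g s) \<and>
     ((\<lambda>n. - (of_real (ln (real (Suc n))) / of_nat (Suc n) powr s)) sums g' s) \<and> (g has_field_derivative g' s) (at s)"
  proof (rule series_and_derivative_comparison_local)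
    show "open {s. Re s > 1}" by (rule open_halfspace_Re_gt)
    fix n :: nat and s :: complex assume "s \<in> {s. Re s > 1}"
    have ln: "Ln (of_nat (Suc n)) = of_real (ln (real (Suc n)))"
      using Ln_of_real[of "real (Suc n)"] by simp
    show "((\<lambda>s. 1 / of_nat (Suc n) powr s) has_field_derivative - (of_real (ln (real (Suc n))) / of_nat (Suc n) powr s)) (at s)"
      unfolding powr_def ln by (auto intro!: derivative_eq_intros simp: power2_eq_square simp del: of_nat_Suc)
  next
    fix s :: complex assume s: "s \<in> {s. Re s > 1}"
    define d where "d = (Re s - 1) / 2"
    have d: "d > 0" using s by (simp add: d_def)
    show "\<exists>d h. 0 < d \<and> summable h \<and> (\<forall>\<^sub>F n in sequentially. \<forall>y\<in>ball s d \<inter> {s. Re s > 1}.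
       norm (1 / of_nat (Suc n) powr y) \<le> h n)"
    proof (intro exI conjI always_eventually allI ballI)
      show "d > 0" by (fact d)
      show "summable (\<lambda>n. real (Suc n) powr (- (1 + d)))"
        using d by (subst summable_Suc_iff) (simp add: summable_real_powr_iff)
      fix n :: nat and y assume "y \<in> ball s d \<inter> {s. Re s > 1}"
      hence "norm (s - y) < d" by (simp add: dist_norm)
      hence "Re s - Re y < d" using abs_Re_le_cmod[of "s - y"] by simp
      hence y: "Re y \<ge> 1 + d" by (simp add: d_def field_simps)
      have "norm (1 / of_nat (Suc n) powr y) = real (Suc n) powr (- Re y)"
        by (simp add: norm_divide norm_powr_real_powr powr_minus field_simps del: of_nat_Suc)
      also have "\<dots> \<le> real (Suc n) powr (- (1 + d))" using y by (intro powr_mono) auto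
      finally show "norm (1 / of_nat (Suc n) powr y) \<le> real (Suc n) powr (- (1 + d))" .
    qed
  qed
  then obtain g g' where "\<And>s. s\<in>{s. Re s > 1} \<Longrightarrow> ((\<lambda>n. 1 / of_nat (Suc n) powr s) sums g s) \<and>
     ((\<lambda>n. - (of_real (ln (real (Suc n))) / of_nat (Suc n) powr s)) sums g' s) \<and> (g has_field_derivative g' s) (at s)"
    by blast
  thus ?thesis by (intro that[of g g']) auto
qed

text \<open>The pole of \<open>1 / (s * (s - 1)) = 1 / (s - 1) - 1 / s\<close> at 0 is cancelled by
  the zero of \<open>rGamma (s / 2)\<close> there; writing \<open>rGamma (s / 2) / s\<close> as
  \<open>rGamma (s / 2 + 1) / 2\<close> makes this visible and leaves only the singularity at
  1.\<close>

definition zeta_cont :: "complex \<Rightarrow> complex" where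
  "zeta_cont s = of_real pi powr (s / 2) *
     (rGamma (s / 2) * (xi_int (s - 1 / 2) + 1 / (s - 1)) - rGamma (s / 2 + 1) / 2)"

lemma zeta_cont_eq:
  assumes "s \<noteq> 0" "s \<noteq> 1"
  shows "zeta_cont s = of_real pi powr (s / 2) * rGamma (s / 2) * (xi_int (s - 1 / 2) + 1 / (s * (s - 1)))"
proof -
  have "rGamma (s / 2) = s / 2 * rGamma (s / 2 + 1)" by (rule rGamma_plus1[symmetric])
  hence "rGamma (s / 2 + 1) / 2 = rGamma (s / 2) / s" using assms by simp
  moreover have "1 / (s * (s - 1)) = 1 / (s - 1) - 1 / s" using assms by (simp add: divide_simps)
  ultimately show ?thesis unfolding zeta_cont_def by (simp only:) (simp add: algebra_simps)
qed

lemma zeta_cont_holomorphic: "zeta_cont holomorphic_on - {1}"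
proof -
  have "(\<lambda>s. xi_int (s - 1 / 2)) holomorphic_on - {1}"
    by (rule holomorphic_on_compose_gen[OF _ xi_int_holomorphic, unfolded o_def]) (auto intro!: holomorphic_intros)
  thus ?thesis unfolding zeta_cont_def[abs_def] by (intro holomorphic_intros) auto
qed

lemma of_nat_powr_of_real: "complex_of_nat (Suc n) powr of_real \<sigma> = of_real (real (Suc n) powr \<sigma>)"
  by (metis of_real_of_nat_eq powr_of_real of_nat_0_le_iff)

text \<open>On the real half-line beyond 1 this is \<open>mellin_theta_tail\<close> divided by the
  Gamma factor. Both sides are holomorphic for \<open>Re s > 1\<close> and the real points
  accumulate at 2, so the identity theorem applies.\<close>

lemma zeta_cont_sums:
  assumes s: "Re s > 1"
  shows "(\<lambda>n. 1 / of_nat (Suc n) powr s) sums zeta_cont s"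
proof -
  obtain g g' where g: "\<And>s. Re s > 1 \<Longrightarrow> (\<lambda>n. 1 / of_nat (Suc n) powr s) sums g s"
    "\<And>s. Re s > 1 \<Longrightarrow> (g has_field_derivative g' s) (at s)"
    using dirichlet_series_properties by metis
  have real: "zeta_cont (of_real \<sigma>) = g (of_real \<sigma>)" if sigma: "\<sigma> > 1" for \<sigma> :: real
  proof -
    let ?G = "Gamma (\<sigma> / 2) * pi powr (- (\<sigma> / 2))"
    have "?G > 0" using sigma by simp
    hence G: "complex_of_real ?G \<noteq> 0" by auto
    have 1: "(\<lambda>n. of_real ?G * (1 / of_nat (Suc n) powr of_real \<sigma>)) sums (of_real ?G * g (of_real \<sigma>))"
      using sigma by (intro sums_mult g) auto
    have 2: "(\<lambda>n. of_real ?G * (1 / of_nat (Suc n) powr of_real \<sigma>)) =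
       (\<lambda>n. complex_of_real (Gamma (\<sigma> / 2) * (pi * real (Suc n) ^ 2) powr (- (\<sigma> / 2))))"
    proof
      fix n
      note of_nat_powr_of_real[of n \<sigma>]
      moreover have "(pi * real (Suc n) ^ 2) powr (- (\<sigma> / 2)) = pi powr (- (\<sigma> / 2)) * real (Suc n) powr (- \<sigma>)"
        by (subst powr_mult) (auto simp: square_powr simp del: of_nat_Suc)
      ultimately show "of_real ?G * (1 / of_nat (Suc n) powr of_real \<sigma>) =
         complex_of_real (Gamma (\<sigma> / 2) * (pi * real (Suc n) ^ 2) powr (- (\<sigma> / 2)))"
        by (simp add: powr_minus field_simps)
    qed
    have "of_real ?G * g (of_real \<sigma>) = xi_int (of_real \<sigma> - 1 / 2) + of_real (1 / (\<sigma> - 1) - 1 / \<sigma>)"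
      by (rule sums_unique2[OF 1[unfolded 2] mellin_theta_tail[OF sigma]])
    also have "of_real (1 / (\<sigma> - 1) - 1 / \<sigma>) = 1 / (complex_of_real \<sigma> * (of_real \<sigma> - 1))"
    proof -
      have "1 / (\<sigma> - 1) - 1 / \<sigma> = 1 / (\<sigma> * (\<sigma> - 1))" using sigma by (simp add: divide_simps)
      thus ?thesis by simp
    qed
    finally have "of_real ?G * g (of_real \<sigma>) = xi_int (of_real \<sigma> - 1 / 2) + 1 / (complex_of_real \<sigma> * (of_real \<sigma> - 1))" .
    moreover have "of_real pi powr (of_real \<sigma> / 2) * rGamma (of_real \<sigma> / 2) = 1 / complex_of_real ?G"
    proof -
      have "complex_of_real pi powr (of_real \<sigma> / 2) = of_real (pi powr (\<sigma> / 2))"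
        using powr_of_real[of pi "\<sigma> / 2"] by simp
      moreover have "rGamma (of_real \<sigma> / 2) = complex_of_real (inverse (Gamma (\<sigma> / 2)))"
        using rGamma_complex_of_real[of "\<sigma> / 2"] by (simp add: rGamma_inverse_Gamma)
      ultimately show ?thesis by (simp add: powr_minus field_simps)
    qed
    moreover have "zeta_cont (of_real \<sigma>) = of_real pi powr (of_real \<sigma> / 2) * rGamma (of_real \<sigma> / 2) *
        (xi_int (of_real \<sigma> - 1 / 2) + 1 / (of_real \<sigma> * (of_real \<sigma> - 1)))"
      using sigma by (intro zeta_cont_eq) auto
    ultimately have "zeta_cont (of_real \<sigma>) = 1 / complex_of_real ?G * (of_real ?G * g (of_real \<sigma>))"
      by (simp only:)
    moreover have "1 / c * (c * y) = y" if "c \<noteq> 0" for c y :: complex using that by simp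
    ultimately show ?thesis using G by (simp only: not_False_eq_True)
  qed
  have "zeta_cont s - g s = 0"
  proof (rule analytic_continuation[where f = "\<lambda>s. zeta_cont s - g s" and S = "{s. Re s > 1}" and U = "of_real ` {1<..}" and \<xi> = 2])
    have "g holomorphic_on {s. Re s > 1}"
      using g(2) by (subst holomorphic_on_open) (auto simp: open_halfspace_Re_gt)
    moreover have "zeta_cont holomorphic_on {s. Re s > 1}"
      by (rule holomorphic_on_subset[OF zeta_cont_holomorphic]) auto
    ultimately show "(\<lambda>s. zeta_cont s - g s) holomorphic_on {s. Re s > 1}" by (rule holomorphic_on_diff[rotated])
    show "open {s. Re s > 1}" by (rule open_halfspace_Re_gt)
    show "connected {s. Re s > 1}" by (intro convex_connected convex_halfspace_Re_gt)
    show "(2::complex) islimpt of_real ` {1<..}"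
    proof (subst islimpt_approachable, safe)
      fix e :: real assume "e > 0"
      thus "\<exists>x'\<in>complex_of_real ` {1<..}. x' \<noteq> 2 \<and> dist x' 2 < e"
        by (intro bexI[of _ "of_real (2 + e / 2)"] conjI) (auto simp: dist_norm complex_eq_iff cmod_def)
    qed
    show "zeta_cont z - g z = 0" if "z \<in> of_real ` {1<..}" for z using that real by auto
  qed (use s in auto)
  thus ?thesis using g(1)[OF s] by simp
qed

text \<open>For the description defining \<open>riemann_zeta\<close>, \<open>zeta_cont\<close> gives
  existence, and the identity theorem on the connected punctured plane gives uniqueness. At 1 the
  formula for \<open>zeta_cont\<close> divides by zero, whence the separate value there.\<close>

lemma riemann_zeta_eq: "riemann_zeta = (\<lambda>s. if s = 1 then 0 else zeta_cont s)"
proof -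
  define Z where "Z = (\<lambda>s. if s = 1 then 0 else zeta_cont s)"
  have "Z holomorphic_on - {1}"
    unfolding Z_def by (rule holomorphic_transform[OF zeta_cont_holomorphic]) auto
  hence Z: "Z holomorphic_on - {1} \<and> (\<forall>s. Re s > 1 \<longrightarrow> (\<lambda>n. 1 / of_nat (Suc n) powr s) sums Z s) \<and> Z 1 = 0"
    using zeta_cont_sums unfolding Z_def by auto
  have uniq: "f = Z"
    if f: "f holomorphic_on - {1} \<and> (\<forall>s. Re s > 1 \<longrightarrow> (\<lambda>n. 1 / of_nat (Suc n) powr s) sums f s) \<and> f 1 = 0" for f
  proof -
    have "f s = zeta_cont s" if "s \<noteq> 1" for s
    proof (rule analytic_continuation_open[where s = "{s. Re s > 1}" and s' = "- {1}" and f = f and g = zeta_cont and z = s])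
      have "2 \<in> {s. Re s > 1}" by simp
      thus "{s. Re s > 1} \<noteq> {}" by blast
      show "connected (- {1::complex})" by (rule connected_punctured_universe) simp
      show "f z = zeta_cont z" if "z \<in> {s. Re s > 1}" for z
        using that f zeta_cont_sums[of z] sums_unique2[of "\<lambda>n. 1 / of_nat (Suc n) powr z"] by simp
    qed (use f that zeta_cont_holomorphic in \<open>auto simp: open_halfspace_Re_gt\<close>)
    thus ?thesis using f by (auto simp: Z_def)
  qed
  have "riemann_zeta = Z" unfolding riemann_zeta_def
    by (rule the_equality, rule Z, rule uniq)
  thus ?thesis by (simp add: Z_def)
qed

lemma riemann_zeta_holomorphic: "riemann_zeta holomorphic_on - {1}"
  unfolding riemann_zeta_eq by (rule holomorphic_transform[OF zeta_cont_holomorphic]) auto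

lemma riemann_zeta_sums: "Re s > 1 \<Longrightarrow> (\<lambda>n. 1 / of_nat (Suc n) powr s) sums riemann_zeta s"
  unfolding riemann_zeta_eq using zeta_cont_sums[of s] by auto

text \<open>Because \<open>(s - 1 / 2)^2 - 1 / 4 = s * (s - 1)\<close>. Apart from the explicit
  factor, zeta is now a function of \<open>(s - 1 / 2)^2\<close>, which is the functional
  equation.\<close>

lemma riemann_zeta_eq_xi_sq:
  assumes "s \<noteq> 0" "s \<noteq> 1"
  shows "riemann_zeta s = of_real pi powr (s / 2) * rGamma (s / 2) / (s * (s - 1)) * xi_sq ((s - 1 / 2)\<^sup>2)"
proof -
  have "(s - 1 / 2)\<^sup>2 - 1 / 4 = s * (s - 1)" by (simp add: power2_eq_square field_simps)
  hence "xi_sq ((s - 1 / 2)\<^sup>2) = 1 + s * (s - 1) * xi_int (s - 1 / 2)" unfolding xi_sq_square by simp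
  hence "xi_sq ((s - 1 / 2)\<^sup>2) / (s * (s - 1)) = xi_int (s - 1 / 2) + 1 / (s * (s - 1))"
    using assms by (simp add: field_simps)
  thus ?thesis using assms zeta_cont_eq[OF assms] by (simp add: riemann_zeta_eq flip: times_divide_eq_right)
qed

section \<open>Zeros of the zeta function\<close>

lemma norm_inverse_powr: "norm (c / of_nat (Suc n) powr s) = norm c / real (Suc n) powr Re s" for c s :: complex
  by (simp add: norm_divide norm_powr_real_powr del: of_nat_Suc)

text \<open>The series with \<open>ln\<close> converges as the termwise derivative of the Dirichlet
  series, and it dominates the one with \<open>mangoldt\<close>.\<close>

lemma summable_mangoldt_powr:
  assumes \<sigma>: "\<sigma> > 1"
  shows "summable (\<lambda>n. ln (real (Suc n)) / real (Suc n) powr \<sigma>)"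
    "summable (\<lambda>n. mangoldt (Suc n) / real (Suc n) powr \<sigma>)"
proof -
  obtain g g' where "\<And>s. Re s > 1 \<Longrightarrow> (\<lambda>n. - (of_real (ln (real (Suc n))) / of_nat (Suc n) powr s)) sums (g' s :: complex)"
    using dirichlet_series_properties by metis
  from this[of "of_real \<sigma>"] have "summable (\<lambda>n. - (of_real (ln (real (Suc n))) / of_nat (Suc n) powr (of_real \<sigma> :: complex)))"
    using \<sigma> by (auto simp: sums_iff)
  hence "summable (\<lambda>n. Re (of_real (ln (real (Suc n))) / of_nat (Suc n) powr (of_real \<sigma> :: complex)))"
    by (intro summable_Re) (simp only: summable_minus_iff)
  moreover have "Re (of_real (ln (real (Suc n))) / of_nat (Suc n) powr (of_real \<sigma> :: complex)) = ln (real (Suc n)) / real (Suc n) powr \<sigma>" for n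
    by (simp only: of_nat_powr_of_real of_real_divide[symmetric] Re_complex_of_real)
  ultimately show *: "summable (\<lambda>n. ln (real (Suc n)) / real (Suc n) powr \<sigma>)" by (simp only:)
  show "summable (\<lambda>n. mangoldt (Suc n) / real (Suc n) powr \<sigma>)"
    by (rule summable_comparison_test'[OF *]) (auto intro!: divide_right_mono mangoldt_le simp del: of_nat_Suc)
qed

lemma summable_inverse_powr:
  assumes "\<sigma> > 1" shows "summable (\<lambda>n. 1 / real (Suc n) powr \<sigma>)"
proof -
  have "summable (\<lambda>n. real (Suc n) powr (- \<sigma>))"
    using assms by (subst summable_Suc_iff) (simp add: summable_real_powr_iff)
  thus ?thesis by (simp add: powr_minus inverse_eq_divide del: of_nat_Suc)
qed

lemma riemann_zeta_deriv_sums: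
  assumes s: "Re s > 1"
  shows "(\<lambda>n. - (of_real (ln (real (Suc n))) / of_nat (Suc n) powr s)) sums deriv riemann_zeta s"
proof -
  obtain g g' where g: "\<And>s. Re s > 1 \<Longrightarrow> (\<lambda>n. 1 / of_nat (Suc n) powr s) sums g s"
    "\<And>s. Re s > 1 \<Longrightarrow> (\<lambda>n. - (of_real (ln (real (Suc n))) / of_nat (Suc n) powr s)) sums g' s"
    "\<And>s. Re s > 1 \<Longrightarrow> (g has_field_derivative g' s) (at s)"
    by (rule dirichlet_series_properties) blast
  have eq: "riemann_zeta s = g s" if "Re s > 1" for s
    by (rule sums_unique2[OF riemann_zeta_sums[OF that] g(1)[OF that]])
  have "\<forall>\<^sub>F u in nhds s. riemann_zeta u = g u"
    using eventually_nhds_in_open[of "{s. Re s > 1}" s] s eq by (auto simp: open_halfspace_Re_gt elim: eventually_mono)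
  hence "deriv riemann_zeta s = deriv g s" by (rule deriv_cong_ev) simp
  also have "\<dots> = g' s" using g(3)[OF s] by (rule DERIV_imp_deriv)
  finally show ?thesis using g(2)[OF s] by simp
qed

lemma has_sum_from_1:
  fixes f :: "nat \<Rightarrow> complex"
  assumes "summable (\<lambda>n. norm (f (Suc n)))" "(\<lambda>n. f (Suc n)) sums S"
  shows "(f has_sum S) {1..}" "(\<lambda>n. norm (f n)) summable_on {1..}"
proof -
  have "((\<lambda>n. f (Suc n)) has_sum S) UNIV" by (rule norm_summable_imp_has_sum[OF assms])
  thus "(f has_sum S) {1..}"
    by (rule has_sum_reindex_bij_witness[of "{1..}" Suc "\<lambda>n. n - 1" UNIV "\<lambda>n. f (Suc n)" f S S, THEN iffD2, rotated -1]) auto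
  have "summable (\<lambda>n. norm (norm (f (Suc n))))" using assms(1) by simp
  from norm_summable_imp_has_sum[OF this summable_sums[OF assms(1)]]
  have "((\<lambda>n. norm (f (Suc n))) has_sum (\<Sum>n. norm (f (Suc n)))) UNIV" .
  hence "((\<lambda>n. norm (f n)) has_sum (\<Sum>n. norm (f (Suc n)))) {1..}"
    by (rule has_sum_reindex_bij_witness[of "{1..}" Suc "\<lambda>n. n - 1" UNIV, THEN iffD2, rotated -1]) auto
  thus "(\<lambda>n. norm (f n)) summable_on {1..}" by (auto simp: summable_on_def)
qed

text \<open>Summing \<open>mangoldt d\<close> over the divisors \<open>d\<close> of \<open>n\<close>
  gives \<open>ln n\<close>. The double series over \<open>(d, m)\<close> converges absolutely and
  is summed once as a product and once along \<open>n = d * m\<close>. The statement is multiplied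
  out because zeros of zeta in this half-plane are excluded only afterwards, with its help.\<close>

lemma riemann_zeta_logderiv:
  assumes s: "Re s > 1"
  shows "deriv riemann_zeta s = - (\<Sum>n. mangoldt (Suc n) / of_nat (Suc n) powr s) * riemann_zeta s"
proof -
  define p where "p = (\<lambda>n. of_nat n powr s :: complex)"
  define D where "D = (\<Sum>n. mangoldt (Suc n) / p (Suc n))"
  have nrm: "norm (c / p (Suc n)) = norm c / real (Suc n) powr Re s" for c n
    unfolding p_def by (rule norm_inverse_powr)
  have "summable (\<lambda>n. norm (mangoldt (Suc n) / p (Suc n)))"
    unfolding nrm using summable_mangoldt_powr(2)[OF s] by simp
  moreover from this have "(\<lambda>n. mangoldt (Suc n) / p (Suc n)) sums D"
    unfolding D_def by (intro summable_sums) (rule summable_norm_cancel)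
  ultimately have D: "((\<lambda>n. mangoldt n / p n) has_sum D) {1..}" "(\<lambda>n. norm (mangoldt n / p n)) summable_on {1..}"
    by (rule has_sum_from_1)+
  have Z: "((\<lambda>n. 1 / p n) has_sum riemann_zeta s) {1..}" "(\<lambda>n. norm (1 / p n)) summable_on {1..}"
    using summable_inverse_powr[OF s] riemann_zeta_sums[OF s] nrm[of 1]
    by (intro has_sum_from_1; simp add: p_def)+
  have L: "((\<lambda>n. - (of_real (ln (real n)) / p n)) has_sum deriv riemann_zeta s) {1..}"
  proof (rule has_sum_from_1)
    show "summable (\<lambda>n. norm (- (complex_of_real (ln (real (Suc n))) / p (Suc n))))"
      using summable_mangoldt_powr(1)[OF s] by (simp add: nrm del: of_nat_Suc)
    show "(\<lambda>n. - (complex_of_real (ln (real (Suc n))) / p (Suc n))) sums deriv riemann_zeta s"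
      unfolding p_def by (rule riemann_zeta_deriv_sums[OF s])
  qed
  define F where "F = (\<lambda>(d, m). (mangoldt d / p d) * (1 / p m))"
  have "(\<lambda>x. norm (F x)) summable_on ({1..} \<times> {1..})"
  proof (subst Infinite_Sum.abs_summable_on_Sigma_iff, intro conjI ballI)
    fix d :: nat assume "d \<in> {1..}"
    show "(\<lambda>m. norm (F (d, m))) summable_on {1..}"
      unfolding F_def prod.case norm_mult by (rule summable_on_cmult_right[OF Z(2)])
  next
    have "(\<Sum>\<^sub>\<infinity>m\<in>{1..}. norm (F (d, m))) = norm (mangoldt d / p d) * (\<Sum>\<^sub>\<infinity>m\<in>{1..}. norm (1 / p m))" for d
      unfolding F_def prod.case norm_mult by (rule infsum_cmult_right[OF Z(2)])
    thus "(\<lambda>d. norm (\<Sum>\<^sub>\<infinity>m\<in>{1..}. norm (F (d, m)))) summable_on {1..}"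
      using summable_on_cmult_left[OF D(2), of "norm (\<Sum>\<^sub>\<infinity>m\<in>{1..}. norm (1 / p m))"]
      by (simp only: norm_mult real_norm_def abs_mult abs_norm_cancel)
  qed
  hence "F summable_on ({1..} \<times> {1..})" by (rule abs_summable_summable)
  then obtain T where T: "(F has_sum T) ({1..} \<times> {1..})" by (auto simp: summable_on_def)
  have "((\<lambda>d. (mangoldt d / p d) * riemann_zeta s) has_sum T) {1..}"
  proof (rule has_sum_Sigma'[OF T])
    fix d :: nat
    show "((\<lambda>m. F (d, m)) has_sum (mangoldt d / p d) * riemann_zeta s) {1..}"
      unfolding F_def prod.case by (rule has_sum_cmult_right[OF Z(1)])
  qed
  hence T1: "T = D * riemann_zeta s"
    using has_sum_cmult_left[OF D(1), of "riemann_zeta s"] has_sum_unique by blast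
  \<comment> \<open>Factor pairs \<open>(d, m)\<close> are reindexed by the product
    \<open>n = d * m\<close> together with its divisor \<open>d\<close>.\<close>
  have "((\<lambda>(n, d). mangoldt d / p n) has_sum T) (SIGMA n:{1..}. {d. d dvd n})"
  proof (rule has_sum_reindex_bij_witness[of "{1..} \<times> {1..}" "\<lambda>(n, d). (d, n div d)" "\<lambda>(d, m). (d * m, d)", THEN iffD1, OF _ _ _ _ _ refl T])
    fix a :: "nat \<times> nat" assume "a \<in> {1..} \<times> {1..}"
    then obtain d m where a: "a = (d, m)" "d \<ge> 1" "m \<ge> 1" by auto
    have "p (d * m) = p d * p m" unfolding p_def by (simp add: powr_times_real)
    thus "(case case a of (d, m) \<Rightarrow> (d * m, d) of (n, d) \<Rightarrow> mangoldt d / p n) = F a"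
      by (simp add: a F_def)
    show "(case case a of (d, m) \<Rightarrow> (d * m, d) of (n, d) \<Rightarrow> (d, n div d)) = a" using a by auto
    show "(case a of (d, m) \<Rightarrow> (d * m, d)) \<in> (SIGMA n:{1..}. {d. d dvd n})" using a by (auto simp: Suc_le_eq)
  next
    fix b :: "nat \<times> nat" assume "b \<in> (SIGMA n:{1..}. {d. d dvd n})"
    then obtain n d where b: "b = (n, d)" "n \<ge> 1" "d dvd n" by auto
    hence "d \<ge> 1" by (auto simp: Suc_le_eq intro!: Nat.gr0I)
    thus "(case case b of (n, d) \<Rightarrow> (d, n div d) of (d, m) \<Rightarrow> (d * m, d)) = b"
      "(case b of (n, d) \<Rightarrow> (d, n div d)) \<in> {1..} \<times> {1..}"
      using b by (auto simp: Suc_le_eq div_greater_zero_iff dvd_imp_le)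
  qed
  hence "((\<lambda>n. of_real (ln (real n)) / p n) has_sum T) {1..}"
  proof (rule has_sum_Sigma')
    fix n :: nat assume n: "n \<in> {1..}"
    have "((\<lambda>d. mangoldt d / p n) has_sum (\<Sum>d | d dvd n. mangoldt d / p n)) {d. d dvd n}"
      using n by (intro has_sum_finite) auto
    also have "(\<Sum>d | d dvd n. mangoldt d / p n) = of_real (ln (real n)) / p n"
      using n mangoldt_sum[of n, where ?'a = complex] by (simp add: sum_divide_distrib[symmetric])
    finally show "((\<lambda>d. case (n, d) of (n, d) \<Rightarrow> mangoldt d / p n) has_sum of_real (ln (real n)) / p n) {d. d dvd n}"
      by simp
  qed
  hence "((\<lambda>n. - (of_real (ln (real n)) / p n)) has_sum - T) {1..}" by (simp add: has_sum_uminus)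
  hence "deriv riemann_zeta s = - T" using L has_sum_unique by blast
  thus ?thesis unfolding T1 D_def p_def by simp
qed

lemma norm_mangoldt_series_le:
  assumes "\<sigma> > 1" "Re s \<ge> \<sigma>"
  shows "norm (\<Sum>n. mangoldt (Suc n) / of_nat (Suc n) powr s :: complex) \<le> (\<Sum>n. mangoldt (Suc n) / real (Suc n) powr \<sigma>)"
proof (rule norm_suminf_le)
  show "summable (\<lambda>n. mangoldt (Suc n) / real (Suc n) powr \<sigma>)" by (rule summable_mangoldt_powr(2)[OF assms(1)])
  fix n
  show "norm (mangoldt (Suc n) / of_nat (Suc n) powr s :: complex) \<le> mangoldt (Suc n) / real (Suc n) powr \<sigma>"
    unfolding norm_inverse_powr norm_mangoldt
    using assms by (intro divide_left_mono powr_mono mangoldt_nonneg mult_pos_pos) auto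
qed

text \<open>A sum of positive terms. It shows that zeta does not vanish identically on the
  half-plane, so that a zero there would have a finite order.\<close>

lemma riemann_zeta_2_nonzero: "riemann_zeta 2 \<noteq> 0"
proof
  assume "riemann_zeta 2 = 0"
  with riemann_zeta_sums[of 2] have "(\<lambda>n. 1 / of_nat (Suc n) powr 2) sums (0::complex)" by simp
  hence "(\<lambda>n. Re (1 / of_nat (Suc n) powr 2)) sums Re 0" by (rule sums_Re)
  moreover have "Re (1 / of_nat (Suc n) powr 2) = 1 / real (Suc n) powr 2" for n
  proof -
    have "1 / complex_of_nat (Suc n) powr 2 = of_real (1 / real (Suc n) powr 2)"
      using of_nat_powr_of_real[of n 2] by (simp del: of_nat_Suc)
    thus ?thesis by (simp only: Re_complex_of_real)
  qed
  ultimately have S: "(\<lambda>n. 1 / real (Suc n) powr 2) sums 0" by (simp only: zero_complex.sel)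
  have "(\<Sum>n. 1 / real (Suc n) powr 2) > 0"
    by (rule suminf_pos[OF sums_summable[OF S]]) simp
  moreover have "(\<Sum>n. 1 / real (Suc n) powr 2) = 0" by (rule sums_unique[OF S, symmetric])
  ultimately show False by simp
qed

text \<open>At a zero the logarithmic derivative would be unbounded, whereas the von Mangoldt series is
  bounded on every half-plane strictly inside \<open>Re s > 1\<close>.\<close>

lemma riemann_zeta_nonzero:
  assumes s: "Re s > 1"
  shows "riemann_zeta s \<noteq> 0"
proof
  assume z: "riemann_zeta s = 0"
  let ?S = "{s. Re s > 1}"
  have hol: "riemann_zeta holomorphic_on ?S" by (rule holomorphic_on_subset[OF riemann_zeta_holomorphic]) auto
  define m where "m = nat (zorder riemann_zeta s)"
  define h where "h = zor_poly riemann_zeta s"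
  have "zorder riemann_zeta s > 0 \<and> (\<exists>r>0. cball s r \<subseteq> ?S \<and> h holomorphic_on cball s r \<and>
     (\<forall>u\<in>cball s r. riemann_zeta u = h u * (u - s) ^ m \<and> h u \<noteq> 0))"
  proof -
    have "\<exists>w\<in>?S. riemann_zeta w \<noteq> 0" using riemann_zeta_2_nonzero by (intro bexI[of _ 2]) auto
    from zorder_exist_zero[OF hol open_halfspace_Re_gt convex_connected[OF convex_halfspace_Re_gt] _ this, of s]
    show ?thesis using s z unfolding m_def h_def by simp
  qed
  then obtain r where r: "zorder riemann_zeta s > 0" "r > 0" "cball s r \<subseteq> ?S" "h holomorphic_on cball s r"
     "\<And>u. u \<in> cball s r \<Longrightarrow> riemann_zeta u = h u * (u - s) ^ m" "\<And>u. u \<in> cball s r \<Longrightarrow> h u \<noteq> 0" by blast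
  have m: "m > 0" using r(1) by (simp add: m_def)
  define D where "D = (\<lambda>u::complex. \<Sum>n. mangoldt (Suc n) / of_nat (Suc n) powr u :: complex)"
  have hol': "h holomorphic_on ball s r" by (rule holomorphic_on_subset[OF r(4)]) auto
  \<comment> \<open>The multiplied-out logarithmic derivative for \<open>h u * (u - s)^m\<close>,
    with the common power cancelled. As \<open>D\<close> is bounded near \<open>s\<close>, the
    right-hand side tends to 0 there, which forces \<open>h s = 0\<close>.\<close>
  have eq: "of_nat m * h u = - (D u * h u + deriv h u) * (u - s)" if u: "u \<in> ball s r" "u \<noteq> s" for u
  proof -
    have dh: "(h has_field_derivative deriv h u) (at u)" using u by (intro holomorphic_derivI[OF hol']) auto
    have "((\<lambda>u. h u * (u - s) ^ m) has_field_derivative deriv h u * (u - s) ^ m + h u * (of_nat m * (u - s) ^ (m - 1))) (at u)"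
      by (auto intro!: derivative_eq_intros dh)
    moreover have "\<forall>\<^sub>F u in nhds u. h u * (u - s) ^ m = riemann_zeta u"
      using eventually_nhds_in_open[of "ball s r" u] u r(5) by (auto elim!: eventually_mono)
    ultimately have "(riemann_zeta has_field_derivative deriv h u * (u - s) ^ m + h u * (of_nat m * (u - s) ^ (m - 1))) (at u)"
      using DERIV_cong_ev[of u u "\<lambda>u. h u * (u - s) ^ m" riemann_zeta] by blast
    hence "deriv riemann_zeta u = deriv h u * (u - s) ^ m + h u * (of_nat m * (u - s) ^ (m - 1))"
      by (rule DERIV_imp_deriv)
    moreover have "deriv riemann_zeta u = - D u * (h u * (u - s) ^ m)"
    proof -
      have u': "u \<in> cball s r" using u by simp
      hence "Re u > 1" using r(3) by blast
      from riemann_zeta_logderiv[OF this] show ?thesis unfolding D_def r(5)[OF u'] .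
    qed
    moreover have "(u - s) ^ m = (u - s) * (u - s) ^ (m - 1)" using m by (cases m) auto
    ultimately have "(u - s) ^ (m - 1) * (of_nat m * h u) = (u - s) ^ (m - 1) * (- (D u * h u + deriv h u) * (u - s))"
      by (simp add: algebra_simps)
    thus ?thesis using u by simp
  qed
  \<comment> \<open>The exponent is the midpoint of 1 and \<open>Re s\<close>, a lower bound for the
    real parts in the ball of the next step.\<close>
  define B where "B = (\<Sum>n. mangoldt (Suc n) / real (Suc n) powr ((1 + Re s) / 2))"
  have B: "norm (D u) \<le> B" if "u \<in> ball s ((Re s - 1) / 2)" for u
  proof -
    have "Re s - Re u \<le> norm (s - u)" using complex_Re_le_cmod[of "s - u"] by simp
    hence "Re u \<ge> (1 + Re s) / 2" using that by (simp add: dist_norm field_simps)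
    thus ?thesis unfolding D_def B_def using s by (intro norm_mangoldt_series_le) auto
  qed
  have ch: "isCont h s" "isCont (deriv h) s"
    using hol' holomorphic_deriv[OF hol'] r(2) holomorphic_on_imp_continuous_on continuous_on_eq_continuous_at[of "ball s r"]
    by (metis centre_in_ball open_ball)+
  have "((\<lambda>u. of_nat m * h u) \<longlongrightarrow> 0) (at s)"
  proof (rule Lim_null_comparison)
    have "\<forall>\<^sub>F u in at s. u \<in> ball s r - {s}" "\<forall>\<^sub>F u in at s. u \<in> ball s ((Re s - 1) / 2) - {s}"
      using r(2) s by (intro eventually_at_in_open; auto)+
    thus "\<forall>\<^sub>F u in at s. norm (of_nat m * h u) \<le> (B * norm (h u) + norm (deriv h u)) * norm (u - s)"
    proof eventually_elim
      case (elim u)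
      have "norm (D u * h u + deriv h u) \<le> norm (D u) * norm (h u) + norm (deriv h u)"
        by (metis norm_mult norm_triangle_ineq)
      also have "\<dots> \<le> B * norm (h u) + norm (deriv h u)" using B[of u] elim by (intro add_mono mult_right_mono) auto
      finally have "norm (D u * h u + deriv h u) * norm (u - s) \<le> (B * norm (h u) + norm (deriv h u)) * norm (u - s)"
        by (intro mult_right_mono) auto
      thus ?case using eq[of u] elim by (simp add: norm_mult norm_minus_cancel del: minus_add_distrib)
    qed
    have "((\<lambda>u. (B * norm (h u) + norm (deriv h u)) * norm (u - s)) \<longlongrightarrow> (B * norm (h s) + norm (deriv h s)) * norm (s - s)) (at s)"
      using ch by (intro tendsto_intros) (auto simp: isCont_def)
    thus "((\<lambda>u. (B * norm (h u) + norm (deriv h u)) * norm (u - s)) \<longlongrightarrow> 0) (at s)" by simp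
  qed
  moreover have "((\<lambda>u. of_nat m * h u) \<longlongrightarrow> of_nat m * h s) (at s)"
    using ch by (intro tendsto_intros) (auto simp: isCont_def)
  ultimately have "of_nat m * h s = 0" using tendsto_unique[of "at s"] by fastforce
  thus False using m r(2) r(6)[of s] by auto
qed

lemma xi_kernel_of_real:
  "xi_kernel (of_real v) t = of_real (theta_tail t * t powr (- 3 / 4) * (exp (v / 2 * ln t) + exp (- (v / 2) * ln t)))"
proof -
  have "exp (complex_of_real v / 2 * of_real (ln t)) = of_real (exp (v / 2 * ln t))"
    "exp (- (complex_of_real v / 2) * of_real (ln t)) = of_real (exp (- (v / 2) * ln t))"
    using exp_of_real[of "v / 2 * ln t", where ?'a = complex] exp_of_real[of "- (v / 2) * ln t", where ?'a = complex] by simp_all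
  thus ?thesis unfolding xi_kernel_def by simp
qed

text \<open>Zeros of zeta on the real segment would escape a list of zeros with positive imaginary
  part, so they must be excluded. For \<open>v \<ge> 1 / 2\<close> the kernel and
  \<open>v^2 - 1 / 4\<close> are nonnegative, so the real part is at least 1; for smaller
  \<open>v\<close> the factor \<open>v^2 - 1 / 4\<close> has size at most \<open>1 / 4\<close> and
  \<open>xi_int\<close> has size less than 4.\<close>

lemma xi_sq_real_nonzero:
  fixes v :: real
  assumes v: "v \<ge> 0"
  shows "xi_sq (of_real v ^ 2) \<noteq> 0"
proof (cases "v \<ge> 1 / 2")
  case True
  have "Re (xi_int (of_real v)) \<ge> 0"
  proof -
    have "Re (xi_int (of_real v)) = (LBINT t:{1..}. Re (xi_kernel (of_real v) t))"
      using integral_Re[of lborel "\<lambda>t. indicator {1..} t *\<^sub>R xi_kernel (of_real v) t"] set_integrable_xi_kernel[of "of_real v"]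
      unfolding xi_int_def set_lebesgue_integral_def set_integrable_def by simp
    also have "\<dots> \<ge> 0" unfolding set_lebesgue_integral_def
    proof (intro integral_nonneg_AE AE_I2)
      fix t :: real
      have "Re (xi_kernel (of_real v) t) = theta_tail t * t powr (- 3 / 4) * (exp (v / 2 * ln t) + exp (- (v / 2) * ln t))"
        unfolding xi_kernel_of_real by simp
      thus "0 \<le> indicat_real {1..} t *\<^sub>R Re (xi_kernel (of_real v) t)"
        using theta_tail_nonneg[of t] by (auto simp: indicator_def)
    qed
    finally show ?thesis .
  qed
  moreover have "Re (xi_sq (of_real v ^ 2)) = 1 + (v\<^sup>2 - 1 / 4) * Re (xi_int (of_real v))"
  proof -
    have "of_real v ^ 2 - 1 / 4 = complex_of_real (v\<^sup>2 - 1 / 4)" by simp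
    thus ?thesis unfolding xi_sq_square by (simp only: plus_complex.sel one_complex.sel Re_complex_of_real times_complex.sel Im_complex_of_real)
  qed
  moreover have "v\<^sup>2 \<ge> (1 / 2)\<^sup>2" using True by (intro power_mono) auto
  hence "v\<^sup>2 - 1 / 4 \<ge> 0" by (simp add: power2_eq_square)
  ultimately have "Re (xi_sq (of_real v ^ 2)) \<ge> 1" by simp
  thus ?thesis by auto
next
  case False
  \<comment> \<open>As \<open>v / 2\<close> is below \<open>3 / 4\<close>, both exponentials are at
    most \<open>t powr (3 / 4)\<close>, which cancels the power in the kernel; moreover
    \<open>pi * t \<ge> 2 * t \<ge> 1 + t\<close>. The majorant has integral
    \<open>4 * exp (- 1)\<close> over the positive reals, which is less than 4.\<close>
  have kb: "norm (xi_kernel (of_real v) t) \<le> 4 * exp (- 1) * exp (- t)" if t: "t \<ge> 1" for t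
  proof -
    have "exp (v / 2 * ln t) \<le> exp (3 / 4 * ln t)" "exp (- (v / 2) * ln t) \<le> exp (3 / 4 * ln t)"
      using t v False by (simp_all only: exp_le_cancel_iff) (intro mult_right_mono; simp)+
    hence b: "exp (v / 2 * ln t) + exp (- (v / 2) * ln t) \<le> 2 * t powr (3 / 4)"
      using t powr_def[of t "3 / 4"] by (smt (verit))
    have "xi_kernel (of_real v) t = of_real (theta_tail t * t powr (- 3 / 4) * (exp (v / 2 * ln t) + exp (- (v / 2) * ln t)))"
      by (rule xi_kernel_of_real)
    hence "norm (xi_kernel (of_real v) t) = theta_tail t * t powr (- 3 / 4) * (exp (v / 2 * ln t) + exp (- (v / 2) * ln t))"
      using theta_tail_nonneg[of t] t by (simp only: norm_of_real) (auto intro!: abs_of_nonneg mult_nonneg_nonneg)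
    also have "\<dots> \<le> (2 * exp (- (pi * t))) * t powr (- 3 / 4) * (2 * t powr (3 / 4))"
      using theta_tail_le[OF t] theta_tail_nonneg[of t] t b by (intro mult_mono) auto
    also have "\<dots> = 4 * exp (- (pi * t)) * (t powr (- 3 / 4) * t powr (3 / 4))" by simp
    also have "t powr (- 3 / 4) * t powr (3 / 4) = 1" using t by (simp flip: powr_add)
    also have "exp (- (pi * t)) \<le> exp (- 1 - t)"
    proof -
      have "2 * t \<le> pi * t" using t pi_ge_two by (intro mult_right_mono) auto
      hence "- (pi * t) \<le> - 1 - t" using t by linarith
      thus ?thesis by simp
    qed
    finally show ?thesis by (simp add: exp_diff exp_minus field_simps)
  qed
  have "norm (xi_int (of_real v)) \<le> (LBINT t:{1..}. norm (xi_kernel (of_real v) t))"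
    unfolding xi_int_def by (rule set_integral_norm_bound[OF set_integrable_xi_kernel])
  also have "\<dots> \<le> (LBINT t:{0<..}. 4 * exp (- 1) * exp (- t) :: real)"
    unfolding set_lebesgue_integral_def
  proof (rule integral_mono)
    show "integrable lborel (\<lambda>t. indicat_real {1..} t *\<^sub>R norm (xi_kernel (of_real v) t))"
      using set_integrable_norm[OF set_integrable_xi_kernel] by (simp add: set_integrable_def)
    have "set_integrable lborel {0<..} (\<lambda>t. 4 * exp (- 1) * exp (- t) :: real)"
      using integral_exp_Ioi(1)[of 1] by (intro set_integrable_mult_right) simp
    thus "integrable lborel (\<lambda>t. indicat_real {0<..} t *\<^sub>R (4 * exp (- 1) * exp (- t) :: real))" by (simp only: set_integrable_def)
    show "indicat_real {1..} t *\<^sub>R norm (xi_kernel (of_real v) t) \<le> indicat_real {0<..} t *\<^sub>R (4 * exp (- 1) * exp (- t))" for t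
      using kb[of t] by (auto simp: indicator_def)
  qed
  also have "\<dots> = 4 * exp (- 1)" using integral_exp_Ioi(2)[of 1] by simp
  also have "\<dots> < 4" by simp
  finally have n: "norm (xi_int (of_real v)) < 4" .
  have "v\<^sup>2 \<le> (1 / 2)\<^sup>2" using False v by (intro power_mono) auto
  hence v2: "\<bar>v\<^sup>2 - 1 / 4\<bar> \<le> 1 / 4" by (simp add: power2_eq_square abs_le_iff)
  have "of_real v ^ 2 - 1 / 4 = complex_of_real (v\<^sup>2 - 1 / 4)" by simp
  hence "norm ((of_real v ^ 2 - 1 / 4) * xi_int (of_real v)) = \<bar>v\<^sup>2 - 1 / 4\<bar> * norm (xi_int (of_real v))"
    by (simp only: norm_mult norm_of_real)
  also have "\<dots> \<le> 1 / 4 * norm (xi_int (of_real v))" using v2 by (intro mult_right_mono) auto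
  also have "\<dots> < 1" using n by simp
  finally have "norm ((of_real v ^ 2 - 1 / 4) * xi_int (of_real v)) < 1" .
  hence "(of_real v ^ 2 - 1 / 4) * xi_int (of_real v) \<noteq> -1" by (metis less_irrefl norm_minus_cancel norm_one)
  thus ?thesis unfolding xi_sq_square by (metis add_eq_0_iff)
qed

lemma xi_factor_nonzero:
  assumes "Im s > 0"
  shows "of_real pi powr (s / 2) * rGamma (s / 2) / (s * (s - 1)) \<noteq> (0::complex)"
proof -
  have "s / 2 \<notin> \<int>\<^sub>\<le>\<^sub>0" using assms by (auto elim!: nonpos_Ints_cases simp: complex_eq_iff)
  thus ?thesis using assms by (auto simp: rGamma_eq_zero_iff)
qed

lemma riemann_zeta_eq_0_iff_xi_sq:
  assumes "Im s > 0"
  shows "riemann_zeta s = 0 \<longleftrightarrow> xi_sq ((s - 1 / 2)\<^sup>2) = 0"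
proof -
  have "s \<noteq> 0" "s \<noteq> 1" using assms by auto
  from riemann_zeta_eq_xi_sq[OF this] show ?thesis using xi_factor_nonzero[OF assms] by simp
qed

text \<open>The root with \<open>Re u \<ge> 0\<close> has \<open>Re u \<le> 1 / 2\<close>, since
  zeta has no zero with real part above 1, and it is not real by \<open>xi_sq_real_nonzero\<close>;
  hence it or its negative lies in the upper half-plane.\<close>

lemma xi_sq_zero_imp:
  assumes z: "xi_sq z = 0"
  obtains v where "v\<^sup>2 = z" "Im v > 0" "\<bar>Re v\<bar> \<le> 1 / 2" "riemann_zeta (1 / 2 + v) = 0"
proof -
  define u where "u = csqrt z"
  have u: "u\<^sup>2 = z" "Re u \<ge> 0" using csqrt_principal[of z] unfolding u_def by auto
  have Reu: "Re u \<le> 1 / 2"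
  proof (rule ccontr)
    assume "\<not> Re u \<le> 1 / 2"
    hence s: "Re (1 / 2 + u) > 1" by simp
    hence "1 / 2 + u \<noteq> 0" "1 / 2 + u \<noteq> 1" by (auto simp: complex_eq_iff)
    from riemann_zeta_eq_xi_sq[OF this] have "riemann_zeta (1 / 2 + u) = 0" using u z by simp
    with riemann_zeta_nonzero[OF s] show False by simp
  qed
  have "Im u \<noteq> 0"
  proof
    assume "Im u = 0"
    hence "u = of_real (Re u)" by (simp add: complex_eq_iff)
    hence "xi_sq (of_real (Re u) ^ 2) = 0" using u z by simp
    with xi_sq_real_nonzero[OF u(2)] show False by simp
  qed
  define v where "v = (if Im u > 0 then u else - u)"
  have v: "v\<^sup>2 = z" "Im v > 0" "\<bar>Re v\<bar> \<le> 1 / 2" using u Reu \<open>Im u \<noteq> 0\<close> by (auto simp: v_def)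
  have "Im (1 / 2 + v) > 0" using v by simp
  from riemann_zeta_eq_0_iff_xi_sq[OF this] have "riemann_zeta (1 / 2 + v) = 0" using v z by simp
  with v show ?thesis by (intro that)
qed

text \<open>Squaring is locally invertible at \<open>v\<close>, which is nonzero:
  \<open>(s - 1 / 2)^2 - v^2\<close> is \<open>(s - 1 / 2 + v) * (s - (1 / 2 + v))\<close>, and the
  first factor has the value \<open>2 * v\<close> at the point. The factor relating zeta to
  \<open>xi_sq\<close> is zero-free in the upper half-plane.\<close>

lemma zorder_riemann_zeta:
  assumes v: "Im v > 0"
  shows "zorder riemann_zeta (1 / 2 + v) = zorder xi_sq (v\<^sup>2)"
proof -
  define w where "w = v\<^sup>2"
  define m where "m = nat (zorder xi_sq w)"
  define g where "g = zor_poly xi_sq w"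
  define c where "c = (\<lambda>s::complex. of_real pi powr (s / 2) * rGamma (s / 2) / (s * (s - 1)))"
  have "\<exists>w\<in>UNIV. xi_sq w \<noteq> 0" using xi_sq_real_nonzero[of 0] by blast
  from zorder_exist_zero[OF xi_sq_holomorphic open_UNIV connected_UNIV UNIV_I this, of w]
  obtain r where r: "zorder xi_sq w \<ge> 0" "r > 0" "g holomorphic_on cball w r"
    "\<And>u. u \<in> cball w r \<Longrightarrow> xi_sq u = g u * (u - w) ^ m" "\<And>u. u \<in> cball w r \<Longrightarrow> g u \<noteq> 0"
    unfolding m_def g_def by (metis order_less_imp_le order_refl)
  define S where "S = {s. Im s > 0} \<inter> (\<lambda>s. (s - 1 / 2)\<^sup>2) -` ball w r"
  have "zorder riemann_zeta (1 / 2 + v) = int m"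
  proof (rule zorder_eqI[where S = S and g = "\<lambda>s. c s * (g ((s - 1 / 2)\<^sup>2) * (s - 1 / 2 + v) ^ m)"])
    show "open S" unfolding S_def
      by (intro open_Int open_halfspace_Im_gt open_vimage) (auto intro!: continuous_intros)
    show "1 / 2 + v \<in> S" using v r by (auto simp: S_def w_def)
    have "(\<lambda>s. g ((s - 1 / 2)\<^sup>2)) holomorphic_on S"
      by (rule holomorphic_on_compose_gen[OF _ r(3), unfolded o_def]) (auto intro!: holomorphic_intros simp: S_def)
    moreover have "c holomorphic_on S" unfolding c_def by (intro holomorphic_intros) (auto simp: S_def)
    ultimately show "(\<lambda>s. c s * (g ((s - 1 / 2)\<^sup>2) * (s - 1 / 2 + v) ^ m)) holomorphic_on S"
      by (intro holomorphic_intros)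
    have "v \<noteq> 0" using v by auto
    thus "c (1 / 2 + v) * (g ((1 / 2 + v - 1 / 2)\<^sup>2) * (1 / 2 + v - 1 / 2 + v) ^ m) \<noteq> 0"
      using r xi_factor_nonzero[of "1 / 2 + v"] v by (auto simp: c_def w_def simp flip: mult_2)
    fix s assume s: "s \<in> S" "s \<noteq> 1 / 2 + v"
    hence s': "Im s > 0" "(s - 1 / 2)\<^sup>2 \<in> cball w r" by (auto simp: S_def)
    hence "s \<noteq> 0" "s \<noteq> 1" by auto
    hence "riemann_zeta s = c s * xi_sq ((s - 1 / 2)\<^sup>2)" unfolding c_def by (rule riemann_zeta_eq_xi_sq)
    also have "xi_sq ((s - 1 / 2)\<^sup>2) = g ((s - 1 / 2)\<^sup>2) * ((s - 1 / 2)\<^sup>2 - w) ^ m" by (rule r(4)[OF s'(2)])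
    also have "(s - 1 / 2)\<^sup>2 - w = (s - 1 / 2 + v) * (s - (1 / 2 + v))"
      by (simp add: w_def power2_eq_square algebra_simps)
    finally show "riemann_zeta s = c s * (g ((s - 1 / 2)\<^sup>2) * (s - 1 / 2 + v) ^ m) * (s - (1 / 2 + v)) powi int m"
      by (simp add: power_mult_distrib mult_ac)
  qed
  thus ?thesis using r(1) by (simp add: m_def w_def)
qed

context
  fixes \<rho> :: "nat \<Rightarrow> complex"
  assumes rho: "upper_zeta_zeros_seq \<rho>"
begin

lemma rho_zero: "n \<ge> 1 \<Longrightarrow> riemann_zeta (\<rho> n) = 0" and rho_Im: "n \<ge> 1 \<Longrightarrow> Im (\<rho> n) > 0"
  using rho by (auto simp: upper_zeta_zeros_seq_def)

lemma xi_sq_rho: "n \<ge> 1 \<Longrightarrow> xi_sq ((\<rho> n - 1 / 2)\<^sup>2) = 0"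
  using riemann_zeta_eq_0_iff_xi_sq rho_zero rho_Im by blast

text \<open>Of the two square roots of \<open>z\<close> only \<open>v\<close> has positive imaginary
  part, so the indices counted are those with \<open>\<rho> n = 1 / 2 + v\<close>, and their number
  is the order of that zero of zeta.\<close>

lemma card_rho:
  assumes z: "xi_sq z = 0"
  shows "int (card {n\<in>{1..}. (\<rho> n - 1 / 2)\<^sup>2 = z}) = zorder xi_sq z"
proof -
  obtain v where v: "v\<^sup>2 = z" "Im v > 0" "riemann_zeta (1 / 2 + v) = 0" using xi_sq_zero_imp[OF z] by metis
  have "\<rho> n = 1 / 2 + v" if n: "n \<ge> 1" "(\<rho> n - 1 / 2)\<^sup>2 = z" for n
  proof -
    have "(\<rho> n - 1 / 2)\<^sup>2 = v\<^sup>2" using n v(1) by simp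
    hence "\<rho> n - 1 / 2 = v \<or> \<rho> n - 1 / 2 = - v" by (simp only: power2_eq_iff)
    thus "\<rho> n = 1 / 2 + v"
    proof
      assume "\<rho> n - 1 / 2 = - v"
      hence "Im (\<rho> n - 1 / 2) = - Im v" by simp
      thus ?thesis using rho_Im[of n] n v by simp
    qed (simp add: algebra_simps)
  qed
  moreover have "(\<rho> n - 1 / 2)\<^sup>2 = z" if "\<rho> n = 1 / 2 + v" for n
    using v(1) unfolding that by simp
  ultimately have "{n\<in>{1..}. (\<rho> n - 1 / 2)\<^sup>2 = z} = {n. n \<ge> 1 \<and> \<rho> n = 1 / 2 + v}"
    unfolding atLeast_iff by blast
  moreover have "Im (1 / 2 + v) > 0" using v by simp
  ultimately have "int (card {n\<in>{1..}. (\<rho> n - 1 / 2)\<^sup>2 = z}) = zorder riemann_zeta (1 / 2 + v)"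
    using rho v(3) unfolding upper_zeta_zeros_seq_def by simp
  thus ?thesis using zorder_riemann_zeta[OF v(2)] v(1) by simp
qed

text \<open>Put \<open>D = w - Re z\<close> and \<open>z = v^2\<close>. Then
  \<open>(Re v)^2 \<le> 1 / 4\<close> gives both \<open>D \<ge> 1 + (Im v)^2\<close>, which explains
  \<open>5 / 4 = 1 + 1 / 4\<close>, and \<open>(Im z)^2 \<le> (Im v)^2 \<le> D \<le> D^2\<close>. So
  the real part \<open>D / (D^2 + (Im z)^2)\<close> is comparable to the modulus, wherever in the
  strip the zeros lie.\<close>

lemma rho_bounds:
  assumes n: "n \<ge> 1" and w: "w \<ge> 5 / 4"
  defines "z \<equiv> (\<rho> n - 1 / 2)\<^sup>2"
  shows "w - Re z \<ge> 1" "Re (1 / (of_real w - z)) \<ge> 1 / (2 * (w - Re z))"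
    "norm (1 / (of_real w - z)) \<le> 1 / (w - Re z)"
proof -
  have "xi_sq z = 0" unfolding z_def by (rule xi_sq_rho[OF n])
  then obtain v where v: "v\<^sup>2 = z" "\<bar>Re v\<bar> \<le> 1 / 2" by (rule xi_sq_zero_imp)
  define D where "D = w - Re z"
  have Rez: "Re z = (Re v)\<^sup>2 - (Im v)\<^sup>2" and Imz: "Im z = 2 * Re v * Im v"
    using v(1) by (auto simp: power2_eq_square)
  have re: "(Re v)\<^sup>2 \<le> 1 / 4" using power_mono[OF v(2), of 2] by (simp add: power2_eq_square)
  have D: "D \<ge> 1 + (Im v)\<^sup>2" using w re by (simp add: D_def Rez)
  hence D1: "D \<ge> 1" by (meson add_increasing2 order_trans zero_le_power2 le_add_same_cancel1)
  thus "w - Re z \<ge> 1" by (simp add: D_def)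
  have "(Im z)\<^sup>2 = 4 * (Re v)\<^sup>2 * (Im v)\<^sup>2" by (simp add: Imz power_mult_distrib)
  also have "\<dots> \<le> 4 * (1 / 4) * (Im v)\<^sup>2" using re by (intro mult_mono) auto
  also have "\<dots> \<le> D" using D by simp
  also have "D \<le> D\<^sup>2" using D1 by (simp add: power2_eq_square)
  finally have im: "(Im z)\<^sup>2 \<le> D\<^sup>2" .
  have "Re (1 / (of_real w - z)) = D / (D\<^sup>2 + (Im z)\<^sup>2)"
    by (simp add: Re_divide D_def power2_eq_square)
  also have "\<dots> \<ge> D / (2 * D\<^sup>2)" using im D1 by (intro divide_left_mono mult_pos_pos add_pos_nonneg) auto
  also have "D / (2 * D\<^sup>2) = 1 / (2 * D)" using D1 by (simp add: power2_eq_square)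
  finally show "Re (1 / (of_real w - z)) \<ge> 1 / (2 * (w - Re z))" by (simp add: D_def)
  have "D \<le> norm (of_real w - z)" using complex_Re_le_cmod[of "of_real w - z"] by (simp add: D_def)
  thus "norm (1 / (of_real w - z)) \<le> 1 / (w - Re z)"
    using D1 unfolding D_def by (simp add: norm_divide frac_le)
qed

text \<open>The disc sums converge to \<open>L\<close> and their terms have nonnegative real parts,
  so every finite sum of \<open>1 / (w - Re z)\<close> is at most \<open>2 * Re L\<close>. This
  gives absolute convergence, after which the sum in the given order equals the limit over
  discs.\<close>

lemma xi_sq_logderiv_sums:
  assumes w: "w \<ge> 5 / 4"
  shows "summable (\<lambda>n. 1 / (w - Re ((\<rho> (Suc n) - 1 / 2)\<^sup>2)))"
    "(\<lambda>n. 1 / (of_real w - (\<rho> (Suc n) - 1 / 2)\<^sup>2)) sums (deriv xi_sq (of_real w) / xi_sq (of_real w))"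
proof -
  define a where "a = (\<lambda>n. (\<rho> n - 1 / 2)\<^sup>2)"
  define L where "L = deriv xi_sq (of_real w) / xi_sq (of_real w)"
  have nz: "xi_sq (of_real w) \<noteq> 0"
    using xi_sq_real_nonzero[of "sqrt w"] w by (simp flip: of_real_power)
  \<comment> \<open>The listed zero at index 1 is set against the nonzero value at
    \<open>w\<close>.\<close>
  have nc: "\<not> xi_sq constant_on UNIV"
  proof
    assume "xi_sq constant_on UNIV"
    hence "xi_sq (of_real w) = xi_sq (a 1)" by (auto simp: constant_on_def)
    thus False using xi_sq_rho[of 1] nz by (simp add: a_def)
  qed
  have zero: "\<And>n. n \<in> {1..} \<Longrightarrow> xi_sq (a n) = 0"
    unfolding a_def using xi_sq_rho by simp
  have mult: "\<And>z. xi_sq z = 0 \<Longrightarrow> int (card {n\<in>{1..}. a n = z}) = zorder xi_sq z"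
    unfolding a_def by (rule card_rho)
  let ?F = "\<lambda>R. {n\<in>{1..}. a n \<in> cball (of_real w) R}"
  have fin: "finite (?F R)" for R
    by (rule logderiv_eq_sum_zeros(1)[OF xi_sq_holomorphic nz xi_sq_growth nc zero mult])
  have lim: "((\<lambda>R. \<Sum>n\<in>?F R. 1 / (of_real w - a n)) \<longlongrightarrow> L) at_top"
    unfolding L_def
    by (rule logderiv_eq_sum_zeros(2)[OF xi_sq_holomorphic nz xi_sq_growth nc zero mult])
  have D: "w - Re (a n) \<ge> 1" "Re (1 / (of_real w - a n)) \<ge> 1 / (2 * (w - Re (a n)))"
    "norm (1 / (of_real w - a n)) \<le> 1 / (w - Re (a n))" if "n \<ge> 1" for n
    using rho_bounds[OF that w] unfolding a_def by auto
  have nn: "Re (1 / (of_real w - a n)) \<ge> 0" if "n \<ge> 1" for n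
  proof -
    have "0 \<le> 1 / (2 * (w - Re (a n)))" using D(1)[OF that] by simp
    thus ?thesis using D(2)[OF that] by linarith
  qed
  have sub: "\<forall>\<^sub>F R in at_top. G \<subseteq> ?F R" if "finite G" "G \<subseteq> {1..}" for G
  proof -
    have "\<forall>\<^sub>F R in at_top. \<forall>n\<in>G. dist (of_real w) (a n) \<le> R"
      using that by (intro eventually_ball_finite ballI eventually_ge_at_top) auto
    thus ?thesis by eventually_elim (use that in auto)
  qed
  have bound: "(\<Sum>n\<in>G. 1 / (w - Re (a n))) \<le> 2 * Re L" if G: "finite G" "G \<subseteq> {1..}" for G
  proof -
    have "(\<Sum>n\<in>G. Re (1 / (of_real w - a n))) \<le> Re L"
    proof (rule tendsto_lowerbound)
      show "((\<lambda>R. Re (\<Sum>n\<in>?F R. 1 / (of_real w - a n))) \<longlongrightarrow> Re L) at_top" by (rule tendsto_Re[OF lim])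
      show "\<forall>\<^sub>F R in at_top. (\<Sum>n\<in>G. Re (1 / (of_real w - a n))) \<le> Re (\<Sum>n\<in>?F R. 1 / (of_real w - a n))"
        using sub[OF G]
      proof eventually_elim
        case (elim R)
        show ?case unfolding Re_sum by (rule sum_mono2[OF fin elim]) (use nn in auto)
      qed
    qed auto
    moreover have "(\<Sum>n\<in>G. 1 / (2 * (w - Re (a n)))) \<le> (\<Sum>n\<in>G. Re (1 / (of_real w - a n)))"
      using G D(2) by (intro sum_mono) auto
    moreover have "(\<Sum>n\<in>G. 1 / (2 * (w - Re (a n)))) = (\<Sum>n\<in>G. 1 / (w - Re (a n))) / 2"
      unfolding sum_divide_distrib by (intro sum.cong refl) (simp only: divide_divide_eq_left mult.commute[of 2])
    ultimately show ?thesis by linarith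
  qed
  show sm: "summable (\<lambda>n. 1 / (w - Re ((\<rho> (Suc n) - 1 / 2)\<^sup>2)))"
    unfolding a_def[symmetric]
  proof (rule bounded_imp_summable)
    show "1 / (w - Re ((\<rho> (Suc n) - 1 / 2)\<^sup>2)) \<ge> 0" for n using D(1)[of "Suc n"] unfolding a_def by simp
    fix n
    have "(\<Sum>k\<le>n. 1 / (w - Re (a (Suc k)))) = (\<Sum>k\<in>Suc ` {..n}. 1 / (w - Re (a k)))"
      by (subst sum.reindex) auto
    also have "\<dots> \<le> 2 * Re L" by (rule bound) auto
    finally show "(\<Sum>k\<le>n. 1 / (w - Re ((\<rho> (Suc k) - 1 / 2)\<^sup>2))) \<le> 2 * Re L" unfolding a_def .
  qed
  have ns: "summable (\<lambda>n. norm (1 / (of_real w - a (Suc n))))"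
    by (rule summable_comparison_test'[OF sm]) (use D(3) in \<open>auto simp: a_def\<close>)
  from summable_norm_cancel[OF ns] obtain S where S: "(\<lambda>n. 1 / (of_real w - a (Suc n))) sums S"
    unfolding summable_def by (elim exE)
  have "((\<lambda>n. 1 / (of_real w - a n)) has_sum S) {1..}"
    by (rule has_sum_from_1(1)[OF ns S])
  \<comment> \<open>The index sets of the discs are finite and eventually contain any given finite
    set, so the unconditional sum is also the limit over discs.\<close>
  moreover have "filterlim ?F (finite_subsets_at_top {1..}) at_top"
    unfolding filterlim_finite_subsets_at_top
  proof (intro allI impI)
    fix X :: "nat set" assume X: "finite X \<and> X \<subseteq> {1..}"
    have "\<forall>\<^sub>F R in at_top. X \<subseteq> ?F R" using X by (intro sub) auto
    thus "\<forall>\<^sub>F R in at_top. finite (?F R) \<and> X \<subseteq> ?F R \<and> ?F R \<subseteq> {1..}"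
      by eventually_elim (use fin in auto)
  qed
  ultimately have "((\<lambda>R. \<Sum>n\<in>?F R. 1 / (of_real w - a n)) \<longlongrightarrow> S) at_top"
    unfolding has_sum_def by (rule filterlim_compose)
  hence "S = L" by (rule tendsto_unique[OF trivial_limit_at_top_linorder _ lim])
  thus "(\<lambda>n. 1 / (of_real w - (\<rho> (Suc n) - 1 / 2)\<^sup>2)) sums (deriv xi_sq (of_real w) / xi_sq (of_real w))"
    using S by (simp add: a_def L_def)
qed

end

section \<open>The digamma function and \<open>Phi\<close>\<close>

lemma laplace_exp_complex:
  fixes z :: complex
  assumes z: "Re z > 0"
  shows "set_integrable lborel {0<..} (\<lambda>u. exp (- (z * of_real u)))"
    and "(LBINT u:{0<..}. exp (- (z * of_real u))) = 1 / z"
proof -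
  have z0: "z \<noteq> 0" using z by auto
  have e: "einterval 0 \<infinity> = {0<..}" by (auto simp: einterval_def zero_ereal_def)
  show i: "set_integrable lborel {0<..} (\<lambda>u. exp (- (z * of_real u)))"
  proof (rule set_integrable_bound[OF integral_exp_Ioi(1)[OF z]])
    have "(\<lambda>u::real. exp (- (z * of_real u))) \<in> borel_measurable borel"
      by (intro borel_measurable_continuous_onI continuous_intros)
    thus "set_borel_measurable lborel {0<..} (\<lambda>u. exp (- (z * of_real u)))"
      unfolding set_borel_measurable_def by measurable
  qed auto
  have der: "((\<lambda>u. - (exp (- (z * of_real u)) / z)) has_vector_derivative exp (- (z * of_real u))) (at u)" for u :: real
  proof -
    have "((\<lambda>w. - (exp (- (z * w)) / z)) has_field_derivative exp (- (z * of_real u))) (at (of_real u))"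
      using z0 by (auto intro!: derivative_eq_intros)
    thus ?thesis by (rule has_vector_derivative_real_field)
  qed
  have "(LBINT u=0..\<infinity>. exp (- (z * of_real u))) = 0 - (- (1 / z))"
  proof (rule interval_integral_FTC_integrable[where F = "\<lambda>u. - (exp (- (z * of_real u)) / z)"])
    show "set_integrable lborel (einterval 0 \<infinity>) (\<lambda>u. exp (- (z * of_real u)))" using i by (simp add: e)
    have "((\<lambda>u::real. - (exp (- (z * of_real u)) / z)) \<longlongrightarrow> - (exp (- (z * of_real 0)) / z)) (at_right 0)"
      using z0 by (intro tendsto_intros)
    thus "(((\<lambda>u. - (exp (- (z * of_real u)) / z)) \<circ> real_of_ereal) \<longlongrightarrow> - (1 / z)) (at_right 0)"
      by (simp add: zero_ereal_def ereal_tendsto_simps)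
    have "((\<lambda>u::real. norm (- (exp (- (z * of_real u)) / z))) \<longlongrightarrow> 0) at_top"
    proof -
      have "((\<lambda>u::real. exp (- (Re z * u)) / norm z) \<longlongrightarrow> 0) at_top" using z z0 by real_asymp
      thus ?thesis by (simp add: norm_divide)
    qed
    hence "((\<lambda>u::real. - (exp (- (z * of_real u)) / z)) \<longlongrightarrow> 0) at_top" by (rule tendsto_norm_zero_cancel)
    thus "(((\<lambda>u. - (exp (- (z * of_real u)) / z)) \<circ> real_of_ereal) \<longlongrightarrow> 0) (at_left \<infinity>)"
      by (simp add: ereal_tendsto_simps)
  qed (auto intro!: der continuous_intros)
  thus "(LBINT u:{0<..}. exp (- (z * of_real u))) = 1 / z"
    by (simp add: interval_lebesgue_integral_def e)
qed

lemma norm_exp_diff_le: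
  fixes a b :: complex
  assumes "Re a \<le> M" "Re b \<le> M"
  shows "norm (exp a - exp b) \<le> exp M * norm (a - b)"
proof (rule field_differentiable_bound[where S = "{z. Re z \<le> M}"])
  show "convex {z. Re z \<le> M}" by (rule convex_halfspace_Re_le)
  show "(exp has_field_derivative exp z) (at z within {z. Re z \<le> M})" for z :: complex
    by (rule has_field_derivative_at_within[OF DERIV_exp])
qed (use assms in auto)

lemma one_minus_exp_ge:
  fixes u :: real
  assumes "u > 0" shows "u / (1 - exp (- u)) \<le> 1 + u"
proof -
  have "exp (- u) \<le> 1 / (1 + u)"
    using exp_ge_add_one_self[of u] assms by (simp add: exp_minus field_simps)
  hence "u / (1 + u) \<le> 1 - exp (- u)" using assms by (simp add: field_simps)
  moreover have "1 - exp (- u) > 0" using assms by simp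
  ultimately show ?thesis using assms by (simp add: field_simps)
qed

lemma integral_id_exp:
  fixes c :: real
  assumes "c > 0"
  shows "set_integrable lborel {0<..} (\<lambda>u. u * exp (- (c * u)))" "(LBINT u:{0<..}. u * exp (- (c * u))) = 1 / c\<^sup>2"
proof -
  have eq: "u powr (2 - 1) * exp (- (c * u)) = u * exp (- (c * u))" if "u \<in> {0<..}" for u using that by simp
  note * = integral_Gamma_scaled[of 2 c]
  show "set_integrable lborel {0<..} (\<lambda>u. u * exp (- (c * u)))"
    using *(1) assms by (subst set_integrable_cong[OF refl refl eq[symmetric]]) auto
  have "(LBINT u:{0<..}. u * exp (- (c * u))) = (LBINT u:{0<..}. u powr (2 - 1) * exp (- (c * u)))"
    by (rule set_lebesgue_integral_cong) (auto simp: eq)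
  also have "\<dots> = 1 / c\<^sup>2"
    using *(2) assms by (simp add: Gamma_numeral powr_minus inverse_eq_divide)
  finally show "(LBINT u:{0<..}. u * exp (- (c * u))) = 1 / c\<^sup>2" .
qed

text \<open>Expand \<open>1 / (1 - exp (- u))\<close> into a geometric series: the
  \<open>n\<close>-th term integrates to \<open>1 / (a + n) - 1 / (b + n)\<close>, a term of the
  difference of the digamma series. The difference of exponentials vanishes at \<open>u = 0\<close>
  and is bounded by \<open>norm (a - b) * u * exp (- ((d + n) * u))\<close>, whose integral is of
  order \<open>1 / (d + n)^2\<close> and hence summable.\<close>

lemma Digamma_diff_integral:
  fixes a b :: complex
  assumes a: "Re a > 0" and b: "Re b > 0"
  shows "set_integrable lborel {0<..} (\<lambda>u. (exp (- (a * of_real u)) - exp (- (b * of_real u))) / of_real (1 - exp (- u)))"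
    and "(LBINT u:{0<..}. (exp (- (a * of_real u)) - exp (- (b * of_real u))) / of_real (1 - exp (- u))) = Digamma b - Digamma a"
proof -
  define d where "d = min (Re a) (Re b)"
  have d: "d > 0" using a b by (simp add: d_def)
  let ?g = "\<lambda>u::real. exp (- (a * of_real u)) - exp (- (b * of_real u))"
  let ?f = "\<lambda>n u. exp (- ((a + of_nat n) * of_real u)) - exp (- ((b + of_nat n) * of_real u))"
  have feq: "?f n u = ?g u * of_real (exp (- u)) ^ n" for n u
    by (simp add: exp_add[symmetric] exp_of_nat_mult[symmetric] exp_of_real[symmetric] algebra_simps)
  have int: "set_integrable lborel {0<..} (?f n)" "(LBINT u:{0<..}. ?f n u) = 1 / (a + of_nat n) - 1 / (b + of_nat n)" for n
    using laplace_exp_complex[of "a + of_nat n"] laplace_exp_complex[of "b + of_nat n"] a b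
    by (auto simp: set_integral_diff)
  have sm: "(\<lambda>n. ?f n u) sums (?g u / of_real (1 - exp (- u)))" if "u > 0" for u
  proof -
    have "(\<lambda>n. ?g u * of_real (exp (- u)) ^ n) sums (?g u * (1 / (1 - of_real (exp (- u)))))"
      using that by (intro sums_mult geometric_sums) simp
    thus ?thesis unfolding feq by simp
  qed
  have bd: "norm (?f n u) \<le> norm (a - b) * (u * exp (- ((d + real n) * u)))" if u: "u > 0" for n u
  proof -
    have le: "(d + real n) * u \<le> (x + real n) * u" if "d \<le> x" for x
      using that u by (intro mult_right_mono) auto
    have "norm (?f n u) \<le> exp (- ((d + real n) * u)) * norm (- ((a + of_nat n) * of_real u) - (- ((b + of_nat n) * of_real u)))"
      using le[of "Re a"] le[of "Re b"] by (intro norm_exp_diff_le) (auto simp: d_def)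
    also have "- ((a + of_nat n) * of_real u) - (- ((b + of_nat n) * of_real u)) = (b - a) * of_real u"
      by (simp add: algebra_simps)
    finally show ?thesis using u by (simp add: norm_mult norm_minus_commute mult_ac)
  qed
  have s2: "summable (\<lambda>n. LBINT u:{0<..}. norm (?f n u))"
  proof (rule summable_comparison_test')
    have "summable (\<lambda>n. 1 / (d + real n)\<^sup>2)"
    proof (rule summable_comparison_test_ev)
      show "summable (\<lambda>n. 1 / (real n)\<^sup>2)" using inverse_power_summable[of 2] by (simp add: inverse_eq_divide)
      show "\<forall>\<^sub>F n in sequentially. norm (1 / (d + real n)\<^sup>2) \<le> 1 / (real n)\<^sup>2"
        using eventually_gt_at_top[of 0] by eventually_elim (use d in \<open>auto intro!: divide_left_mono power_mono mult_pos_pos add_pos_pos\<close>)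
    qed
    thus "summable (\<lambda>n. norm (a - b) * (1 / (d + real n)\<^sup>2))" by (rule summable_mult)
    fix n
    have dn: "d + real n > 0" using d by simp
    have "(LBINT u:{0<..}. norm (?f n u)) \<le> (LBINT u:{0<..}. norm (a - b) * (u * exp (- ((d + real n) * u))))"
    proof (rule set_integral_mono)
      show "set_integrable lborel {0<..} (\<lambda>u. norm (?f n u))" by (rule set_integrable_norm[OF int(1)])
      show "set_integrable lborel {0<..} (\<lambda>u. norm (a - b) * (u * exp (- ((d + real n) * u))))"
        by (intro set_integrable_mult_right integral_id_exp(1)[OF dn])
    qed (use bd in auto)
    also have "\<dots> = norm (a - b) * (1 / (d + real n)\<^sup>2)"
      unfolding set_integral_mult_right integral_id_exp(2)[OF dn] ..
    finally have le: "(LBINT u:{0<..}. norm (?f n u)) \<le> norm (a - b) * (1 / (d + real n)\<^sup>2)" .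
    have "(LBINT u:{0<..}. norm (?f n u)) \<ge> 0"
      unfolding set_lebesgue_integral_def by (intro integral_nonneg_AE AE_I2) auto
    with le show "norm (LBINT u:{0<..}. norm (?f n u)) \<le> norm (a - b) * (1 / (d + real n)\<^sup>2)" by simp
  qed
  have s1: "summable (\<lambda>n. norm (?f n u))" if "u \<in> {0<..}" for u
  proof -
    have "summable (\<lambda>n. norm (?g u) * exp (- u) ^ n)" using that by (intro summable_mult summable_geometric) auto
    thus ?thesis unfolding feq norm_mult norm_power by simp
  qed
  note S = set_integral_suminf[OF int(1) s1 s2]
  show "set_integrable lborel {0<..} (\<lambda>u. ?g u / of_real (1 - exp (- u)))"
    using S(1) by (rule set_integrable_cong[THEN iffD1, rotated -1]) (use sm in \<open>auto simp: sums_iff\<close>)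
  have "(LBINT u:{0<..}. ?g u / of_real (1 - exp (- u))) = (LBINT u:{0<..}. \<Sum>n. ?f n u)"
    by (rule set_lebesgue_integral_cong) (use sm in \<open>auto simp: sums_iff\<close>)
  also have "\<dots> = Digamma b - Digamma a"
  proof (rule sums_unique2)
    show "(\<lambda>n. 1 / (a + of_nat n) - 1 / (b + of_nat n)) sums (LBINT u:{0<..}. \<Sum>n. ?f n u)"
      using S(2) unfolding int(2) .
    have "a \<noteq> 0" "b \<noteq> 0" using a b by auto
    from sums_diff[OF Digamma_sums[OF this(2)] Digamma_sums[OF this(1)]]
    show "(\<lambda>n. 1 / (a + of_nat n) - 1 / (b + of_nat n)) sums (Digamma b - Digamma a)"
      by (simp add: inverse_eq_divide)
  qed
  finally show "(LBINT u:{0<..}. ?g u / of_real (1 - exp (- u))) = Digamma b - Digamma a" .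
qed

text \<open>Logarithmic derivative of Legendre's duplication formula; the \<open>ln 2\<close> comes
  from its exponential factor.\<close>

lemma Digamma_duplication:
  fixes z :: complex
  assumes z: "Re z > 0"
  shows "Digamma z + Digamma (z + 1 / 2) = 2 * Digamma (2 * z) - 2 * of_real (ln 2)"
proof -
  have nI: "w \<notin> \<int>\<^sub>\<le>\<^sub>0" if "Re w > 0" for w :: complex using that by (auto elim!: nonpos_Ints_cases)
  let ?G = "\<lambda>z::complex. exp ((1 - 2 * z) * of_real (ln 2)) * of_real (sqrt pi) * Gamma (2 * z)"
  have G: "Gamma (2 * z) \<noteq> 0" using nI[of "2 * z"] z by (simp add: Gamma_eq_zero_iff)
  have L: "((\<lambda>z. Gamma z * Gamma (z + 1 / 2)) has_field_derivative
     Gamma z * Gamma (z + 1 / 2) * (Digamma z + Digamma (z + 1 / 2))) (at z)"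
    using nI[of z] nI[of "z + 1 / 2"] z by (auto intro!: derivative_eq_intros simp: algebra_simps)
  have R: "(?G has_field_derivative ?G z * (2 * Digamma (2 * z) - 2 * of_real (ln 2))) (at z)"
    using nI[of "2 * z"] z by (auto intro!: derivative_eq_intros simp: algebra_simps)
  have ev: "\<forall>\<^sub>F u in nhds z. Gamma u * Gamma (u + 1 / 2) = ?G u"
  proof -
    have "\<forall>\<^sub>F u in nhds z. u \<in> {u. Re u > 0}" using z by (intro eventually_nhds_in_open open_halfspace_Re_gt) auto
    thus ?thesis by eventually_elim (rule Gamma_legendre_duplication; auto intro!: nI)
  qed
  have "Gamma z * Gamma (z + 1 / 2) * (Digamma z + Digamma (z + 1 / 2)) = ?G z * (2 * Digamma (2 * z) - 2 * of_real (ln 2))"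
    by (rule DERIV_unique[OF L[unfolded DERIV_cong_ev[OF refl ev refl]] R])
  moreover have "Gamma z * Gamma (z + 1 / 2) = ?G z"
    using z by (intro Gamma_legendre_duplication nI) auto
  moreover have "?G z \<noteq> 0" using G by simp
  ultimately show ?thesis by (metis mult_left_cancel)
qed

lemma Re_Digamma_cnj:
  assumes "Re z > 0"
  shows "Re (Digamma (cnj z)) = Re (Digamma z)"
proof -
  have "z \<noteq> 0" "cnj z \<noteq> 0" using assms by auto
  note s = sums_Re[OF Digamma_sums[OF this(1)]] sums_Re[OF Digamma_sums[OF this(2)]]
  have eq: "Re (inverse (of_nat (Suc k)) - inverse (cnj z + of_nat k)) = Re (inverse (of_nat (Suc k)) - inverse (z + of_nat k))" for k
  proof -
    have "inverse (cnj z + of_nat k) = cnj (inverse (z + of_nat k))" by simp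
    thus ?thesis by (simp only: minus_complex.sel cnj.sel)
  qed
  have "Re (Digamma z + euler_mascheroni) = Re (Digamma (cnj z) + euler_mascheroni)"
    by (rule sums_unique2[OF s(1) s(2)[unfolded eq]])
  thus ?thesis by simp
qed

text \<open>Duplication at \<open>z = 1 / 4 + \<i> * t / 2\<close> expresses the digamma value in
  \<open>Psi\<close> by those at \<open>z\<close> and \<open>z + 1 / 2\<close>. The latter point is
  conjugate to \<open>1 - z\<close>, and reflection leads back to the value at \<open>z\<close> plus
  a multiple of \<open>1 / cosh (pi * t)\<close> that cancels the one in \<open>Psi\<close>. What
  remains belongs to the factor \<open>pi powr (- s / 2) * Gamma (s / 2)\<close> at
  \<open>s = 1 / 2 + \<i> * t\<close>.\<close>

lemma Psi_eq: "Psi t = ln pi - Re (Digamma (1 / 4 + \<i> * of_real (t / 2)))"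
proof -
  define z where "z = 1 / 4 + \<i> * complex_of_real (t / 2)"
  have Rez: "Re z = 1 / 4" "Im z = t / 2" by (auto simp: z_def)
  have z2: "2 * z = 1 / 2 + \<i> * of_real t" by (simp add: z_def)
  have nI: "2 * z \<notin> \<int>\<^sub>\<le>\<^sub>0" by (auto elim!: nonpos_Ints_cases simp: complex_eq_iff Rez)
  have zI: "z \<notin> \<int>"
  proof
    assume "z \<in> \<int>"
    then obtain n where "z = of_int n" by (auto elim: Ints_cases)
    hence "real_of_int (4 * n) = real_of_int 1" using Rez by (simp add: complex_eq_iff)
    hence "4 * n = 1" by (simp only: of_int_eq_iff)
    thus False by presburger
  qed
  have "deriv Gamma (2 * z) = Gamma (2 * z) * Digamma (2 * z)"
    using nI by (intro DERIV_imp_deriv) (auto intro!: derivative_eq_intros)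
  moreover have "Gamma (2 * z) \<noteq> 0" using nI by (simp add: Gamma_eq_zero_iff)
  ultimately have "deriv Gamma (2 * z) / Gamma (2 * z) = Digamma (2 * z)" by simp
  hence Psi: "Psi t = ln (2 * pi) + pi / (2 * cosh (pi * t)) - Re (Digamma (2 * z))"
    unfolding Psi_def z2 by simp
  have "cnj (1 - z) = z + 1 / 2" by (simp add: complex_eq_iff Rez)
  hence "Re (Digamma (z + 1 / 2)) = Re (Digamma (1 - z))"
    using Re_Digamma_cnj[of "1 - z"] Rez by simp
  hence "2 * Re (Digamma (2 * z)) = 2 * ln 2 + Re (Digamma z) + Re (Digamma (1 - z))"
    using arg_cong[OF Digamma_duplication[of z], of Re] Rez by simp
  moreover have "Re (Digamma (1 - z)) = Re (Digamma z) + pi / cosh (pi * t)"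
  proof -
    have "Re (cot (of_real pi * z)) = 1 / cosh (pi * t)"
    proof -
      \<comment> \<open>At real part \<open>pi / 4\<close> cosine and sine agree, so the common
        factor \<open>sqrt 2 / 2\<close> cancels and the cotangent is rational in \<open>r\<close>;
        its real part is \<open>2 / (r^2 + 1 / r^2)\<close>.\<close>
      define q where "q = of_real pi * z"
      have q: "Re q = pi / 4" "Im q = pi * t / 2" by (simp_all add: q_def Rez)
      define r where "r = exp (pi * t / 2)"
      have r: "r > 0" by (simp add: r_def)
      have c: "cos (complex_of_real (pi / 4)) = of_real (sqrt 2 / 2)" "sin (complex_of_real (pi / 4)) = of_real (sqrt 2 / 2)"
        by (simp_all only: cos_of_real sin_of_real cos_45 sin_45)
      have "exp (\<i> * q) = exp (- of_real (pi * t / 2)) * exp (\<i> * of_real (pi / 4))"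
        unfolding exp_add[symmetric] by (rule arg_cong[of _ _ exp]) (simp add: complex_eq_iff q)
      hence e1: "exp (\<i> * q) = of_real (1 / r * (sqrt 2 / 2)) * (1 + \<i>)"
        unfolding exp_Euler c by (simp add: r_def exp_of_real[symmetric] exp_minus field_simps)
      have "exp (- (\<i> * q)) = exp (of_real (pi * t / 2)) * exp (- (\<i> * of_real (pi / 4)))"
        unfolding exp_add[symmetric] by (rule arg_cong[of _ _ exp]) (simp add: complex_eq_iff q)
      also have "exp (- (\<i> * complex_of_real (pi / 4))) = exp (\<i> * (- of_real (pi / 4)))"
        by (simp only: mult_minus_right)
      also have "\<dots> = of_real (sqrt 2 / 2) * (1 - \<i>)"
        unfolding exp_Euler cos_minus sin_minus c by (simp add: algebra_simps)
      also have "exp (complex_of_real (pi * t / 2)) = of_real r" by (simp only: r_def exp_of_real)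
      finally have e2: "exp (- (\<i> * q)) = of_real (r * (sqrt 2 / 2)) * (1 - \<i>)" by simp
      have "cot q = \<i> * (exp (\<i> * q) + exp (- (\<i> * q))) / (exp (\<i> * q) - exp (- (\<i> * q)))"
      proof -
        have gen: "(A / 2) / (B / (2 * \<i>)) = \<i> * A / B" for A B :: complex
          by (cases "B = 0") (simp_all add: field_simps)
        have "sin q = (exp (\<i> * q) - exp (- (\<i> * q))) / (2 * \<i>)" "cos q = (exp (\<i> * q) + exp (- (\<i> * q))) / 2"
          by (simp_all add: sin_exp_eq cos_exp_eq)
        thus ?thesis unfolding cot_def by (simp only: gen)
      qed
      also have "\<dots> = \<i> * ((1 / r + r) + (1 / r - r) * \<i>) / ((1 / r - r) + (1 / r + r) * \<i>)"
      proof -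
        have "exp (\<i> * q) + exp (- (\<i> * q)) = of_real (sqrt 2 / 2) * ((1 / r + r) + (1 / r - r) * \<i>)"
          "exp (\<i> * q) - exp (- (\<i> * q)) = of_real (sqrt 2 / 2) * ((1 / r - r) + (1 / r + r) * \<i>)"
          unfolding e1 e2 by (simp_all add: complex_eq_iff algebra_simps Re_divide Im_divide add_divide_distrib)
        moreover have "\<i> * (c * A) / (c * B) = \<i> * A / B" if "c \<noteq> 0" for c A B :: complex using that by simp
        moreover have "complex_of_real (sqrt 2 / 2) \<noteq> 0" by simp
        ultimately show ?thesis by (simp only: not_False_eq_True)
      qed
      finally have "Re (cot q) = Re ((Complex (r - 1 / r) (1 / r + r)) / (Complex (1 / r - r) (1 / r + r)))"
        by (simp add: complex_eq_iff Complex_eq algebra_simps)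
      also have "\<dots> = ((1 / r + r)\<^sup>2 - (r - 1 / r)\<^sup>2) / ((r - 1 / r)\<^sup>2 + (1 / r + r)\<^sup>2)"
        by (simp add: Re_divide power2_eq_square algebra_simps)
      also have "\<dots> = 2 / (r\<^sup>2 + 1 / r\<^sup>2)"
      proof -
        have "(1 / r + r)\<^sup>2 - (r - 1 / r)\<^sup>2 = 4" "(r - 1 / r)\<^sup>2 + (1 / r + r)\<^sup>2 = 2 * (r\<^sup>2 + 1 / r\<^sup>2)"
          using r by (simp_all add: power2_eq_square field_simps)
        moreover have "4 / (2 * y) = 2 / y" for y :: real by simp
        ultimately show ?thesis by (simp only:)
      qed
      also have "r\<^sup>2 + 1 / r\<^sup>2 = 2 * cosh (pi * t)"
      proof -
        have "r\<^sup>2 = exp (pi * t)" unfolding r_def exp_double[symmetric] by simp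
        thus ?thesis by (simp add: cosh_def exp_minus inverse_eq_divide)
      qed
      finally show ?thesis unfolding q_def by simp
    qed
    thus ?thesis using arg_cong[OF Digamma_reflection[OF zI], of Re] by simp
  qed
  moreover have "ln (2 * pi) = ln 2 + ln pi" by (simp add: ln_mult)
  moreover have "pi / (2 * cosh (pi * t)) = (pi / cosh (pi * t)) / 2" by simp
  ultimately show ?thesis unfolding Psi z_def[symmetric] by linarith
qed

section \<open>Gaussian averages of \<open>Psi\<close> and the Laplace transform of
  \<open>Phi\<close>\<close>

lemma gaussian_cos_integral:
  fixes x b :: real
  assumes x: "x > 0"
  shows "set_integrable lborel {0<..} (\<lambda>t. exp (- x * t\<^sup>2) * cos (b * t))"
    and "(LBINT t:{0<..}. exp (- x * t\<^sup>2) * cos (b * t)) = sqrt (pi / x) / 2 * exp (- (b\<^sup>2 / (4 * x)))"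
proof -
  \<comment> \<open>With \<open>y = c * t\<close> the weight \<open>exp (- y^2 / 2)\<close> becomes
    \<open>exp (- x * t^2)\<close>, so the integral is the real part of the characteristic function
    of the standard normal distribution, rescaled and halved by evenness.\<close>
  define c where "c = sqrt (2 * x)"
  have c: "c > 0" "c\<^sup>2 = 2 * x" using x by (auto simp: c_def)
  define s where "s = b / c"
  let ?f = "\<lambda>y. std_normal_density y * cos (s * y)"
  have i1: "integrable lborel ?f"
  proof (rule Bochner_Integration.integrable_bound[OF integrable_normal_density[of 1 0]])
    show "?f \<in> borel_measurable lborel" by measurable
    show "AE y in lborel. norm (?f y) \<le> norm (std_normal_density y)"
      by (intro AE_I2) (auto simp: abs_mult intro!: mult_left_le)
  qed auto
  have "Re (char std_normal_distribution s) = exp (- s\<^sup>2 / 2)"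
    unfolding char_std_normal_distribution by simp
  moreover have "char std_normal_distribution s = (LINT y|lborel. std_normal_density y *\<^sub>R iexp (s * y))"
    unfolding char_def by (subst integral_density) (auto simp: normal_density_nonneg)
  moreover have "integrable lborel (\<lambda>y. std_normal_density y *\<^sub>R iexp (s * y))"
    by (rule Bochner_Integration.integrable_bound[OF integrable_normal_density[of 1 0]]) (auto intro!: borel_measurable_scaleR borel_measurable_continuous_onI continuous_intros simp: normal_density_nonneg)
  ultimately have I: "(LINT y|lborel. ?f y) = exp (- s\<^sup>2 / 2)"
    by (simp add: integral_Re[symmetric] Re_exp)
  have eq: "?f (0 + c * t) = 1 / sqrt (2 * pi) * (exp (- x * t\<^sup>2) * cos (b * t))" for t
    using c by (simp add: std_normal_density_def power_mult_distrib s_def)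
  let ?g = "\<lambda>t. exp (- x * t\<^sup>2) * cos (b * t)"
  have "integrable lborel (\<lambda>t. ?f (0 + c * t))" using i1 c by (intro lborel_integrable_real_affine) auto
  hence "integrable lborel (\<lambda>t. sqrt (2 * pi) * ?f (0 + c * t))" by (rule integrable_mult_right)
  hence g: "integrable lborel ?g" unfolding eq by simp
  have "exp (- s\<^sup>2 / 2) = \<bar>c\<bar> *\<^sub>R (LINT t|lborel. ?f (0 + c * t))"
    using c I lborel_integral_real_affine[of c ?f 0] by simp
  hence "exp (- s\<^sup>2 / 2) = c / sqrt (2 * pi) * (LINT t|lborel. ?g t)" unfolding eq using c by simp
  hence tot: "(LINT t|lborel. ?g t) = sqrt (2 * pi) / c * exp (- s\<^sup>2 / 2)" using c by (simp add: field_simps)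
  also have "sqrt (2 * pi) / c = sqrt (pi / x)" by (simp add: c_def real_sqrt_divide[symmetric])
  also have "- s\<^sup>2 / 2 = - (b\<^sup>2 / (4 * x))" using c by (simp add: s_def power_divide)
  finally have tot: "(LINT t|lborel. ?g t) = sqrt (pi / x) * exp (- (b\<^sup>2 / (4 * x)))" .
  show si: "set_integrable lborel {0<..} ?g"
    unfolding set_integrable_def by (rule integrable_mult_indicator[OF _ g]) auto
  have AE0: "AE t in lborel. indicator {0<..} t *\<^sub>R ?g t = indicator {0..} t *\<^sub>R ?g t"
    using AE_lborel_singleton[of "0::real"] by eventually_elim (auto simp: indicator_def)
  have "has_bochner_integral lborel (\<lambda>t. indicator {0<..} t *\<^sub>R ?g t) (LBINT t:{0<..}. ?g t)"
    using si by (simp add: set_lebesgue_integral_def set_integrable_def has_bochner_integral_iff)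
  hence "has_bochner_integral lborel (\<lambda>t. indicator {0..} t *\<^sub>R ?g t) (LBINT t:{0<..}. ?g t)"
    by (subst (asm) has_bochner_integral_cong_AE[OF _ _ AE0]) auto
  hence "has_bochner_integral lborel ?g (2 *\<^sub>R (LBINT t:{0<..}. ?g t))"
    by (rule has_bochner_integral_even_function) simp
  thus "(LBINT t:{0<..}. ?g t) = sqrt (pi / x) / 2 * exp (- (b\<^sup>2 / (4 * x)))"
    using tot by (simp add: has_bochner_integral_iff)
qed

text \<open>For a nonnegative integrand the inner integral \<open>h\<close> decides integrability on
  the product, so evaluating one order of integration is enough to justify the exchange.\<close>

lemma set_integral_Tonelli_Ioi:
  fixes f :: "real \<Rightarrow> real \<Rightarrow> real"
  assumes meas: "(\<lambda>(u, t). f u t) \<in> borel_measurable (borel \<Otimes>\<^sub>M borel)"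
    and nonneg: "\<And>u t. u > 0 \<Longrightarrow> t > 0 \<Longrightarrow> f u t \<ge> 0"
    and int: "\<And>u. u > 0 \<Longrightarrow> set_integrable lborel {0<..} (f u)"
    and val: "\<And>u. u > 0 \<Longrightarrow> (LBINT t:{0<..}. f u t) = h u"
    and int_h: "set_integrable lborel {0<..} h"
  shows "set_integrable lborel {0<..} (\<lambda>t. LBINT u:{0<..}. f u t)"
    and "(LBINT t:{0<..}. LBINT u:{0<..}. f u t) = (LBINT u:{0<..}. h u)"
proof -
  define F where "F = (\<lambda>u t. indicator {0<..} u * (indicator {0<..} t * f u t))"
  have meas': "case_prod F \<in> borel_measurable (lborel \<Otimes>\<^sub>M lborel)"
  proof -
    have [measurable]: "(\<lambda>p. f (fst p) (snd p)) \<in> borel_measurable (borel \<Otimes>\<^sub>M borel)"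
      using meas by (simp add: case_prod_unfold)
    have "(\<lambda>p. indicator {0<..} (fst p) * (indicator {0<..} (snd p) * f (fst p) (snd p))) \<in> borel_measurable (borel \<Otimes>\<^sub>M borel)"
      by measurable
    moreover have "sets (lborel \<Otimes>\<^sub>M lborel :: (real \<times> real) measure) = sets (borel \<Otimes>\<^sub>M borel)"
      by (intro sets_pair_measure_cong) auto
    ultimately show ?thesis unfolding F_def case_prod_unfold by (simp cong: measurable_cong_sets)
  qed
  have inner: "(LINT t|lborel. F u t) = indicator {0<..} u * h u" for u
    unfolding F_def using val[of u] by (auto simp: indicator_def set_lebesgue_integral_def)
  have "integrable (lborel \<Otimes>\<^sub>M lborel) (case_prod F)"
  proof (rule lborel_pair.Fubini_integrable[OF meas'])
    have "(LINT t|lborel. norm (case_prod F (u, t))) = indicator {0<..} u * h u" for u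
    proof -
      have "(LINT t|lborel. norm (case_prod F (u, t))) = (LINT t|lborel. F u t)"
        by (intro Bochner_Integration.integral_cong) (auto simp: F_def indicator_def nonneg)
      thus ?thesis by (simp add: inner)
    qed
    thus "integrable lborel (\<lambda>u. LINT t|lborel. norm (case_prod F (u, t)))"
      using int_h by (simp add: set_integrable_def)
    show "AE u in lborel. integrable lborel (\<lambda>t. case_prod F (u, t))"
      using int by (intro AE_I2) (auto simp: F_def set_integrable_def indicator_def)
  qed
  note F = this
  have outer: "(LINT u|lborel. F u t) = indicator {0<..} t *\<^sub>R (LBINT u:{0<..}. f u t)" for t
    unfolding F_def by (auto simp: indicator_def set_lebesgue_integral_def)
  show "set_integrable lborel {0<..} (\<lambda>t. LBINT u:{0<..}. f u t)"
    using lborel_pair.integrable_snd[OF F] unfolding set_integrable_def outer .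
  have "(LBINT t:{0<..}. LBINT u:{0<..}. f u t) = (LINT t|lborel. LINT u|lborel. F u t)"
    unfolding outer set_lebesgue_integral_def[of _ "{0<..}" "\<lambda>t. LBINT u:{0<..}. f u t"] ..
  also have "\<dots> = (LINT u|lborel. LINT t|lborel. F u t)" by (rule lborel_pair.Fubini_integral[OF F])
  also have "\<dots> = (LBINT u:{0<..}. h u)" unfolding inner by (simp add: set_lebesgue_integral_def)
  finally show "(LBINT t:{0<..}. LBINT u:{0<..}. f u t) = (LBINT u:{0<..}. h u)" .
qed

lemma LBINT_Ioi_cong:
  fixes f g :: "real \<Rightarrow> 'a :: {banach, second_countable_topology}"
  assumes "\<And>x. x \<in> {0<..} \<Longrightarrow> f x = g x"
  shows "(LBINT x:{0<..}. f x) = (LBINT x:{0<..}. g x)"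
  by (rule set_lebesgue_integral_cong) (use assms in auto)

text \<open>The weight in Gauss's integral for the digamma function at \<open>1 / 4\<close>. It
  behaves like \<open>1 / u\<close> at 0, so it is integrated only against a factor vanishing there
  or after its singularity has been subtracted.\<close>

definition digamma_kernel :: "real \<Rightarrow> real" where
  "digamma_kernel u = exp (- (u / 4)) / (1 - exp (- u))"

lemma digamma_kernel_measurable [measurable]: "digamma_kernel \<in> borel_measurable borel"
  unfolding digamma_kernel_def by measurable

lemma digamma_kernel_pos: "u > 0 \<Longrightarrow> digamma_kernel u > 0"
  by (simp add: digamma_kernel_def)

lemma digamma_kernel_le:
  assumes u: "u > 0"
  shows "digamma_kernel u * u \<le> 16 * exp (- (u / 8))" "digamma_kernel u * u\<^sup>2 \<le> 256 * exp (- (u / 8))"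
proof -
  \<comment> \<open>The crude constant 16 buys the slow exponential \<open>exp (u / 16)\<close>:
    each use lowers the decay rate by \<open>1 / 16\<close>, from \<open>1 / 4\<close> to
    \<open>3 / 16\<close> and then to \<open>1 / 8\<close>.\<close>
  have e: "1 + u \<le> 16 * exp (u / 16)" using exp_ge_add_one_self[of "u / 16"] u by linarith
  have "digamma_kernel u * u = exp (- (u / 4)) * (u / (1 - exp (- u)))" by (simp add: digamma_kernel_def)
  also have "\<dots> \<le> exp (- (u / 4)) * (16 * exp (u / 16))"
    using one_minus_exp_ge[OF u] e by (intro mult_left_mono) auto
  also have "\<dots> = 16 * exp (- (3 * u / 16))" by (simp flip: exp_add)
  finally have 1: "digamma_kernel u * u \<le> 16 * exp (- (3 * u / 16))" .
  also have "\<dots> \<le> 16 * exp (- (u / 8))" using u by simp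
  finally show "digamma_kernel u * u \<le> 16 * exp (- (u / 8))" .
  have "digamma_kernel u * u\<^sup>2 = (digamma_kernel u * u) * u" by (simp add: power2_eq_square)
  also have "\<dots> \<le> (16 * exp (- (3 * u / 16))) * (16 * exp (u / 16))"
    by (rule mult_mono[OF 1]) (use e u in auto)
  also have "\<dots> = 256 * exp (- (u / 8))" by (simp flip: exp_add)
  finally show "digamma_kernel u * u\<^sup>2 \<le> 256 * exp (- (u / 8))" .
qed

lemma Digamma_quarter_diff:
  fixes v :: complex
  assumes v: "Re v \<ge> 0"
  shows "set_integrable lborel {0<..} (\<lambda>u. of_real (digamma_kernel u) * (1 - exp (- (v * of_real u))))"
    and "(LBINT u:{0<..}. of_real (digamma_kernel u) * (1 - exp (- (v * of_real u)))) = Digamma (1 / 4 + v) - Digamma (1 / 4)"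
proof -
  have "exp (- ((1 / 4 + v) * of_real u)) = of_real (exp (- (u / 4))) * exp (- (v * of_real u))" for u
    by (simp add: exp_of_real[symmetric] distrib_right exp_add[symmetric])
  moreover have "exp (- (1 / 4 * of_real u)) = complex_of_real (exp (- (u / 4)))" for u
    by (simp add: exp_of_real[symmetric])
  ultimately have eq: "(\<lambda>u. of_real (digamma_kernel u) * (1 - exp (- (v * of_real u)))) =
    (\<lambda>u. (exp (- (1 / 4 * of_real u)) - exp (- ((1 / 4 + v) * of_real u))) / of_real (1 - exp (- u)))"
    unfolding digamma_kernel_def by (simp add: fun_eq_iff algebra_simps diff_divide_distrib)
  show "set_integrable lborel {0<..} (\<lambda>u. of_real (digamma_kernel u) * (1 - exp (- (v * of_real u))))"
    unfolding eq using v by (intro Digamma_diff_integral(1)) auto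
  show "(LBINT u:{0<..}. of_real (digamma_kernel u) * (1 - exp (- (v * of_real u)))) = Digamma (1 / 4 + v) - Digamma (1 / 4)"
    unfolding eq using v by (intro Digamma_diff_integral(2)) auto
qed

lemma Digamma_quarter_diff_cos:
  "set_integrable lborel {0<..} (\<lambda>u. digamma_kernel u * (1 - cos (u / 2 * t)))"
  "(LBINT u:{0<..}. digamma_kernel u * (1 - cos (u / 2 * t))) = Re (Digamma (1 / 4 + \<i> * of_real (t / 2))) - Re (Digamma (1 / 4 :: complex))"
proof -
  let ?v = "\<i> * complex_of_real (t / 2)"
  have v: "Re ?v \<ge> 0" by simp
  have r: "Re (indicator {0<..} u *\<^sub>R (of_real (digamma_kernel u) * (1 - exp (- (?v * of_real u))))) =
       indicator {0<..} u *\<^sub>R (digamma_kernel u * (1 - cos (u / 2 * t)))" for u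
    by (simp add: Re_exp mult_ac)
  note * = Digamma_quarter_diff[OF v, unfolded set_integrable_def set_lebesgue_integral_def]
  show "set_integrable lborel {0<..} (\<lambda>u. digamma_kernel u * (1 - cos (u / 2 * t)))"
    using integrable_Re[OF *(1)] unfolding r set_integrable_def .
  show "(LBINT u:{0<..}. digamma_kernel u * (1 - cos (u / 2 * t))) = Re (Digamma (1 / 4 + ?v)) - Re (Digamma (1 / 4 :: complex))"
    using integral_Re[OF *(1)] unfolding *(2) r set_lebesgue_integral_def by simp
qed

lemma Digamma_quarter_diff_exp:
  fixes s :: real
  assumes s: "s \<ge> 0"
  shows "set_integrable lborel {0<..} (\<lambda>u. digamma_kernel u * (1 - exp (- (s * (u / 2)))))"
    "(LBINT u:{0<..}. digamma_kernel u * (1 - exp (- (s * (u / 2))))) = Re (Digamma (1 / 4 + of_real (s / 2))) - Re (Digamma (1 / 4 :: complex))"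
proof -
  let ?v = "complex_of_real (s / 2)"
  have v: "Re ?v \<ge> 0" using s by simp
  have r: "Re (indicator {0<..} u *\<^sub>R (of_real (digamma_kernel u) * (1 - exp (- (?v * of_real u))))) =
       indicator {0<..} u *\<^sub>R (digamma_kernel u * (1 - exp (- (s * (u / 2)))))" for u
    by (simp add: Re_exp mult_ac)
  note * = Digamma_quarter_diff[OF v, unfolded set_integrable_def set_lebesgue_integral_def]
  show "set_integrable lborel {0<..} (\<lambda>u. digamma_kernel u * (1 - exp (- (s * (u / 2)))))"
    using integrable_Re[OF *(1)] unfolding r set_integrable_def .
  show "(LBINT u:{0<..}. digamma_kernel u * (1 - exp (- (s * (u / 2))))) = Re (Digamma (1 / 4 + ?v)) - Re (Digamma (1 / 4 :: complex))"
    using integral_Re[OF *(1)] unfolding *(2) r set_lebesgue_integral_def by simp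
qed

text \<open>The mean of \<open>Re (Digamma (1 / 4 + \<i> * t / 2)) - Re (Digamma (1 / 4))\<close>
  under the normalised weight \<open>exp (- x * t^2)\<close> on \<open>t > 0\<close>: a cosine of
  frequency \<open>u / 2\<close> averages to \<open>exp (- (u / 2)^2 / (4 * x))\<close>.\<close>

definition gauss_digamma :: "real \<Rightarrow> real" where
  "gauss_digamma x = (LBINT u:{0<..}. digamma_kernel u * (1 - exp (- (u\<^sup>2 / (16 * x)))))"

lemma integrable_exp_eighth: "set_integrable lborel {0<..} (\<lambda>u::real. c * exp (- (u / 8)))"
  using integral_exp_Ioi(1)[of "1 / 8"] by (intro set_integrable_mult_right) simp

lemma set_integrable_gauss_digamma:
  assumes x: "x > 0"
  shows "set_integrable lborel {0<..} (\<lambda>u. digamma_kernel u * (1 - exp (- (u\<^sup>2 / (16 * x)))))"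
proof (rule set_integrable_bound[OF integrable_exp_eighth[of "16 / x"]])
  show "set_borel_measurable lborel {0<..} (\<lambda>u. digamma_kernel u * (1 - exp (- (u\<^sup>2 / (16 * x)))))"
    unfolding set_borel_measurable_def by measurable
  show "AE u in lborel. u \<in> {0<..} \<longrightarrow> norm (digamma_kernel u * (1 - exp (- (u\<^sup>2 / (16 * x))))) \<le> norm (16 / x * exp (- (u / 8)))"
  proof (intro AE_I2 impI)
    fix u :: real assume "u \<in> {0<..}"
    hence u: "u > 0" by simp
    have "digamma_kernel u * (1 - exp (- (u\<^sup>2 / (16 * x)))) \<le> digamma_kernel u * (u\<^sup>2 / (16 * x))"
      using exp_ge_add_one_self[of "- (u\<^sup>2 / (16 * x))"] digamma_kernel_pos[OF u] by (intro mult_left_mono) auto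
    also have "\<dots> = (digamma_kernel u * u\<^sup>2) / (16 * x)" by simp
    also have "\<dots> \<le> (256 * exp (- (u / 8))) / (16 * x)"
      using digamma_kernel_le(2)[OF u] x by (intro divide_right_mono) auto
    also have "\<dots> = 16 / x * exp (- (u / 8))" by simp
    finally show "norm (digamma_kernel u * (1 - exp (- (u\<^sup>2 / (16 * x))))) \<le> norm (16 / x * exp (- (u / 8)))"
      using x digamma_kernel_pos[OF u] by simp
  qed
qed

lemma integral_gaussian_Ioi:
  assumes x: "x > 0"
  shows "set_integrable lborel {0<..} (\<lambda>t. exp (- x * t\<^sup>2))" "(LBINT t:{0<..}. exp (- x * t\<^sup>2)) = sqrt (pi / x) / 2"
  using gaussian_cos_integral[OF x, of 0] by simp_all

text \<open>The digamma difference in \<open>Psi_eq\<close> is an integral over \<open>u\<close>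
  with the factor \<open>1 - cos (u / 2 * t)\<close>. This factor is nonnegative, so Tonelli allows
  the Gaussian integration in \<open>t\<close> to be done first.\<close>

lemma Phi_eq:
  assumes x: "x > 0"
  shows "set_integrable lborel {0<..} (\<lambda>t. exp (- x * t\<^sup>2) * Psi t)"
    and "Phi x = (ln pi - Re (Digamma (1 / 4 :: complex)) - gauss_digamma x) / (4 * sqrt (pi * x))"
proof -
  let ?P = "Re (Digamma (1 / 4 :: complex))"
  let ?f = "\<lambda>u t. exp (- x * t\<^sup>2) * (digamma_kernel u * (1 - cos (u / 2 * t)))"
  let ?c = "sqrt (pi / x) / 2"
  have inner: "set_integrable lborel {0<..} (?f u)"
    "(LBINT t:{0<..}. ?f u t) = ?c * (digamma_kernel u * (1 - exp (- (u\<^sup>2 / (16 * x)))))" for u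
  proof -
    have eq: "?f u = (\<lambda>t. digamma_kernel u * (exp (- x * t\<^sup>2) - exp (- x * t\<^sup>2) * cos (u / 2 * t)))"
      by (simp add: fun_eq_iff algebra_simps)
    note i = integral_gaussian_Ioi[OF x] gaussian_cos_integral[OF x, of "u / 2"]
    show "set_integrable lborel {0<..} (?f u)"
      unfolding eq by (intro set_integrable_mult_right set_integral_diff(1) i)
    have "(LBINT t:{0<..}. ?f u t) = digamma_kernel u * (?c - ?c * exp (- ((u / 2)\<^sup>2 / (4 * x))))"
      unfolding eq set_integral_mult_right set_integral_diff(2)[OF i(1) i(3)] i(2) i(4) ..
    also have "(u / 2)\<^sup>2 / (4 * x) = u\<^sup>2 / (16 * x)" by (simp add: power_divide)
    finally show "(LBINT t:{0<..}. ?f u t) = ?c * (digamma_kernel u * (1 - exp (- (u\<^sup>2 / (16 * x)))))"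
      by (simp add: algebra_simps)
  qed
  note T = set_integral_Tonelli_Ioi[of ?f "\<lambda>u. ?c * (digamma_kernel u * (1 - exp (- (u\<^sup>2 / (16 * x)))))"]
  have inn: "(LBINT u:{0<..}. ?f u t) = exp (- x * t\<^sup>2) * (Re (Digamma (1 / 4 + \<i> * of_real (t / 2))) - ?P)" for t
    unfolding set_integral_mult_right Digamma_quarter_diff_cos(2) ..
  have m: "(\<lambda>(u, t). ?f u t) \<in> borel_measurable (borel \<Otimes>\<^sub>M borel)" by measurable
  have nn: "?f u t \<ge> 0" if "u > 0" "t > 0" for u t using digamma_kernel_pos[OF that(1)] by simp
  have hi: "set_integrable lborel {0<..} (\<lambda>u. ?c * (digamma_kernel u * (1 - exp (- (u\<^sup>2 / (16 * x))))))"
    by (intro set_integrable_mult_right set_integrable_gauss_digamma[OF x])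
  have T1: "set_integrable lborel {0<..} (\<lambda>t. exp (- x * t\<^sup>2) * (Re (Digamma (1 / 4 + \<i> * of_real (t / 2))) - ?P))"
    and T2: "(LBINT t:{0<..}. exp (- x * t\<^sup>2) * (Re (Digamma (1 / 4 + \<i> * of_real (t / 2))) - ?P)) = ?c * gauss_digamma x"
  proof -
    note T' = T[OF m nn inner(1) inner(2) hi]
    show "set_integrable lborel {0<..} (\<lambda>t. exp (- x * t\<^sup>2) * (Re (Digamma (1 / 4 + \<i> * of_real (t / 2))) - ?P))"
      using T'(1) unfolding inn .
    have "(LBINT u:{0<..}. ?c * (digamma_kernel u * (1 - exp (- (u\<^sup>2 / (16 * x)))))) = ?c * gauss_digamma x"
      unfolding gauss_digamma_def by (rule set_integral_mult_right)
    with T'(2)[unfolded inn]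
    show "(LBINT t:{0<..}. exp (- x * t\<^sup>2) * (Re (Digamma (1 / 4 + \<i> * of_real (t / 2))) - ?P)) = ?c * gauss_digamma x"
      by (rule trans)
  qed
  have eq: "(\<lambda>t. exp (- x * t\<^sup>2) * Psi t) = (\<lambda>t. (ln pi - ?P) * exp (- x * t\<^sup>2) -
     exp (- x * t\<^sup>2) * (Re (Digamma (1 / 4 + \<i> * of_real (t / 2))) - ?P))"
    unfolding Psi_eq by (simp add: fun_eq_iff algebra_simps)
  have G: "set_integrable lborel {0<..} (\<lambda>t. (ln pi - ?P) * exp (- x * t\<^sup>2))"
    by (intro set_integrable_mult_right integral_gaussian_Ioi(1)[OF x])
  show "set_integrable lborel {0<..} (\<lambda>t. exp (- x * t\<^sup>2) * Psi t)"
    unfolding eq by (rule set_integral_diff(1)[OF G T1])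
  have "(LBINT t:{0<..}. exp (- x * t\<^sup>2) * Psi t) = (ln pi - ?P) * ?c - ?c * gauss_digamma x"
    unfolding eq set_integral_diff(2)[OF G T1] T2 set_integral_mult_right integral_gaussian_Ioi(2)[OF x] ..
  hence "Phi x = 1 / (2 * pi) * ((ln pi - ?P) * ?c - ?c * gauss_digamma x)" unfolding Phi_def by simp
  also have "\<dots> = (?c / (2 * pi)) * (ln pi - ?P - gauss_digamma x)" by (simp add: algebra_simps diff_divide_distrib)
  also have "?c / (2 * pi) = 1 / (4 * sqrt (pi * x))"
  proof -
    have "pi = sqrt pi * sqrt pi" by simp
    hence "sqrt pi / sqrt x / 2 / (2 * pi) = 1 / (4 * (sqrt pi * sqrt x))" using x by (simp add: field_simps)
    thus ?thesis by (simp add: real_sqrt_divide real_sqrt_mult)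
  qed
  finally show "Phi x = (ln pi - ?P - gauss_digamma x) / (4 * sqrt (pi * x))" by simp
qed

text \<open>By \<open>laplace_gauss\<close> with \<open>a = u / 2\<close>, the transform replaces
  \<open>exp (- (u^2 / (16 * x)))\<close> by \<open>exp (- (s * (u / 2)))\<close>. Thus digamma on
  the critical line turns into its value at the real point \<open>1 / 4 + s / 2\<close>, half of
  \<open>1 / 2 + s\<close>, as it occurs in the logarithmic derivative of the Gamma factor.\<close>

lemma laplace_Phi:
  assumes s: "s > 0"
  shows "set_integrable lborel {0<..} (\<lambda>x. exp (- (s\<^sup>2 * x)) * Phi x)"
    and "(LBINT x:{0<..}. exp (- (s\<^sup>2 * x)) * Phi x) = (ln pi - Re (Digamma (1 / 4 + of_real (s / 2)))) / (4 * s)"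
proof -
  let ?P = "Re (Digamma (1 / 4 :: complex))"
  let ?f = "\<lambda>u x. (exp (- (s\<^sup>2 * x)) / sqrt x) * (digamma_kernel u * (1 - exp (- (u\<^sup>2 / (16 * x)))))"
  let ?c = "sqrt pi / s"
  have g0: "set_integrable lborel {0<..} (\<lambda>x. exp (- (s\<^sup>2 * x)) / sqrt x)" "(LBINT x:{0<..}. exp (- (s\<^sup>2 * x)) / sqrt x) = ?c"
    using laplace_gauss[OF s order_refl] by simp_all
  have inner: "set_integrable lborel {0<..} (?f u)"
    "(LBINT x:{0<..}. ?f u x) = ?c * (digamma_kernel u * (1 - exp (- (s * (u / 2)))))" if u: "u > 0" for u
  proof -
    have q: "(u / 2)\<^sup>2 / (4 * x) = u\<^sup>2 / (16 * x)" for x :: real by (simp add: power_divide)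
    have eq: "?f u = (\<lambda>x. digamma_kernel u * (exp (- (s\<^sup>2 * x)) / sqrt x - exp (- (s\<^sup>2 * x)) * (exp (- ((u / 2)\<^sup>2 / (4 * x))) / sqrt x)))"
      unfolding q by (simp add: fun_eq_iff algebra_simps diff_divide_distrib)
    have "u / 2 \<ge> 0" using u by simp
    note i = laplace_gauss[OF s this]
    show "set_integrable lborel {0<..} (?f u)"
      unfolding eq by (intro set_integrable_mult_right set_integral_diff(1) i g0)
    have "(LBINT x:{0<..}. ?f u x) = digamma_kernel u * (?c - sqrt pi * exp (- (s * (u / 2))) / s)"
      unfolding eq set_integral_mult_right set_integral_diff(2)[OF g0(1) i(1)] g0(2) i(2) ..
    thus "(LBINT x:{0<..}. ?f u x) = ?c * (digamma_kernel u * (1 - exp (- (s * (u / 2)))))"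
      by (simp add: algebra_simps diff_divide_distrib)
  qed
  note T = set_integral_Tonelli_Ioi[of ?f "\<lambda>u. ?c * (digamma_kernel u * (1 - exp (- (s * (u / 2)))))"]
  have m: "(\<lambda>(u, x). ?f u x) \<in> borel_measurable (borel \<Otimes>\<^sub>M borel)" by measurable
  have nn: "?f u x \<ge> 0" if "u > 0" "x > 0" for u x using digamma_kernel_pos[OF that(1)] that by simp
  have hi: "set_integrable lborel {0<..} (\<lambda>u. ?c * (digamma_kernel u * (1 - exp (- (s * (u / 2))))))"
    using s by (intro set_integrable_mult_right Digamma_quarter_diff_exp) auto
  have inn: "(LBINT u:{0<..}. ?f u x) = (exp (- (s\<^sup>2 * x)) / sqrt x) * gauss_digamma x" for x
    unfolding set_integral_mult_right gauss_digamma_def ..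
  have s': "s \<ge> 0" using s by simp
  have T1: "set_integrable lborel {0<..} (\<lambda>x. (exp (- (s\<^sup>2 * x)) / sqrt x) * gauss_digamma x)"
    and T2: "(LBINT x:{0<..}. (exp (- (s\<^sup>2 * x)) / sqrt x) * gauss_digamma x) = ?c * (Re (Digamma (1 / 4 + of_real (s / 2))) - ?P)"
  proof -
    note T' = T[OF m nn inner(1) inner(2) hi]
    show "set_integrable lborel {0<..} (\<lambda>x. (exp (- (s\<^sup>2 * x)) / sqrt x) * gauss_digamma x)"
      using T'(1) unfolding inn .
    have "(LBINT u:{0<..}. ?c * (digamma_kernel u * (1 - exp (- (s * (u / 2)))))) = ?c * (Re (Digamma (1 / 4 + of_real (s / 2))) - ?P)"
      unfolding set_integral_mult_right Digamma_quarter_diff_exp(2)[OF s'] ..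
    with T'(2)[unfolded inn]
    show "(LBINT x:{0<..}. (exp (- (s\<^sup>2 * x)) / sqrt x) * gauss_digamma x) = ?c * (Re (Digamma (1 / 4 + of_real (s / 2))) - ?P)"
      by (rule trans)
  qed
  let ?h = "\<lambda>x. 1 / (4 * sqrt pi) * ((ln pi - ?P) * (exp (- (s\<^sup>2 * x)) / sqrt x) - (exp (- (s\<^sup>2 * x)) / sqrt x) * gauss_digamma x)"
  have eq: "exp (- (s\<^sup>2 * x)) * Phi x = ?h x" if "x > 0" for x
  proof -
    have "e * ((l - p - g) / (4 * (r * q))) = 1 / (4 * r) * ((l - p) * (e / q) - (e / q) * g)" for e l p g r q :: real
      by (simp add: right_diff_distrib left_diff_distrib diff_divide_distrib mult_ac)
    thus ?thesis unfolding Phi_eq(2)[OF that] real_sqrt_mult .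
  qed
  have A: "set_integrable lborel {0<..} (\<lambda>x. (ln pi - ?P) * (exp (- (s\<^sup>2 * x)) / sqrt x))"
    by (intro set_integrable_mult_right g0)
  have hint: "set_integrable lborel {0<..} ?h" by (intro set_integrable_mult_right set_integral_diff(1)[OF A T1])
  show "set_integrable lborel {0<..} (\<lambda>x. exp (- (s\<^sup>2 * x)) * Phi x)"
    using hint by (rule set_integrable_cong[THEN iffD1, rotated -1]) (simp_all only: eq greaterThan_iff)
  have "(LBINT x:{0<..}. exp (- (s\<^sup>2 * x)) * Phi x) = (LBINT x:{0<..}. ?h x)"
    by (rule LBINT_Ioi_cong) (simp only: eq greaterThan_iff)
  also have "\<dots> = 1 / (4 * sqrt pi) * ((ln pi - ?P) * ?c - ?c * (Re (Digamma (1 / 4 + of_real (s / 2))) - ?P))"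
    unfolding set_integral_mult_right set_integral_diff(2)[OF A T1] T2 g0(2) ..
  also have "\<dots> = (ln pi - Re (Digamma (1 / 4 + of_real (s / 2)))) / (4 * s)"
    using s by (simp add: field_simps)
  finally show "(LBINT x:{0<..}. exp (- (s\<^sup>2 * x)) * Phi x) = (ln pi - Re (Digamma (1 / 4 + of_real (s / 2)))) / (4 * s)" .
qed

text \<open>\<open>gauss_digamma\<close> is Lipschitz as a function of \<open>1 / x\<close>:
  \<open>exp\<close> has slope at most 1 on nonpositive arguments, and
  \<open>digamma_kernel u * u^2\<close> is dominated by an integrable exponential.\<close>

lemma continuous_on_Phi: "continuous_on {0<..} Phi"
proof -
  define C where "C = (LBINT u:{0<..}. 16 * exp (- (u / 8)) :: real)"
  have lip: "\<bar>gauss_digamma x - gauss_digamma y\<bar> \<le> C * \<bar>1 / x - 1 / y\<bar>" if x: "x > 0" and y: "y > 0" for x y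
  proof -
    note ix = set_integrable_gauss_digamma[OF x] and iy = set_integrable_gauss_digamma[OF y]
    note d = set_integral_diff[OF ix iy]
    have "\<bar>gauss_digamma x - gauss_digamma y\<bar> \<le> (LBINT u:{0<..}. \<bar>digamma_kernel u * (1 - exp (- (u\<^sup>2 / (16 * x)))) - digamma_kernel u * (1 - exp (- (u\<^sup>2 / (16 * y))))\<bar>)"
      unfolding gauss_digamma_def d(2)[symmetric] using set_integral_norm_bound[OF d(1)] by simp
    also have "\<dots> \<le> (LBINT u:{0<..}. \<bar>1 / x - 1 / y\<bar> * (16 * exp (- (u / 8))))"
    proof (rule set_integral_mono)
      show "set_integrable lborel {0<..} (\<lambda>u. \<bar>digamma_kernel u * (1 - exp (- (u\<^sup>2 / (16 * x)))) - digamma_kernel u * (1 - exp (- (u\<^sup>2 / (16 * y))))\<bar>)"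
        by (rule set_integrable_abs[OF d(1)])
      show "set_integrable lborel {0<..} (\<lambda>u. \<bar>1 / x - 1 / y\<bar> * (16 * exp (- (u / 8))))"
        by (intro set_integrable_mult_right integrable_exp_eighth)
      fix u :: real assume "u \<in> {0<..}"
      hence u: "u > 0" by simp
      have "\<bar>exp (- (u\<^sup>2 / (16 * y))) - exp (- (u\<^sup>2 / (16 * x)))\<bar> \<le> \<bar>u\<^sup>2 / (16 * x) - u\<^sup>2 / (16 * y)\<bar>"
      proof -
        have "norm (exp (complex_of_real (- (u\<^sup>2 / (16 * y)))) - exp (complex_of_real (- (u\<^sup>2 / (16 * x))))) \<le>
           exp 0 * norm (complex_of_real (- (u\<^sup>2 / (16 * y))) - complex_of_real (- (u\<^sup>2 / (16 * x))))"
          using x y by (intro norm_exp_diff_le) auto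
        thus ?thesis unfolding exp_of_real of_real_diff[symmetric] norm_of_real by simp
      qed
      also have "u\<^sup>2 / (16 * x) - u\<^sup>2 / (16 * y) = u\<^sup>2 / 16 * (1 / x - 1 / y)" by (simp add: algebra_simps)
      finally have "digamma_kernel u * \<bar>exp (- (u\<^sup>2 / (16 * y))) - exp (- (u\<^sup>2 / (16 * x)))\<bar> \<le> digamma_kernel u * (u\<^sup>2 / 16 * \<bar>1 / x - 1 / y\<bar>)"
        using digamma_kernel_pos[OF u] by (intro mult_left_mono) (auto simp: abs_mult)
      also have "\<dots> = (digamma_kernel u * u\<^sup>2) * (\<bar>1 / x - 1 / y\<bar> / 16)" by simp
      also have "\<dots> \<le> (256 * exp (- (u / 8))) * (\<bar>1 / x - 1 / y\<bar> / 16)"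
        by (intro mult_right_mono digamma_kernel_le(2)[OF u]) auto
      also have "\<dots> = \<bar>1 / x - 1 / y\<bar> * (16 * exp (- (u / 8)))" by simp
      finally have "digamma_kernel u * \<bar>exp (- (u\<^sup>2 / (16 * y))) - exp (- (u\<^sup>2 / (16 * x)))\<bar> \<le> \<bar>1 / x - 1 / y\<bar> * (16 * exp (- (u / 8)))" .
      moreover have "digamma_kernel u * (1 - exp (- (u\<^sup>2 / (16 * x)))) - digamma_kernel u * (1 - exp (- (u\<^sup>2 / (16 * y)))) =
         digamma_kernel u * (exp (- (u\<^sup>2 / (16 * y))) - exp (- (u\<^sup>2 / (16 * x))))" by (simp add: algebra_simps)
      moreover have "\<bar>digamma_kernel u * z\<bar> = digamma_kernel u * \<bar>z\<bar>" for z using digamma_kernel_pos[OF u] by (simp add: abs_mult)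
      ultimately show "\<bar>digamma_kernel u * (1 - exp (- (u\<^sup>2 / (16 * x)))) - digamma_kernel u * (1 - exp (- (u\<^sup>2 / (16 * y))))\<bar> \<le>
         \<bar>1 / x - 1 / y\<bar> * (16 * exp (- (u / 8)))" by (simp only:)
    qed
    also have "\<dots> = C * \<bar>1 / x - 1 / y\<bar>" unfolding set_integral_mult_right[where a = "\<bar>1 / x - 1 / y\<bar>"] C_def by (rule mult.commute)
    finally show ?thesis .
  qed
  have "continuous_on {0<..} gauss_digamma"
  proof (rule continuous_at_imp_continuous_on, safe)
    fix x :: real assume x: "x > 0"
    show "isCont gauss_digamma x" unfolding isCont_def
    proof (rule Lim_transform_eventually[where f = "\<lambda>y. gauss_digamma x + (gauss_digamma y - gauss_digamma x)"])
      have "((\<lambda>y. gauss_digamma y - gauss_digamma x) \<longlongrightarrow> 0) (at x)"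
      proof (rule Lim_null_comparison)
        have "\<forall>\<^sub>F y in at x. y \<in> {0<..}" using x by (intro eventually_at_in_open') auto
        thus "\<forall>\<^sub>F y in at x. norm (gauss_digamma y - gauss_digamma x) \<le> C * \<bar>1 / y - 1 / x\<bar>"
          by eventually_elim (use lip x in auto)
        have "((\<lambda>y. C * \<bar>1 / y - 1 / x\<bar>) \<longlongrightarrow> C * \<bar>1 / x - 1 / x\<bar>) (at x)" using x by (intro tendsto_intros) auto
        thus "((\<lambda>y. C * \<bar>1 / y - 1 / x\<bar>) \<longlongrightarrow> 0) (at x)" by simp
      qed
      thus "((\<lambda>y. gauss_digamma x + (gauss_digamma y - gauss_digamma x)) \<longlongrightarrow> gauss_digamma x) (at x)"
        using tendsto_add[OF tendsto_const[of "gauss_digamma x" "at x"]] by fastforce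
    qed simp
  qed
  hence "continuous_on {0<..} (\<lambda>x. (ln pi - Re (Digamma (1 / 4 :: complex)) - gauss_digamma x) / (4 * sqrt (pi * x)))"
    by (intro continuous_intros) auto
  thus ?thesis by (rule continuous_on_eq) (simp add: Phi_eq(2))
qed

lemma set_integrable_Ioi_cong:
  fixes f g :: "real \<Rightarrow> 'a :: {banach, second_countable_topology}"
  assumes "set_integrable lborel {0<..} g" "\<And>x. x \<in> {0<..} \<Longrightarrow> f x = g x"
  shows "set_integrable lborel {0<..} f"
  using assms(1) by (subst set_integrable_cong[OF refl refl assms(2)])

section \<open>Frullani integrals and the second formula for \<open>Phi\<close>\<close>

lemma abs_exp_diff_le:
  fixes p q :: real
  assumes "p \<le> M" "q \<le> M"
  shows "\<bar>exp p - exp q\<bar> \<le> exp M * \<bar>p - q\<bar>"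
  using norm_exp_diff_le[of "of_real p" M "of_real q"] assms
  unfolding exp_of_real of_real_diff[symmetric] norm_of_real by simp

text \<open>A Frullani integrand cannot be split, because its parts diverge at 0. Replacing
  \<open>1 / u\<close> by \<open>u powr (e - 1)\<close> with \<open>e = 1 / (n + 1)\<close> makes
  the parts Gamma integrals, and \<open>u powr e \<le> 1 + u\<close> provides the majorant for
  letting \<open>e\<close> tend to 0.\<close>

lemma mellin_limit:
  fixes q B :: "real \<Rightarrow> real"
  assumes cont: "continuous_on {0<..} q"
    and B: "set_integrable lborel {0<..} B"
    and bd: "\<And>u. u > 0 \<Longrightarrow> (1 + u) * \<bar>q u\<bar> / u \<le> B u"
  shows "set_integrable lborel {0<..} (\<lambda>u. q u / u)"
    and "(\<lambda>n. LBINT u:{0<..}. u powr (1 / real (Suc n) - 1) * q u) \<longlonglongrightarrow> (LBINT u:{0<..}. q u / u)"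
proof -
  have m1: "(\<lambda>u. indicator {0<..} u *\<^sub>R (q u / u)) \<in> borel_measurable borel"
    by (rule borel_measurable_continuous_on_indicator) (auto intro!: continuous_intros cont)
  have m2: "(\<lambda>u. indicator {0<..} u *\<^sub>R (u powr (1 / real (Suc n) - 1) * q u)) \<in> borel_measurable borel" for n
    by (rule borel_measurable_continuous_on_indicator) (auto intro!: continuous_intros cont)
  have le: "norm (u powr (1 / real (Suc n) - 1) * q u) \<le> B u" if u: "u > 0" for u n
  proof -
    have "u powr (1 / real (Suc n)) \<le> 1 + u"
    proof (cases "u \<le> 1")
      case True
      have "u powr (1 / real (Suc n)) \<le> 1 powr (1 / real (Suc n))" using u True by (intro powr_mono2) auto
      thus ?thesis using u by simp
    next
      case False
      have "u powr (1 / real (Suc n)) \<le> u powr 1" using False by (intro powr_mono) auto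
      thus ?thesis using u by simp
    qed
    hence "u powr (1 / real (Suc n)) * (\<bar>q u\<bar> / u) \<le> (1 + u) * (\<bar>q u\<bar> / u)" using u by (intro mult_right_mono) auto
    moreover have "norm (u powr (1 / real (Suc n) - 1) * q u) = u powr (1 / real (Suc n)) * (\<bar>q u\<bar> / u)"
      using u by (simp add: powr_diff abs_mult del: of_nat_Suc)
    ultimately show ?thesis using bd[OF u] by simp
  qed
  have le': "norm (q u / u) \<le> B u" if u: "u > 0" for u
  proof -
    have "1 * (\<bar>q u\<bar> / u) \<le> (1 + u) * (\<bar>q u\<bar> / u)" using u by (intro mult_right_mono) auto
    thus ?thesis using bd[OF u] u by simp
  qed
  show "set_integrable lborel {0<..} (\<lambda>u. q u / u)"
  proof (rule set_integrable_bound[OF B])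
    show "set_borel_measurable lborel {0<..} (\<lambda>u. q u / u)" using m1 by (simp add: set_borel_measurable_def)
    show "AE u in lborel. u \<in> {0<..} \<longrightarrow> norm (q u / u) \<le> norm (B u)"
      using le' by (intro AE_I2 impI) (force intro: order_trans[OF _ abs_ge_self])
  qed
  show "(\<lambda>n. LBINT u:{0<..}. u powr (1 / real (Suc n) - 1) * q u) \<longlonglongrightarrow> (LBINT u:{0<..}. q u / u)"
    unfolding set_lebesgue_integral_def
  proof (rule integral_dominated_convergence)
    show "integrable lborel (\<lambda>u. indicator {0<..} u *\<^sub>R B u)" using B by (simp add: set_integrable_def)
    show "AE u in lborel. (\<lambda>n. indicator {0<..} u *\<^sub>R (u powr (1 / real (Suc n) - 1) * q u)) \<longlonglongrightarrow> indicator {0<..} u *\<^sub>R (q u / u)"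
    proof (intro AE_I2)
      fix u :: real
      show "(\<lambda>n. indicator {0<..} u *\<^sub>R (u powr (1 / real (Suc n) - 1) * q u)) \<longlonglongrightarrow> indicator {0<..} u *\<^sub>R (q u / u)"
      proof (cases "u > 0")
        case True
        have "(\<lambda>n. 1 / real (Suc n)) \<longlonglongrightarrow> 0" using LIMSEQ_inverse_real_of_nat by (simp add: inverse_eq_divide)
        hence "(\<lambda>n. u powr (1 / real (Suc n) - 1) * q u) \<longlonglongrightarrow> u powr (0 - 1) * q u"
          using True by (intro tendsto_intros) auto
        thus ?thesis using True by (simp add: powr_minus field_simps)
      qed simp
    qed
    show "AE u in lborel. norm (indicator {0<..} u *\<^sub>R (u powr (1 / real (Suc n) - 1) * q u)) \<le> indicator {0<..} u *\<^sub>R B u" for n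
      using le[of _ n] by (intro AE_I2) (auto simp: indicator_def)
  qed (use m1 m2 in auto)
qed

lemma derivative_sequence:
  fixes D :: "real \<Rightarrow> real"
  assumes "(D has_real_derivative l) (at 0)" "D 0 = 0"
  shows "(\<lambda>n. D (1 / real (Suc n)) / (1 / real (Suc n))) \<longlonglongrightarrow> l"
proof -
  have "((\<lambda>h. (D (0 + h) - D 0) / h) \<longlongrightarrow> l) (at 0)" using assms(1) by (simp add: DERIV_def)
  moreover have "filterlim (\<lambda>n. 1 / real (Suc n)) (at 0) sequentially"
    unfolding filterlim_at using LIMSEQ_inverse_real_of_nat by (auto simp: inverse_eq_divide)
  ultimately have "(\<lambda>n. (D (0 + 1 / real (Suc n)) - D 0) / (1 / real (Suc n))) \<longlonglongrightarrow> l"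
    by (rule filterlim_compose)
  thus ?thesis using assms(2) by simp
qed

lemma set_integral_square:
  fixes f :: "real \<Rightarrow> real"
  assumes cont: "continuous_on {0<..} f" and int: "set_integrable lborel {0<..} f"
  shows "set_integrable lborel {0<..} (\<lambda>u. 2 * u * f (u\<^sup>2))" "(LBINT u:{0<..}. 2 * u * f (u\<^sup>2)) = (LBINT v:{0<..}. f v)"
proof -
  have m1: "set_borel_measurable borel {0<..} f"
    unfolding set_borel_measurable_def by (rule borel_measurable_continuous_on_indicator) (auto intro: cont)
  have m2: "set_borel_measurable borel {0<..} (\<lambda>u. 2 * u * f (u\<^sup>2))"
    unfolding set_borel_measurable_def
    by (rule borel_measurable_continuous_on_indicator)
       (auto intro!: continuous_intros continuous_on_compose2[OF cont])
  have im: "(\<lambda>u::real. u\<^sup>2) ` {0<..} = {0<..}"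
  proof safe
    fix x :: real assume "x > 0"
    thus "x \<in> (\<lambda>u. u\<^sup>2) ` {0<..}" by (intro image_eqI[of _ _ "sqrt x"]) auto
  qed auto
  have "(\<lambda>u. \<bar>2 * u\<bar> * f (u\<^sup>2)) absolutely_integrable_on {0<..} \<and>
         integral {0<..} (\<lambda>u. \<bar>2 * u\<bar> * f (u\<^sup>2)) = b \<longleftrightarrow>
        f absolutely_integrable_on ((\<lambda>u. u\<^sup>2) ` {0<..}) \<and> integral ((\<lambda>u. u\<^sup>2) ` {0<..}) f = b" for b
    by (rule has_absolute_integral_change_of_variables_1')
       (auto intro!: derivative_eq_intros inj_onI simp: power2_eq_iff)
  hence eq: "(\<lambda>u. \<bar>2 * u\<bar> * f (u\<^sup>2)) absolutely_integrable_on {0<..} \<and>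
         integral {0<..} (\<lambda>u. \<bar>2 * u\<bar> * f (u\<^sup>2)) = integral {0<..} f"
    using int set_integrable_lborel_iff[OF m1] unfolding im by blast
  have "(\<lambda>u. 2 * u * f (u\<^sup>2)) absolutely_integrable_on {0<..}"
    using conjunct1[OF eq] by (rule set_integrable_cong[THEN iffD1, rotated -1]) auto
  thus i2: "set_integrable lborel {0<..} (\<lambda>u. 2 * u * f (u\<^sup>2))" using set_integrable_lborel_iff[OF m2] by simp
  have "integral {0<..} (\<lambda>u. 2 * u * f (u\<^sup>2)) = integral {0<..} (\<lambda>u. \<bar>2 * u\<bar> * f (u\<^sup>2))"
    by (rule integral_cong) auto
  thus "(LBINT u:{0<..}. 2 * u * f (u\<^sup>2)) = (LBINT v:{0<..}. f v)"
    using conjunct2[OF eq] set_integral_lborel_eq[OF m2 i2] set_integral_lborel_eq[OF m1 int] by simp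
qed

lemma mellin_gaussian:
  fixes a e :: real
  assumes a: "a > 0" and e: "e > 0"
  shows "set_integrable lborel {0<..} (\<lambda>u. u powr (e - 1) * exp (- (a * u\<^sup>2)))"
    "(LBINT u:{0<..}. u powr (e - 1) * exp (- (a * u\<^sup>2))) = Gamma (e / 2) * a powr (- (e / 2)) / 2"
proof -
  let ?f = "\<lambda>v. v powr (e / 2 - 1) * exp (- (a * v))"
  have c: "continuous_on {0<..} ?f" by (intro continuous_intros) auto
  have e2: "e / 2 > 0" using e by simp
  note S = set_integral_square[OF c integral_Gamma_scaled(1)[OF e2 a]]
  have eq: "u powr (e - 1) * exp (- (a * u\<^sup>2)) = 1 / 2 * (2 * u * ?f (u\<^sup>2))" if u: "u \<in> {0<..}" for u
  proof -
    have "(u\<^sup>2) powr (e / 2 - 1) = u powr (e - 2)"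
      using u powr_powr[of u 2 "e / 2 - 1"] by (simp add: algebra_simps)
    moreover have "u * u powr (e - 2) = u powr (e - 1)"
      using u powr_add[of u 1 "e - 2"] by simp
    ultimately show ?thesis by (simp flip: mult.assoc)
  qed
  have i: "set_integrable lborel {0<..} (\<lambda>u. 1 / 2 * (2 * u * ?f (u\<^sup>2)))"
    by (intro set_integrable_mult_right S)
  show "set_integrable lborel {0<..} (\<lambda>u. u powr (e - 1) * exp (- (a * u\<^sup>2)))"
    using i by (rule set_integrable_Ioi_cong) (rule eq)
  have "(LBINT u:{0<..}. u powr (e - 1) * exp (- (a * u\<^sup>2))) = (LBINT u:{0<..}. 1 / 2 * (2 * u * ?f (u\<^sup>2)))"
    by (rule LBINT_Ioi_cong) (rule eq)
  also have "\<dots> = Gamma (e / 2) * a powr (- (e / 2)) / 2"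
    unfolding set_integral_mult_right[where a = "1 / 2"] S(2) integral_Gamma_scaled(2)[OF e2 a] by simp
  finally show "(LBINT u:{0<..}. u powr (e - 1) * exp (- (a * u\<^sup>2))) = Gamma (e / 2) * a powr (- (e / 2)) / 2" .
qed

lemma Gamma_real_plus1: "e > 0 \<Longrightarrow> Gamma (1 + e) = e * Gamma (e :: real)"
proof -
  assume "e > 0"
  hence "e \<notin> \<int>\<^sub>\<le>\<^sub>0" by (auto elim!: nonpos_Ints_cases)
  from Gamma_plus1[OF this] show ?thesis by (simp add: add.commute)
qed

text \<open>The regularised integral is
  \<open>Gamma e - Gamma (e / 2) * a powr (- (e / 2)) / 2\<close>, which is \<open>D e / e\<close>
  by the recurrence of Gamma. So the limit is the derivative of \<open>D\<close> at 0: the power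
  contributes \<open>ln a / 2\<close>, and of the Gamma derivatives at 1 one half,
  \<open>- euler_mascheroni / 2\<close>, is left.\<close>

lemma frullani_exp_gaussian:
  fixes a :: real
  assumes a: "a > 0"
  shows "set_integrable lborel {0<..} (\<lambda>u. (exp (- u) - exp (- (a * u\<^sup>2))) / u)"
    "(LBINT u:{0<..}. (exp (- u) - exp (- (a * u\<^sup>2))) / u) = (ln a - euler_mascheroni) / 2"
proof -
  let ?q = "\<lambda>u. exp (- u) - exp (- (a * u\<^sup>2))"
  let ?C = "2 * (1 + a) * exp 1 + 2"
  let ?B = "\<lambda>u. ?C * exp (- (1 * u)) + 2 * exp (- (a * u))"
  have B: "set_integrable lborel {0<..} ?B"
    using a by (intro set_integral_add(1) set_integrable_mult_right integral_exp_Ioi) auto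
  \<comment> \<open>Up to 1 the linear vanishing of \<open>?q\<close> at 0 is used, beyond 1 the
    decay, with \<open>a * u^2 \<ge> a * u\<close>.\<close>
  have bd: "(1 + u) * \<bar>?q u\<bar> / u \<le> ?B u" if u: "u > 0" for u
  proof (cases "u \<le> 1")
    case True
    have "\<bar>?q u\<bar> \<le> exp 0 * \<bar>- u - - (a * u\<^sup>2)\<bar>" using u a by (intro abs_exp_diff_le) auto
    also have "\<dots> \<le> u + a * u\<^sup>2" using u a by (simp add: abs_le_iff)
    also have "\<dots> \<le> u + a * u" using True u a by (simp add: power2_eq_square)
    finally have "\<bar>?q u\<bar> / u \<le> 1 + a" using u by (simp add: field_simps)
    hence "(1 + u) * (\<bar>?q u\<bar> / u) \<le> 2 * (1 + a)" using True u a by (intro mult_mono) auto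
    also have "\<dots> \<le> 2 * (1 + a) * (exp 1 * exp (- u))" using a True by (simp flip: exp_add)
    also have "\<dots> \<le> ?B u" by (simp add: algebra_simps)
    finally show ?thesis by simp
  next
    case False
    have "a * u \<le> a * u\<^sup>2" using False a by (simp add: power2_eq_square)
    hence "\<bar>?q u\<bar> \<le> exp (- u) + exp (- (a * u))"
      by (smt (verit) exp_gt_zero exp_le_cancel_iff)
    hence "((1 + u) / u) * \<bar>?q u\<bar> \<le> 2 * (exp (- u) + exp (- (a * u)))"
      using False u by (intro mult_mono) (auto simp: field_simps)
    also have "\<dots> \<le> ?B u" using a by (simp add: algebra_simps)
    finally show ?thesis by simp
  qed
  have c: "continuous_on {0<..} ?q" by (intro continuous_intros)
  note M = mellin_limit[OF c B bd]
  show "set_integrable lborel {0<..} (\<lambda>u. ?q u / u)" by (rule M(1))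
  define D where "D = (\<lambda>e::real. Gamma (1 + e) - a powr (- (e / 2)) * Gamma (1 + e / 2))"
  have "(D has_real_derivative (ln a - euler_mascheroni) / 2) (at 0)"
    unfolding D_def using a by (auto intro!: derivative_eq_intros simp: field_simps)
  from derivative_sequence[OF this] have "(\<lambda>n. D (1 / real (Suc n)) / (1 / real (Suc n))) \<longlonglongrightarrow> (ln a - euler_mascheroni) / 2"
    using a by (simp add: D_def)
  moreover have "(LBINT u:{0<..}. u powr (e - 1) * ?q u) = D e / e" if e: "e > 0" for e
  proof -
    have 1: "set_integrable lborel {0<..} (\<lambda>u. u powr (e - 1) * exp (- u))" "(LBINT u:{0<..}. u powr (e - 1) * exp (- u)) = Gamma e"
      using integral_Gamma_scaled[OF e, of 1] by simp_all
    note 2 = mellin_gaussian[OF a e]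
    have "(LBINT u:{0<..}. u powr (e - 1) * ?q u) = Gamma e - Gamma (e / 2) * a powr (- (e / 2)) / 2"
      unfolding right_diff_distrib set_integral_diff(2)[OF 1(1) 2(1)] 1(2) 2(2) ..
    also have "\<dots> = D e / e"
      unfolding D_def using Gamma_real_plus1[OF e] Gamma_real_plus1[of "e / 2"] e by (simp add: field_simps)
    finally show ?thesis .
  qed
  hence "(LBINT u:{0<..}. u powr (1 / real (Suc n) - 1) * ?q u) = D (1 / real (Suc n)) / (1 / real (Suc n))" for n by simp
  ultimately show "(LBINT u:{0<..}. ?q u / u) = (ln a - euler_mascheroni) / 2"
    using LIMSEQ_unique[OF M(2)] by simp
qed

text \<open>The same regularisation with \<open>D e = Gamma (1 + e) * (1 - a powr (- e))\<close>,
  whose derivative at 0 is \<open>ln a\<close>.\<close>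

lemma frullani_exp_exp:
  fixes a :: real
  assumes a: "a \<ge> 1"
  shows "set_integrable lborel {0<..} (\<lambda>u. (exp (- u) - exp (- (a * u))) / u)"
    "(LBINT u:{0<..}. (exp (- u) - exp (- (a * u))) / u) = ln a"
proof -
  let ?q = "\<lambda>u. exp (- u) - exp (- (a * u))"
  let ?B = "\<lambda>u. (2 * (a - 1)) * exp (- (1 / 2 * u))"
  have B: "set_integrable lborel {0<..} ?B"
    by (intro set_integrable_mult_right integral_exp_Ioi) auto
  have bd: "(1 + u) * \<bar>?q u\<bar> / u \<le> ?B u" if u: "u > 0" for u
  proof -
    have "\<bar>?q u\<bar> \<le> exp (- u) * \<bar>- u - - (a * u)\<bar>" using u a by (intro abs_exp_diff_le) auto
    also have "\<dots> = exp (- u) * ((a - 1) * u)" using u a by (simp add: algebra_simps abs_if)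
    finally have "\<bar>?q u\<bar> / u \<le> exp (- u) * (a - 1)" using u by (simp add: field_simps)
    moreover have "1 + u \<le> 2 * exp (u / 2)" using exp_ge_add_one_self[of "u / 2"] u by linarith
    ultimately have "(1 + u) * (\<bar>?q u\<bar> / u) \<le> (2 * exp (u / 2)) * (exp (- u) * (a - 1))"
      using u a by (intro mult_mono) auto
    also have "\<dots> = ?B u"
    proof -
      have "exp (u / 2) * exp (- u) = exp (- (1 / 2 * u))" by (simp flip: exp_add)
      moreover have "(2 * exp (u / 2)) * (exp (- u) * (a - 1)) = (2 * (a - 1)) * (exp (u / 2) * exp (- u))"
        by (simp only: mult_ac)
      ultimately show ?thesis by (simp only:)
    qed
    finally show ?thesis by simp
  qed
  have c: "continuous_on {0<..} ?q" by (intro continuous_intros)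
  note M = mellin_limit[OF c B bd]
  show "set_integrable lborel {0<..} (\<lambda>u. ?q u / u)" by (rule M(1))
  define D where "D = (\<lambda>e::real. Gamma (1 + e) * (1 - a powr (- e)))"
  have "(D has_real_derivative ln a) (at 0)"
    unfolding D_def using a by (auto intro!: derivative_eq_intros)
  from derivative_sequence[OF this] have "(\<lambda>n. D (1 / real (Suc n)) / (1 / real (Suc n))) \<longlonglongrightarrow> ln a"
    using a by (simp add: D_def)
  moreover have "(LBINT u:{0<..}. u powr (e - 1) * ?q u) = D e / e" if e: "e > 0" for e
  proof -
    have a0: "a > 0" using a by simp
    have 1: "set_integrable lborel {0<..} (\<lambda>u. u powr (e - 1) * exp (- u))" "(LBINT u:{0<..}. u powr (e - 1) * exp (- u)) = Gamma e"
      using integral_Gamma_scaled[OF e, of 1] by simp_all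
    note 2 = integral_Gamma_scaled[OF e a0]
    have "(LBINT u:{0<..}. u powr (e - 1) * ?q u) = Gamma e - Gamma e * a powr (- e)"
      unfolding right_diff_distrib set_integral_diff(2)[OF 1(1) 2(1)] 1(2) 2(2) ..
    also have "\<dots> = D e / e"
      unfolding D_def using Gamma_real_plus1[OF e] e by (simp add: field_simps)
    finally show ?thesis .
  qed
  hence "(LBINT u:{0<..}. u powr (1 / real (Suc n) - 1) * ?q u) = D (1 / real (Suc n)) / (1 / real (Suc n))" for n by simp
  ultimately show "(LBINT u:{0<..}. ?q u / u) = ln a"
    using LIMSEQ_unique[OF M(2)] by simp
qed

text \<open>Gauss's integral, obtained from differences: the digamma value at \<open>n + 1\<close>
  is \<open>harm n - euler_mascheroni\<close>, its distance from the value at \<open>1 / 4\<close>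
  is known as an integral, and \<open>ln (n + 1)\<close> is a Frullani integral. Their combination
  differs from \<open>?g\<close> by a term with integral at most \<open>1 / (n + 1)\<close>, and
  \<open>harm n - ln (n + 1)\<close> tends to \<open>euler_mascheroni\<close>.\<close>

lemma Digamma_quarter_gauss:
  "set_integrable lborel {0<..} (\<lambda>u. exp (- u) / u - digamma_kernel u)"
  "(LBINT u:{0<..}. exp (- u) / u - digamma_kernel u) = Re (Digamma (1 / 4 :: complex))"
proof -
  let ?g = "\<lambda>u. exp (- u) / u - digamma_kernel u"
  let ?P = "Re (Digamma (1 / 4 :: complex))"
  \<comment> \<open>The factor \<open>1 / (1 - exp (- u))\<close> with its pole at 0 removed, hence
    bounded; damped by \<open>exp (- ((n + 1) * u))\<close> its integral vanishes in the
    limit.\<close>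
  define \<kappa> where "\<kappa> = (\<lambda>u::real. 1 / (1 - exp (- u)) - 1 / u)"
  have kappa: "0 \<le> \<kappa> u" "\<kappa> u \<le> 1" if u: "u > 0" for u
  proof -
    have "1 - exp (- u) > 0" "1 - exp (- u) \<le> u" using u exp_ge_add_one_self[of "- u"] by simp_all
    thus "0 \<le> \<kappa> u" using u unfolding \<kappa>_def by (simp add: frac_le)
    have "1 / (1 - exp (- u)) = (u / (1 - exp (- u))) / u" using u by simp
    also have "\<dots> \<le> (1 + u) / u" using one_minus_exp_ge[OF u] u by (intro divide_right_mono) auto
    finally show "\<kappa> u \<le> 1" using u unfolding \<kappa>_def by (simp add: add_divide_distrib)
  qed
  have main: "set_integrable lborel {0<..} ?g \<and>
     \<bar>(LBINT u:{0<..}. ?g u) - (ln (real (Suc n)) - (harm n - euler_mascheroni - ?P))\<bar> \<le> 1 / real (Suc n)" for n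
  proof -
    let ?N = "real (Suc n)"
    have N: "?N \<ge> 1" "?N > 0" by auto
    have ek: "set_integrable lborel {0<..} (\<lambda>u. exp (- (?N * u)) * \<kappa> u)"
    proof (rule set_integrable_bound[OF integral_exp_Ioi(1)[OF N(2)]])
      show "set_borel_measurable lborel {0<..} (\<lambda>u. exp (- (?N * u)) * \<kappa> u)"
        unfolding set_borel_measurable_def \<kappa>_def by measurable
      show "AE u in lborel. u \<in> {0<..} \<longrightarrow> norm (exp (- (?N * u)) * \<kappa> u) \<le> norm (exp (- (?N * u)))"
        using kappa by (intro AE_I2) (auto simp: abs_mult intro!: mult_left_le)
    qed
    have ekv: "0 \<le> (LBINT u:{0<..}. exp (- (?N * u)) * \<kappa> u)" "(LBINT u:{0<..}. exp (- (?N * u)) * \<kappa> u) \<le> 1 / ?N"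
    proof -
      show "0 \<le> (LBINT u:{0<..}. exp (- (?N * u)) * \<kappa> u)"
        unfolding set_lebesgue_integral_def using kappa by (intro integral_nonneg_AE AE_I2) (auto simp: indicator_def)
      have "(LBINT u:{0<..}. exp (- (?N * u)) * \<kappa> u) \<le> (LBINT u:{0<..}. exp (- (?N * u)))"
        using kappa by (intro set_integral_mono ek integral_exp_Ioi(1)[OF N(2)]) (auto intro!: mult_left_le)
      thus "(LBINT u:{0<..}. exp (- (?N * u)) * \<kappa> u) \<le> 1 / ?N" unfolding integral_exp_Ioi(2)[OF N(2)] .
    qed
    \<comment> \<open>Makes \<open>1 / 4 + ?s / 2\<close> equal to the positive integer
      \<open>?N\<close>, where digamma is a harmonic number minus Euler's constant.\<close>
    let ?s = "2 * (?N - 1 / 4)"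
    have s: "?s \<ge> 0" using N by simp
    note A = frullani_exp_exp[OF N(1)] and B = Digamma_quarter_diff_exp[OF s]
    have eq: "?g u = ((exp (- u) - exp (- (?N * u))) / u - digamma_kernel u * (1 - exp (- (?s * (u / 2))))) - exp (- (?N * u)) * \<kappa> u"
      if u: "u \<in> {0<..}" for u
    proof -
      have "digamma_kernel u * exp (- (?s * (u / 2))) = exp (- (?N * u)) / (1 - exp (- u))"
        unfolding digamma_kernel_def by (simp add: algebra_simps flip: exp_add)
      thus ?thesis unfolding \<kappa>_def by (simp add: algebra_simps diff_divide_distrib del: of_nat_Suc)
    qed
    note AB = set_integral_diff[OF A(1) B(1)]
    note ABk = set_integral_diff[OF AB(1) ek]
    have i: "set_integrable lborel {0<..} ?g"
      using ABk(1) by (rule set_integrable_Ioi_cong) (rule eq)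
    have "(LBINT u:{0<..}. ?g u) = (LBINT u:{0<..}. ((exp (- u) - exp (- (?N * u))) / u - digamma_kernel u * (1 - exp (- (?s * (u / 2))))) - exp (- (?N * u)) * \<kappa> u)"
      by (rule LBINT_Ioi_cong) (rule eq)
    also have "\<dots> = (ln ?N - (Re (Digamma (1 / 4 + of_real (?s / 2))) - ?P)) - (LBINT u:{0<..}. exp (- (?N * u)) * \<kappa> u)"
      unfolding ABk(2) AB(2) A(2) B(2) ..
    also have "1 / 4 + complex_of_real (?s / 2) = of_nat (Suc n)" by (simp add: field_simps)
    also have "Re (Digamma (of_nat (Suc n) :: complex)) = harm n - euler_mascheroni"
    proof -
      have "harm n - euler_mascheroni = complex_of_real (harm n - euler_mascheroni)"
        by (simp add: harm_def of_real_euler_mascheroni)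
      thus ?thesis unfolding Digamma_of_nat by (simp only: Re_complex_of_real)
    qed
    finally have "(LBINT u:{0<..}. ?g u) - (ln ?N - (harm n - euler_mascheroni - ?P)) = - (LBINT u:{0<..}. exp (- (?N * u)) * \<kappa> u)" by simp
    thus ?thesis using i ekv by simp
  qed
  show "set_integrable lborel {0<..} ?g" using main by blast
  have "(\<lambda>n. (LBINT u:{0<..}. ?g u) - (ln (real (Suc n)) - (harm n - euler_mascheroni - ?P))) \<longlonglongrightarrow> 0"
  proof (rule Lim_null_comparison)
    show "\<forall>\<^sub>F n in sequentially. norm ((LBINT u:{0<..}. ?g u) - (ln (real (Suc n)) - (harm n - euler_mascheroni - ?P))) \<le> 1 / real (Suc n)"
      using main by (intro always_eventually) simp
    show "(\<lambda>n. 1 / real (Suc n)) \<longlonglongrightarrow> 0" using LIMSEQ_inverse_real_of_nat by (simp add: inverse_eq_divide)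
  qed
  moreover have "(\<lambda>n. (LBINT u:{0<..}. ?g u) - (ln (real (Suc n)) - (harm n - euler_mascheroni - ?P))) \<longlonglongrightarrow> (LBINT u:{0<..}. ?g u) - ?P"
  proof -
    have "(\<lambda>n. ln (real (Suc n)) - ln (real n)) \<longlonglongrightarrow> 0" by real_asymp
    from tendsto_diff[OF euler_mascheroni_LIMSEQ this]
    have "(\<lambda>n. harm n - ln (real (Suc n))) \<longlonglongrightarrow> euler_mascheroni" by simp
    hence "(\<lambda>n. (LBINT u:{0<..}. ?g u) - ?P + ((harm n - ln (real (Suc n))) - euler_mascheroni)) \<longlonglongrightarrow>
        (LBINT u:{0<..}. ?g u) - ?P + (euler_mascheroni - euler_mascheroni)" by (intro tendsto_intros)
    thus ?thesis by (simp add: algebra_simps)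
  qed
  ultimately have "(LBINT u:{0<..}. ?g u) - ?P = 0" by (rule LIMSEQ_unique[rotated])
  thus "(LBINT u:{0<..}. ?g u) = ?P" by simp
qed

text \<open>Since \<open>exp (3 / 4 * u) / (exp u - 1)\<close> is \<open>digamma_kernel u\<close>,
  the integrand splits into Gauss's integrand, a Frullani integrand with
  \<open>a = 1 / (16 * x)\<close> and that of \<open>gauss_digamma\<close>. The second contributes
  Euler's constant and \<open>ln (16 * x)\<close>; with \<open>ln pi\<close> from
  \<open>Phi_eq\<close> the latter becomes \<open>ln (16 * pi^2 * x)\<close>.\<close>

lemma Phi_second_formula:
  assumes x: "x > 0"
  shows "set_integrable lborel {0<..} (\<lambda>u. exp (- (u\<^sup>2 / (16 * x))) * (1 / u - exp (3 / 4 * u) / (exp u - 1)))"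
    and "Phi x = (euler_mascheroni + ln (16 * pi\<^sup>2 * x)) / (8 * sqrt (pi * x))
         - 1 / (4 * sqrt (pi * x)) * (LBINT u:{0<..}. exp (- (u\<^sup>2 / (16 * x))) * (1 / u - exp (3 / 4 * u) / (exp u - 1)))"
proof -
  let ?P = "Re (Digamma (1 / 4 :: complex))"
  let ?T = "\<lambda>u. exp (- (u\<^sup>2 / (16 * x))) * (1 / u - exp (3 / 4 * u) / (exp u - 1))"
  define a where "a = 1 / (16 * x)"
  have a: "a > 0" using x by (simp add: a_def)
  have aeq: "a * u\<^sup>2 = u\<^sup>2 / (16 * x)" for u by (simp add: a_def)
  note G = Digamma_quarter_gauss and I = frullani_exp_gaussian[OF a, unfolded aeq] and J = set_integrable_gauss_digamma[OF x]
  have eq: "?T u = ((exp (- u) / u - digamma_kernel u) - (exp (- u) - exp (- (u\<^sup>2 / (16 * x)))) / u) +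
      digamma_kernel u * (1 - exp (- (u\<^sup>2 / (16 * x))))" if u: "u \<in> {0<..}" for u
  proof -
    have "exp (3 / 4 * u) / (exp u - 1) = digamma_kernel u"
    proof -
      have "exp (3 / 4 * u) = exp (- (u / 4)) * exp u" by (simp flip: exp_add)
      moreover have "exp u - 1 = exp u * (1 - exp (- u))" by (simp add: right_diff_distrib flip: exp_add)
      moreover have "exp u * (1 - exp (- u)) \<noteq> 0" using u by simp
      ultimately show ?thesis unfolding digamma_kernel_def using u by simp
    qed
    thus ?thesis by (simp add: algebra_simps diff_divide_distrib)
  qed
  note GI = set_integral_diff[OF G(1) I(1)]
  note GIJ = set_integral_add[OF GI(1) J]
  show "set_integrable lborel {0<..} ?T"
    using GIJ(1) by (rule set_integrable_Ioi_cong) (rule eq)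
  have "(LBINT u:{0<..}. ?T u) = (LBINT u:{0<..}. ((exp (- u) / u - digamma_kernel u) - (exp (- u) - exp (- (u\<^sup>2 / (16 * x)))) / u) +
      digamma_kernel u * (1 - exp (- (u\<^sup>2 / (16 * x)))))"
    by (rule LBINT_Ioi_cong) (rule eq)
  also have "\<dots> = ?P - (ln a - euler_mascheroni) / 2 + gauss_digamma x"
    unfolding GIJ(2) GI(2) G(2) I(2) gauss_digamma_def ..
  finally have T: "?P + gauss_digamma x = (LBINT u:{0<..}. ?T u) + (ln a - euler_mascheroni) / 2" by simp
  have lna: "ln a = - ln (16 * x)" using x by (simp add: a_def ln_div)
  have lnx: "ln (16 * pi\<^sup>2 * x) = ln (16 * x) + 2 * ln pi"
  proof -
    have "ln (16 * pi\<^sup>2 * x) = ln (16 * x * pi\<^sup>2)" by (simp add: mult_ac)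
    also have "\<dots> = ln (16 * x) + ln (pi\<^sup>2)" using x by (simp add: ln_mult)
    finally show ?thesis by (simp add: ln_realpow)
  qed
  have "Phi x = (ln pi - (?P + gauss_digamma x)) / (4 * sqrt (pi * x))" unfolding Phi_eq(2)[OF x] by simp
  also have "\<dots> = ((euler_mascheroni + ln (16 * pi\<^sup>2 * x)) / 2 - (LBINT u:{0<..}. ?T u)) / (4 * sqrt (pi * x))"
    unfolding T lna lnx by (simp add: field_simps)
  also have "\<dots> = (euler_mascheroni + ln (16 * pi\<^sup>2 * x)) / (8 * sqrt (pi * x)) - 1 / (4 * sqrt (pi * x)) * (LBINT u:{0<..}. ?T u)"
    by (simp add: diff_divide_distrib)
  finally show "Phi x = (euler_mascheroni + ln (16 * pi\<^sup>2 * x)) / (8 * sqrt (pi * x))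
         - 1 / (4 * sqrt (pi * x)) * (LBINT u:{0<..}. ?T u)" .
qed

section \<open>The explicit formula\<close>

text \<open>\<open>mangoldt\<close> vanishes at 1, so dropping the first term changes nothing; the
  series of the theorem starts at 2.\<close>

lemma sums_mangoldt_shift:
  assumes "\<sigma> > 1"
  shows "(\<lambda>n. mangoldt (n + 2) / real (n + 2) powr \<sigma>) sums (\<Sum>n. mangoldt (Suc n) / real (Suc n) powr \<sigma>)"
proof -
  have "(\<lambda>n. mangoldt (Suc n) / real (Suc n) powr \<sigma>) sums (\<Sum>n. mangoldt (Suc n) / real (Suc n) powr \<sigma>)"
    by (rule summable_sums[OF summable_mangoldt_powr(2)[OF assms]])
  hence "(\<lambda>n. mangoldt (Suc (Suc n)) / real (Suc (Suc n)) powr \<sigma>) sums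
     ((\<Sum>n. mangoldt (Suc n) / real (Suc n) powr \<sigma>) - mangoldt (Suc 0) / real (Suc 0) powr \<sigma>)"
    by (subst sums_Suc_iff) simp
  thus ?thesis by (simp add: numeral_2_eq_2)
qed

text \<open>Logarithmic differentiation of \<open>riemann_zeta_eq_xi_sq\<close> at
  \<open>1 / 2 + s\<close>; the chain rule through the square brings the factor
  \<open>2 * s\<close>. The factors \<open>u\<close> and \<open>u - 1\<close> give
  \<open>1 / (s^2 - 1 / 4)\<close>, the Gamma factor and the power of \<open>pi\<close> the digamma
  term, and zeta the von Mangoldt series. These are the transforms of \<open>exp (x / 4)\<close>, of
  \<open>- Phi\<close> and of the prime sum.\<close>

lemma xi_sq_logderiv:
  fixes s :: real
  assumes s: "s > 1 / 2"
  shows "deriv xi_sq (of_real (s\<^sup>2)) / xi_sq (of_real (s\<^sup>2)) =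
     of_real (1 / (s\<^sup>2 - 1 / 4) - (ln pi - Re (Digamma (1 / 4 + of_real (s / 2)))) / (4 * s)
       - (\<Sum>n. mangoldt (Suc n) / real (Suc n) powr (1 / 2 + s)) / (2 * s))"
proof -
  define z where "z = complex_of_real s"
  define \<sigma> where "\<sigma> = 1 / 2 + z"
  define c where "c = (\<lambda>u::complex. of_real pi powr (u / 2) * rGamma (u / 2) / (u * (u - 1)))"
  have Re\<sigma>: "Re \<sigma> > 1" "\<sigma> \<noteq> 0" "\<sigma> \<noteq> 1" using s by (auto simp: \<sigma>_def z_def complex_eq_iff)
  have z0: "z \<noteq> 0" using s by (auto simp: z_def)
  have nI: "\<sigma> / 2 \<notin> \<int>\<^sub>\<le>\<^sub>0" using Re\<sigma>(1) by (auto elim!: nonpos_Ints_cases)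
  have X: "(xi_sq has_field_derivative deriv xi_sq (z\<^sup>2)) (at (z\<^sup>2))"
    by (rule holomorphic_derivI[OF xi_sq_holomorphic]) auto
  have c0: "c \<sigma> \<noteq> 0" unfolding c_def using Re\<sigma> nI by (auto simp: rGamma_eq_zero_iff)
  \<comment> \<open>The logarithmic derivative of \<open>c\<close> at \<sigma>;
    \<open>rGamma\<close> is the reciprocal of Gamma, hence the negative sign of digamma.\<close>
  define c' where "c' = of_real (ln pi) / 2 - Digamma (\<sigma> / 2) / 2 - 1 / \<sigma> - 1 / (\<sigma> - 1)"
  have "(c has_field_derivative c \<sigma> * c') (at \<sigma>)"
  proof -
    have Ln: "Ln (of_real pi) = of_real (ln pi)" by (rule Ln_of_real) simp
    have 1: "((\<lambda>u::complex. of_real pi powr (u / 2)) has_field_derivative of_real pi powr (\<sigma> / 2) * (of_real (ln pi) / 2)) (at \<sigma>)"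
      unfolding powr_def Ln by (auto intro!: derivative_eq_intros)
    have 2: "((\<lambda>u::complex. rGamma (u / 2)) has_field_derivative rGamma (\<sigma> / 2) * (- Digamma (\<sigma> / 2) / 2)) (at \<sigma>)"
      using nI by (auto intro!: derivative_eq_intros)
    have 3: "((\<lambda>u::complex. u * (u - 1)) has_field_derivative 2 * \<sigma> - 1) (at \<sigma>)"
      by (auto intro!: derivative_eq_intros simp: algebra_simps)
    have ne: "\<sigma> * (\<sigma> - 1) \<noteq> 0" using Re\<sigma> by simp
    have "((of_real pi powr (\<sigma> / 2) * (of_real (ln pi) / 2)) * rGamma (\<sigma> / 2) +
         (rGamma (\<sigma> / 2) * (- Digamma (\<sigma> / 2) / 2)) * of_real pi powr (\<sigma> / 2)) * (\<sigma> * (\<sigma> - 1)) -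
         (of_real pi powr (\<sigma> / 2) * rGamma (\<sigma> / 2)) * (2 * \<sigma> - 1) = c \<sigma> * c' * ((\<sigma> * (\<sigma> - 1)) * (\<sigma> * (\<sigma> - 1)))"
    proof -
      have "(A * (L / 2) * B + B * (- E / 2) * A) * (t * (t - 1)) - A * B * (2 * t - 1) =
         A * B / (t * (t - 1)) * (L / 2 - E / 2 - 1 / t - 1 / (t - 1)) * ((t * (t - 1)) * (t * (t - 1)))"
        if "t \<noteq> 0" "t \<noteq> 1" for A B L E t :: complex
      proof -
        have "A * B / (t * (t - 1)) * (L / 2 - E / 2 - 1 / t - 1 / (t - 1)) * ((t * (t - 1)) * (t * (t - 1))) =
           (A * B / (t * (t - 1)) * (t * (t - 1))) * ((L / 2 - E / 2) * (t * (t - 1)) - (1 / t * t) * (t - 1) - (1 / (t - 1) * (t - 1)) * t)"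
          by (simp only: algebra_simps)
        also have "\<dots> = A * B * ((L / 2 - E / 2) * (t * (t - 1)) - (t - 1) - t)" using that by simp
        finally show ?thesis by (simp add: algebra_simps)
      qed
      from this[OF Re\<sigma>(2,3)] show ?thesis unfolding c_def c'_def .
    qed
    hence "(((of_real pi powr (\<sigma> / 2) * (of_real (ln pi) / 2)) * rGamma (\<sigma> / 2) +
         (rGamma (\<sigma> / 2) * (- Digamma (\<sigma> / 2) / 2)) * of_real pi powr (\<sigma> / 2)) * (\<sigma> * (\<sigma> - 1)) -
         (of_real pi powr (\<sigma> / 2) * rGamma (\<sigma> / 2)) * (2 * \<sigma> - 1)) / ((\<sigma> * (\<sigma> - 1)) * (\<sigma> * (\<sigma> - 1))) = c \<sigma> * c'"
      using ne by (simp only: nonzero_mult_div_cancel_right mult_eq_0_iff simp_thms)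
    thus ?thesis using DERIV_divide[OF DERIV_mult[OF 1 2] 3 ne] unfolding c_def by (simp only:)
  qed
  moreover have "((\<lambda>u. xi_sq ((u - 1 / 2)\<^sup>2)) has_field_derivative deriv xi_sq (z\<^sup>2) * (2 * z)) (at \<sigma>)"
  proof (rule DERIV_chain2[where f = xi_sq])
    show "(xi_sq has_field_derivative deriv xi_sq (z\<^sup>2)) (at ((\<sigma> - 1 / 2)\<^sup>2))" using X by (simp add: \<sigma>_def)
    show "((\<lambda>u. (u - 1 / 2)\<^sup>2) has_field_derivative 2 * z) (at \<sigma>)"
      by (auto intro!: derivative_eq_intros simp: \<sigma>_def)
  qed
  ultimately have "((\<lambda>u. c u * xi_sq ((u - 1 / 2)\<^sup>2)) has_field_derivative
      (c \<sigma> * c') * xi_sq ((\<sigma> - 1 / 2)\<^sup>2) + (deriv xi_sq (z\<^sup>2) * (2 * z)) * c \<sigma>) (at \<sigma>)"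
    by (rule DERIV_mult)
  moreover have "\<forall>\<^sub>F u in nhds \<sigma>. c u * xi_sq ((u - 1 / 2)\<^sup>2) = riemann_zeta u"
  proof -
    have "\<forall>\<^sub>F u in nhds \<sigma>. u \<in> {u. Re u > 1}" using Re\<sigma> by (intro eventually_nhds_in_open open_halfspace_Re_gt) auto
    thus ?thesis
    proof eventually_elim
      case (elim u)
      hence "u \<noteq> 0" "u \<noteq> 1" by auto
      from riemann_zeta_eq_xi_sq[OF this] show ?case by (simp add: c_def)
    qed
  qed
  ultimately have "(riemann_zeta has_field_derivative
      (c \<sigma> * c') * xi_sq ((\<sigma> - 1 / 2)\<^sup>2) + (deriv xi_sq (z\<^sup>2) * (2 * z)) * c \<sigma>) (at \<sigma>)"
    using DERIV_cong_ev[of \<sigma> \<sigma> "\<lambda>u. c u * xi_sq ((u - 1 / 2)\<^sup>2)" riemann_zeta] by blast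
  hence "deriv riemann_zeta \<sigma> = (c \<sigma> * c') * xi_sq (z\<^sup>2) + (deriv xi_sq (z\<^sup>2) * (2 * z)) * c \<sigma>"
    using DERIV_imp_deriv by (fastforce simp: \<sigma>_def)
  moreover define DD where "DD = (\<Sum>n. mangoldt (Suc n) / of_nat (Suc n) powr \<sigma> :: complex)"
  have "deriv riemann_zeta \<sigma> = - DD * riemann_zeta \<sigma>"
    unfolding DD_def by (rule riemann_zeta_logderiv[OF Re\<sigma>(1)])
  moreover have zz: "riemann_zeta \<sigma> = c \<sigma> * xi_sq (z\<^sup>2)"
    using riemann_zeta_eq_xi_sq[OF Re\<sigma>(2,3)] by (simp add: c_def \<sigma>_def)
  ultimately have "c \<sigma> * (- DD * xi_sq (z\<^sup>2)) = c \<sigma> * (c' * xi_sq (z\<^sup>2) + deriv xi_sq (z\<^sup>2) * (2 * z))"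
    by (simp add: algebra_simps)
  hence "- DD * xi_sq (z\<^sup>2) = c' * xi_sq (z\<^sup>2) + deriv xi_sq (z\<^sup>2) * (2 * z)"
    using c0 by (subst (asm) mult_cancel_left) simp
  moreover have "xi_sq (z\<^sup>2) \<noteq> 0" using xi_sq_real_nonzero[of s] s by (simp add: z_def)
  ultimately have main: "deriv xi_sq (z\<^sup>2) / xi_sq (z\<^sup>2) = (- DD - c') / (2 * z)"
    using z0 by (simp add: field_simps)
  have "DD = of_real (\<Sum>n. mangoldt (Suc n) / real (Suc n) powr (1 / 2 + s))"
  proof -
    have "mangoldt (Suc n) / of_nat (Suc n) powr \<sigma> = complex_of_real (mangoldt (Suc n) / real (Suc n) powr (1 / 2 + s))" for n
      using of_nat_powr_of_real[of n "1 / 2 + s"] by (simp add: \<sigma>_def z_def)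
    moreover have "1 / 2 + s > 1" using s by simp
    ultimately show ?thesis unfolding DD_def by (simp only: suminf_of_real[OF summable_mangoldt_powr(2)])
  qed
  moreover have "Digamma (\<sigma> / 2) = of_real (Re (Digamma (1 / 4 + of_real (s / 2))))"
  proof -
    have eq: "\<sigma> / 2 = of_real (1 / 4 + s / 2)" "1 / 4 + complex_of_real (s / 2) = of_real (1 / 4 + s / 2)"
      by (simp_all add: \<sigma>_def z_def add_divide_distrib)
    have "1 / 4 + s / 2 \<noteq> 0" using s by simp
    hence "Digamma (complex_of_real (1 / 4 + s / 2)) = of_real (Digamma (1 / 4 + s / 2))"
      by (rule Polygamma_of_real)
    thus ?thesis unfolding eq by (simp only: Re_complex_of_real)
  qed
  moreover have "1 / \<sigma> + 1 / (\<sigma> - 1) = 2 * z / (z\<^sup>2 - 1 / 4)"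
  proof -
    have "\<sigma> * (\<sigma> - 1) = z\<^sup>2 - 1 / 4" by (simp add: \<sigma>_def power2_eq_square algebra_simps)
    moreover have "1 / \<sigma> + 1 / (\<sigma> - 1) = (2 * \<sigma> - 1) / (\<sigma> * (\<sigma> - 1))" using Re\<sigma> by (simp add: divide_simps)
    moreover have "2 * \<sigma> - 1 = 2 * z" by (simp add: \<sigma>_def)
    ultimately show ?thesis by simp
  qed
  moreover have "(- d - (l / 2 - p / 2 - a - b)) / (2 * y) = (a + b) / (2 * y) - (l - p) / (4 * y) - d / (2 * y)"
    for d l p a b y :: complex by (simp add: diff_divide_distrib add_divide_distrib)
  moreover have "2 * z / (z\<^sup>2 - 1 / 4) / (2 * z) = 1 / (z\<^sup>2 - 1 / 4)" using z0 by simp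
  ultimately have "deriv xi_sq (z\<^sup>2) / xi_sq (z\<^sup>2) = 1 / (z\<^sup>2 - 1 / 4) - (of_real (ln pi) - of_real (Re (Digamma (1 / 4 + of_real (s / 2))))) / (4 * z)
       - of_real (\<Sum>n. mangoldt (Suc n) / real (Suc n) powr (1 / 2 + s)) / (2 * z)"
    unfolding main c'_def by (simp only:)
  thus ?thesis by (simp add: z_def)
qed

text \<open>Completing the square gives \<open>L^2 / (4 * b) \<ge> 2 * L - 4 * b\<close> for the
  logarithm \<open>L\<close>. A Gaussian in the logarithm thus beats the second power, uniformly for
  \<open>x \<le> b\<close>; with the square root in the denominator this gives the exponent
  \<open>5 / 2\<close> below.\<close>

lemma exp_log_square_le:
  fixes x :: real
  assumes x: "0 < x" "x \<le> b"
  shows "exp (- (1 / (4 * x)) * (ln (real (n + 2)))\<^sup>2) \<le> exp (4 * b) * real (n + 2) powr (- 2)"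
proof -
  let ?L = "ln (real (n + 2))"
  have b: "b > 0" using x by simp
  have "0 \<le> (?L / (2 * sqrt b) - 2 * sqrt b)\<^sup>2" by simp
  also have "\<dots> = 1 / (4 * b) * ?L\<^sup>2 - 2 * ?L + 4 * b"
    using b by (simp add: power2_diff power_divide power_mult_distrib)
  finally have "- (1 / (4 * b)) * ?L\<^sup>2 \<le> 4 * b - 2 * ?L" by simp
  moreover have "1 / (4 * b) * ?L\<^sup>2 \<le> 1 / (4 * x) * ?L\<^sup>2" using x by (intro mult_right_mono divide_left_mono) auto
  ultimately have "- (1 / (4 * x)) * ?L\<^sup>2 \<le> 4 * b - 2 * ?L" by linarith
  hence "exp (- (1 / (4 * x)) * ?L\<^sup>2) \<le> exp (4 * b - 2 * ?L)" by simp
  also have "\<dots> = exp (4 * b) * real (n + 2) powr (- 2)" by (simp add: powr_def exp_diff exp_minus field_simps)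
  finally show ?thesis .
qed

lemma mangoldt_gauss_bound:
  fixes x :: real
  assumes x: "0 < x" "x \<le> b"
  shows "norm (mangoldt (n + 2) / sqrt (real (n + 2)) * exp (- (1 / (4 * x)) * (ln (real (n + 2)))\<^sup>2))
     \<le> exp (4 * b) * (mangoldt (n + 2) / real (n + 2) powr (5 / 2))"
proof -
  let ?m = "mangoldt (n + 2) / sqrt (real (n + 2))"
  have m: "?m \<ge> 0" by (simp add: mangoldt_nonneg)
  have "?m * exp (- (1 / (4 * x)) * (ln (real (n + 2)))\<^sup>2) \<ge> 0" by (rule mult_nonneg_nonneg[OF m]) simp
  hence "norm (?m * exp (- (1 / (4 * x)) * (ln (real (n + 2)))\<^sup>2)) = ?m * exp (- (1 / (4 * x)) * (ln (real (n + 2)))\<^sup>2)"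
    by (simp only: real_norm_def abs_of_nonneg)
  also have "\<dots> \<le> ?m * (exp (4 * b) * real (n + 2) powr (- 2))"
    by (intro mult_left_mono exp_log_square_le[OF x] m)
  also have "\<dots> = exp (4 * b) * (mangoldt (n + 2) / real (n + 2) powr (5 / 2))"
  proof -
    have "real (n + 2) powr (1 / 2 + 2) = sqrt (real (n + 2)) * real (n + 2) powr 2"
      by (simp only: powr_add powr_half_sqrt of_nat_0_le_iff)
    moreover have "1 / 2 + 2 = (5 / 2 :: real)" by simp
    ultimately have "real (n + 2) powr (5 / 2) = sqrt (real (n + 2)) * real (n + 2) powr 2" by (simp only:)
    thus ?thesis by (simp add: powr_minus divide_simps)
  qed
  finally show ?thesis .
qed

lemma summable_mangoldt_gauss:
  assumes "x > 0"
  shows "summable (\<lambda>n. mangoldt (n + 2) / sqrt (real (n + 2)) * exp (- (1 / (4 * x)) * (ln (real (n + 2)))\<^sup>2))"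
proof (rule summable_comparison_test')
  show "summable (\<lambda>n. exp (4 * x) * (mangoldt (n + 2) / real (n + 2) powr (5 / 2)))"
    by (intro summable_mult sums_summable[OF sums_mangoldt_shift]) simp
qed (use mangoldt_gauss_bound[OF assms order_refl] in blast)

definition mangoldt_gauss :: "real \<Rightarrow> real" where
  "mangoldt_gauss x = (\<Sum>n. mangoldt (n + 2) / sqrt (real (n + 2)) * exp (- (1 / (4 * x)) * (ln (real (n + 2)))\<^sup>2))"

lemma continuous_on_mangoldt_gauss: "continuous_on {0<..} mangoldt_gauss"
  unfolding mangoldt_gauss_def[abs_def]
proof (rule continuous_on_Ioi_suminf)
  fix a b :: real assume "0 < a" "a < b"
  show "\<exists>M. summable M \<and> (\<forall>n. \<forall>x\<in>{a..b}. norm (mangoldt (n + 2) / sqrt (real (n + 2)) * exp (- (1 / (4 * x)) * (ln (real (n + 2)))\<^sup>2)) \<le> M n)"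
  proof (intro exI conjI allI ballI)
    show "summable (\<lambda>n. exp (4 * b) * (mangoldt (n + 2) / real (n + 2) powr (5 / 2)))"
      by (intro summable_mult sums_summable[OF sums_mangoldt_shift]) simp
  qed (use mangoldt_gauss_bound \<open>0 < a\<close> in auto)
qed (auto intro!: continuous_intros)

text \<open>\<open>laplace_gauss\<close> with \<open>a = ln n\<close> turns each Gaussian into
  \<open>n powr (- s)\<close> up to a common factor; with the square root this is the Dirichlet
  series at \<open>1 / 2 + s\<close>, inside its half-plane of absolute convergence.\<close>

lemma laplace_mangoldt_gauss:
  assumes s: "s > 1 / 2"
  shows "set_integrable lborel {0<..} (\<lambda>x. exp (- (s\<^sup>2 * x)) * (1 / (2 * sqrt (pi * x)) * mangoldt_gauss x))"
    "(LBINT x:{0<..}. exp (- (s\<^sup>2 * x)) * (1 / (2 * sqrt (pi * x)) * mangoldt_gauss x)) =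
       (\<Sum>n. mangoldt (Suc n) / real (Suc n) powr (1 / 2 + s)) / (2 * s)"
proof -
  have s0: "s > 0" using s by simp
  define L where "L = (\<lambda>n. ln (real (n + 2)))"
  have L: "L n \<ge> 0" for n by (simp add: L_def)
  define m where "m = (\<lambda>n. mangoldt (n + 2) / sqrt (real (n + 2)) / (2 * sqrt pi))"
  have m: "m n \<ge> 0" for n by (simp add: m_def mangoldt_nonneg)
  let ?f = "\<lambda>n x. m n * (exp (- (s\<^sup>2 * x)) * (exp (- ((L n)\<^sup>2 / (4 * x))) / sqrt x))"
  note G = laplace_gauss[OF s0 L]
  have i1: "set_integrable lborel {0<..} (?f n)" for n by (intro set_integrable_mult_right G)
  have i2: "(LBINT x:{0<..}. ?f n x) = mangoldt (n + 2) / real (n + 2) powr (1 / 2 + s) / (2 * s)" for n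
  proof -
    have "exp (- (s * L n)) = 1 / real (n + 2) powr s" by (simp add: L_def powr_def exp_minus inverse_eq_divide mult_ac)
    moreover have "real (n + 2) powr (1 / 2 + s) = sqrt (real (n + 2)) * real (n + 2) powr s"
      by (simp add: powr_add powr_half_sqrt)
    ultimately show ?thesis unfolding set_integral_mult_right G(2) m_def by simp
  qed
  have nrm: "norm (?f n x) = ?f n x" if "x > 0" for n x using m[of n] that by (simp add: abs_mult)
  have "1 / 2 + s > 1" using s by simp
  note S = sums_divide[OF sums_mangoldt_shift[OF this], of "2 * s"]
  have pt: "(\<lambda>n. ?f n x) sums (exp (- (s\<^sup>2 * x)) * (1 / (2 * sqrt (pi * x)) * mangoldt_gauss x))" if x: "x > 0" for x
  proof -
    have "(\<lambda>n. (exp (- (s\<^sup>2 * x)) * (1 / (2 * sqrt (pi * x)))) * (mangoldt (n + 2) / sqrt (real (n + 2)) * exp (- (1 / (4 * x)) * (ln (real (n + 2)))\<^sup>2)))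
       sums ((exp (- (s\<^sup>2 * x)) * (1 / (2 * sqrt (pi * x)))) * mangoldt_gauss x)"
      unfolding mangoldt_gauss_def by (intro sums_mult summable_sums summable_mangoldt_gauss x)
    moreover have "(exp (- (s\<^sup>2 * x)) * (1 / (2 * sqrt (pi * x)))) * (mangoldt (n + 2) / sqrt (real (n + 2)) * exp (- (1 / (4 * x)) * (ln (real (n + 2)))\<^sup>2)) = ?f n x" for n
      by (simp add: m_def L_def real_sqrt_mult mult_ac)
    ultimately show ?thesis by (simp only: mult.assoc)
  qed
  have sm: "summable (\<lambda>n. LBINT x:{0<..}. norm (?f n x))"
  proof -
    have "(LBINT x:{0<..}. norm (?f n x)) = (LBINT x:{0<..}. ?f n x)" for n
      by (rule LBINT_Ioi_cong) (simp only: nrm greaterThan_iff)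
    thus ?thesis using sums_summable[OF S] by (simp only: i2)
  qed
  have pts: "summable (\<lambda>n. norm (?f n x))" if "x \<in> {0<..}" for x
  proof -
    have x: "x > 0" using that by simp
    show ?thesis unfolding nrm[OF x] by (rule sums_summable[OF pt[OF x]])
  qed
  have R: "set_integrable lborel {0<..} (\<lambda>x. \<Sum>n. ?f n x)" "(\<lambda>n. LBINT x:{0<..}. ?f n x) sums (LBINT x:{0<..}. \<Sum>n. ?f n x)"
    by (rule set_integral_suminf[OF i1 _ sm], rule pts, assumption)+
  have eq: "exp (- (s\<^sup>2 * x)) * (1 / (2 * sqrt (pi * x)) * mangoldt_gauss x) = (\<Sum>n. ?f n x)" if "x \<in> {0<..}" for x
    by (rule sums_unique[OF pt]) (use that in simp)
  show "set_integrable lborel {0<..} (\<lambda>x. exp (- (s\<^sup>2 * x)) * (1 / (2 * sqrt (pi * x)) * mangoldt_gauss x))"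
    using R(1) by (rule set_integrable_Ioi_cong) (rule eq)
  have "(LBINT x:{0<..}. exp (- (s\<^sup>2 * x)) * (1 / (2 * sqrt (pi * x)) * mangoldt_gauss x)) = (LBINT x:{0<..}. \<Sum>n. ?f n x)"
    by (rule LBINT_Ioi_cong) (rule eq)
  also have "\<dots> = (\<Sum>n. mangoldt (Suc n) / real (Suc n) powr (1 / 2 + s)) / (2 * s)"
    by (rule sums_unique2[OF R(2)[unfolded i2] S])
  finally show "(LBINT x:{0<..}. exp (- (s\<^sup>2 * x)) * (1 / (2 * sqrt (pi * x)) * mangoldt_gauss x)) =
       (\<Sum>n. mangoldt (Suc n) / real (Suc n) powr (1 / 2 + s)) / (2 * s)" .
qed

text \<open>From \<open>exp (- y) \<le> 1 / y\<close> with \<open>y = D * a\<close>: the sum of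
  exponentials is majorised by the series of \<open>1 / (5 / 4 - Re z)\<close>, which converges by
  \<open>xi_sq_logderiv_sums\<close>.\<close>

lemma exp_zero_bound:
  fixes \<rho> :: "nat \<Rightarrow> complex" and x a b :: real
  assumes rho: "upper_zeta_zeros_seq \<rho>" and x: "0 < a" "a \<le> x" "x \<le> b"
  shows "norm (exp ((\<rho> (Suc n) - 1 / 2)\<^sup>2 * of_real x)) \<le> exp (5 / 4 * b) / a * (1 / (5 / 4 - Re ((\<rho> (Suc n) - 1 / 2)\<^sup>2)))"
proof -
  define D where "D = 5 / 4 - Re ((\<rho> (Suc n) - 1 / 2)\<^sup>2)"
  have D: "D \<ge> 1" using rho_bounds(1)[OF rho, of "Suc n" "5 / 4"] by (simp add: D_def)
  have "norm (exp ((\<rho> (Suc n) - 1 / 2)\<^sup>2 * of_real x)) = exp (5 / 4 * x) * exp (- (D * x))"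
    by (simp add: D_def algebra_simps flip: exp_add)
  also have "\<dots> \<le> exp (5 / 4 * b) * (1 / (D * a))"
  proof (rule mult_mono)
    have "exp (- (D * x)) \<le> exp (- (D * a))" using D x by simp
    also have "\<dots> \<le> 1 / (D * a)"
    proof -
      have "D * a > 0" using D x by simp
      moreover have "D * a \<le> exp (D * a)" using exp_ge_add_one_self[of "D * a"] by linarith
      ultimately show ?thesis by (simp add: exp_minus field_simps)
    qed
    finally show "exp (- (D * x)) \<le> 1 / (D * a)" .
  qed (use x D in auto)
  finally show ?thesis by (simp add: D_def mult_ac)
qed

text \<open>Termwise integration: the norms integrate to \<open>1 / (w - Re z)\<close>, which is
  summable, and the terms to \<open>1 / (w - z)\<close>, whose sum is the logarithmic derivative of
  \<open>xi_sq\<close>. Convergence and continuity in \<open>x\<close> come from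
  \<open>exp_zero_bound\<close>.\<close>

lemma laplace_zero_sum:
  fixes \<rho> :: "nat \<Rightarrow> complex" and w :: real
  assumes rho: "upper_zeta_zeros_seq \<rho>" and w: "w \<ge> 5 / 4"
  shows "set_integrable lborel {0<..} (\<lambda>x. of_real (exp (- (w * x))) * (\<Sum>n. exp ((\<rho> (Suc n) - 1 / 2)\<^sup>2 * of_real x)))"
    "(LBINT x:{0<..}. of_real (exp (- (w * x))) * (\<Sum>n. exp ((\<rho> (Suc n) - 1 / 2)\<^sup>2 * of_real x))) = deriv xi_sq (of_real w) / xi_sq (of_real w)"
    "\<And>x. x > 0 \<Longrightarrow> summable (\<lambda>n. norm (exp ((\<rho> (Suc n) - 1 / 2)\<^sup>2 * of_real x)))"
    "continuous_on {0<..} (\<lambda>x. \<Sum>n. exp ((\<rho> (Suc n) - 1 / 2)\<^sup>2 * of_real x))"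
proof -
  define z where "z = (\<lambda>n. (\<rho> (Suc n) - 1 / 2)\<^sup>2)"
  have D: "w - Re (z n) \<ge> 1" for n using rho_bounds(1)[OF rho, of "Suc n" w] w by (simp add: z_def)
  have bd: "norm (exp (z n * of_real x)) \<le> exp (5 / 4 * b) / a * (1 / (5 / 4 - Re (z n)))"
    if "0 < a" "a \<le> x" "x \<le> b" for n x a b
    unfolding z_def by (rule exp_zero_bound[OF rho that])
  have sm0: "summable (\<lambda>n. C * (1 / (5 / 4 - Re (z n))))" for C
    using xi_sq_logderiv_sums(1)[OF rho order_refl] unfolding z_def by (intro summable_mult)
  have pts: "summable (\<lambda>n. norm (exp (z n * of_real x)))" if x: "x > 0" for x
    by (rule summable_comparison_test'[OF sm0[of "exp (5 / 4 * x) / x"]]) (use bd[OF x order_refl order_refl] in simp)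
  thus "\<And>x. x > 0 \<Longrightarrow> summable (\<lambda>n. norm (exp ((\<rho> (Suc n) - 1 / 2)\<^sup>2 * of_real x)))" by (simp add: z_def)
  have "continuous_on {0<..} (\<lambda>x. \<Sum>n. exp (z n * complex_of_real x))"
  proof (rule continuous_on_Ioi_suminf)
    fix a b :: real assume ab: "0 < a" "a < b"
    show "\<exists>M. summable M \<and> (\<forall>n. \<forall>x\<in>{a..b}. norm (exp (z n * complex_of_real x)) \<le> M n)"
    proof (intro exI conjI allI ballI)
      show "summable (\<lambda>n. exp (5 / 4 * b) / a * (1 / (5 / 4 - Re (z n))))" by (rule sm0)
    qed (use bd[OF ab(1)] in simp)
  qed (intro continuous_intros)
  thus "continuous_on {0<..} (\<lambda>x. \<Sum>n. exp ((\<rho> (Suc n) - 1 / 2)\<^sup>2 * of_real x))" unfolding z_def .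
  let ?f = "\<lambda>n x. exp (- ((of_real w - z n) * of_real x))"
  have feq: "of_real (exp (- (w * x))) * exp (z n * of_real x) = ?f n x" for n x
    by (simp add: algebra_simps flip: exp_add exp_of_real)
  have pos: "Re (of_real w - z n) > 0" for n using D[of n] by simp
  note E = laplace_exp_complex[OF pos]
  have nrm: "(LBINT x:{0<..}. norm (?f n x)) = 1 / (w - Re (z n))" for n
  proof -
    have "(LBINT x:{0<..}. norm (?f n x)) = (LBINT x:{0<..}. exp (- ((w - Re (z n)) * x)))" by simp
    also have "\<dots> = 1 / (w - Re (z n))" using D[of n] by (intro integral_exp_Ioi) auto
    finally show ?thesis .
  qed
  have sm: "summable (\<lambda>n. LBINT x:{0<..}. norm (?f n x))"
    unfolding nrm using xi_sq_logderiv_sums(1)[OF rho w] by (simp add: z_def)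
  have ps: "summable (\<lambda>n. norm (?f n x))" if "x \<in> {0<..}" for x
  proof -
    have "summable (\<lambda>n. norm (complex_of_real (exp (- (w * x)))) * norm (exp (z n * of_real x)))"
      using that by (intro summable_mult pts) simp
    thus ?thesis unfolding norm_mult[symmetric] feq .
  qed
  have R: "set_integrable lborel {0<..} (\<lambda>x. \<Sum>n. ?f n x)" "(\<lambda>n. LBINT x:{0<..}. ?f n x) sums (LBINT x:{0<..}. \<Sum>n. ?f n x)"
    by (rule set_integral_suminf[OF E(1) _ sm], rule ps, assumption)+
  have eq: "of_real (exp (- (w * x))) * (\<Sum>n. exp (z n * of_real x)) = (\<Sum>n. ?f n x)" if "x \<in> {0<..}" for x
    unfolding feq[symmetric] using that by (intro suminf_mult[symmetric] summable_norm_cancel[OF pts]) simp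
  have "set_integrable lborel {0<..} (\<lambda>x. of_real (exp (- (w * x))) * (\<Sum>n. exp (z n * of_real x)))"
    using R(1) by (rule set_integrable_Ioi_cong) (rule eq)
  thus "set_integrable lborel {0<..} (\<lambda>x. of_real (exp (- (w * x))) * (\<Sum>n. exp ((\<rho> (Suc n) - 1 / 2)\<^sup>2 * of_real x)))"
    unfolding z_def .
  have "(LBINT x:{0<..}. of_real (exp (- (w * x))) * (\<Sum>n. exp (z n * of_real x))) = (LBINT x:{0<..}. \<Sum>n. ?f n x)"
    by (rule LBINT_Ioi_cong) (rule eq)
  also have "\<dots> = deriv xi_sq (of_real w) / xi_sq (of_real w)"
    using sums_unique2[OF R(2)[unfolded E(2)]] xi_sq_logderiv_sums(2)[OF rho w] by (simp add: z_def)
  finally show "(LBINT x:{0<..}. of_real (exp (- (w * x))) * (\<Sum>n. exp ((\<rho> (Suc n) - 1 / 2)\<^sup>2 * of_real x))) = deriv xi_sq (of_real w) / xi_sq (of_real w)"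
    by (simp add: z_def)
qed

theorem theorem2p2:
  fixes \<rho> \<alpha> :: "nat \<Rightarrow> complex" and x :: real
  assumes "upper_zeta_zeros_seq \<rho>"
    and "\<And>n. n \<ge> 1 \<Longrightarrow> \<rho> n = 1 / 2 + \<i> * \<alpha> n"
    and "x > 0"
  shows "summable (\<lambda>n. mangoldt (n + 2) / sqrt (real (n + 2))
             * exp (- (1 / (4 * x)) * (ln (real (n + 2)))\<^sup>2) :: real)
     \<and> set_integrable lborel {0<..} (\<lambda>t. exp (- x * t\<^sup>2) * Psi t)
     \<and> (\<lambda>n. exp (- (\<alpha> (n + 1))\<^sup>2 * complex_of_real x)) sums
         complex_of_real
           (- (1 / (2 * sqrt (pi * x)))
               * (\<Sum>n. mangoldt (n + 2) / sqrt (real (n + 2))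
                    * exp (- (1 / (4 * x)) * (ln (real (n + 2)))\<^sup>2))
            + exp (x / 4) - Phi x)
     \<and> set_integrable lborel {0<..}
         (\<lambda>u. exp (- (u\<^sup>2 / (16 * x))) * (1 / u - exp (3 / 4 * u) / (exp u - 1)))
     \<and> Phi x = (euler_mascheroni + ln (16 * pi\<^sup>2 * x)) / (8 * sqrt (pi * x))
         - 1 / (4 * sqrt (pi * x))
           * (LBINT u:{0<..}. exp (- (u\<^sup>2 / (16 * x)))
                * (1 / u - exp (3 / 4 * u) / (exp u - 1)))"
proof (intro conjI)
  note rho = assms(1) and x = assms(3)
  define S where "S = (\<lambda>x::real. \<Sum>n. exp ((\<rho> (Suc n) - 1 / 2)\<^sup>2 * of_real x))"
  define R where "R = (\<lambda>x. exp (1 / 4 * x) - Phi x - 1 / (2 * sqrt (pi * x)) * mangoldt_gauss x)"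
  have "S x - of_real (R x) = 0"
  \<comment> \<open>For \<open>w \<ge> 5 / 4\<close> the bounds on the zeros hold, and
    \<open>sqrt w > 1 / 2\<close> puts \<open>1 / 2 + sqrt w\<close> in the half-plane of absolute
    convergence, so both transforms are available at all sampling points.\<close>
  proof (rule laplace_eq_0_imp_eq_0[where c = "5 / 4", OF _ _ _ x])
    have "continuous_on {0<..} R"
      unfolding R_def by (intro continuous_intros continuous_on_Phi continuous_on_mangoldt_gauss) auto
    moreover have "continuous_on {0<..} S"
      unfolding S_def by (rule laplace_zero_sum(4)[OF rho order_refl])
    ultimately show "continuous_on {0<..} (\<lambda>x. S x - complex_of_real (R x))" by (intro continuous_intros)
    fix k :: nat
    define w where "w = 5 / 4 + real k"
    define s where "s = sqrt w"
    have w: "w \<ge> 5 / 4" by (simp add: w_def)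
    have s: "s\<^sup>2 = w" "s > 1 / 2"
    proof -
      show "s\<^sup>2 = w" using w by (simp add: s_def)
      have "sqrt (1 / 4) < s" unfolding s_def using w by (intro real_sqrt_less_mono) simp
      moreover have "sqrt (1 / 4) = 1 / (2::real)" by (simp add: real_sqrt_divide)
      ultimately show "s > 1 / 2" by simp
    qed
    have LZ: "set_integrable lborel {0<..} (\<lambda>x. of_real (exp (- (w * x))) * S x)"
      "(LBINT x:{0<..}. of_real (exp (- (w * x))) * S x) = deriv xi_sq (of_real w) / xi_sq (of_real w)"
      unfolding S_def by (rule laplace_zero_sum[OF rho w])+
    have s0: "s > 0" using s by simp
    note LP = laplace_Phi[OF s0, unfolded s(1)]
    note LM = laplace_mangoldt_gauss[OF s(2), unfolded s(1)]
    \<comment> \<open>The growing exponential stems from the factor \<open>s * (s - 1)\<close>,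
      which equals \<open>w - 1 / 4\<close> and removes the pole of zeta at 1.\<close>
    have LE: "set_integrable lborel {0<..} (\<lambda>x. exp (- (w * x)) * exp (1 / 4 * x))"
      "(LBINT x:{0<..}. exp (- (w * x)) * exp (1 / 4 * x)) = 1 / (w - 1 / 4)"
    proof -
      have eq: "exp (- (w * x)) * exp (1 / 4 * x) = exp (- ((w - 1 / 4) * x))" for x
        by (simp add: algebra_simps flip: exp_add)
      have "w - 1 / 4 > 0" using w by simp
      from integral_exp_Ioi[OF this] show "set_integrable lborel {0<..} (\<lambda>x. exp (- (w * x)) * exp (1 / 4 * x))"
        "(LBINT x:{0<..}. exp (- (w * x)) * exp (1 / 4 * x)) = 1 / (w - 1 / 4)" unfolding eq .
    qed
    note d1 = set_integral_diff[OF LE(1) LP(1)]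
    note d2 = set_integral_diff[OF d1(1) LM(1)]
    have Req: "exp (- (w * x)) * R x = exp (- (w * x)) * exp (1 / 4 * x) - exp (- (w * x)) * Phi x -
       exp (- (w * x)) * (1 / (2 * sqrt (pi * x)) * mangoldt_gauss x)" for x
      unfolding R_def by (simp only: right_diff_distrib)
    have LR: "set_integrable lborel {0<..} (\<lambda>x. exp (- (w * x)) * R x)"
      "complex_of_real (LBINT x:{0<..}. exp (- (w * x)) * R x) = deriv xi_sq (of_real w) / xi_sq (of_real w)"
    proof -
      show "set_integrable lborel {0<..} (\<lambda>x. exp (- (w * x)) * R x)" unfolding Req by (rule d2(1))
      show "complex_of_real (LBINT x:{0<..}. exp (- (w * x)) * R x) = deriv xi_sq (of_real w) / xi_sq (of_real w)"
        unfolding Req d2(2) d1(2) LE(2) LP(2) LM(2) xi_sq_logderiv[OF s(2), unfolded s(1)] ..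
    qed
    have LC: "set_integrable lborel {0<..} (\<lambda>x. complex_of_real (exp (- (w * x)) * R x))"
    proof -
      have "integrable lborel (\<lambda>x. complex_of_real (indicator {0<..} x *\<^sub>R (exp (- (w * x)) * R x)))"
        using LR(1) unfolding set_integrable_def by (rule integrable_of_real)
      thus ?thesis unfolding set_integrable_def by (simp add: scaleR_conv_of_real)
    qed
    have eq: "of_real (exp (- ((5 / 4 + real k) * x))) * (S x - of_real (R x)) =
       of_real (exp (- (w * x))) * S x - of_real (exp (- (w * x)) * R x)" for x
      unfolding w_def by (simp only: right_diff_distrib of_real_mult)
    show "set_integrable lborel {0<..} (\<lambda>x. of_real (exp (- ((5 / 4 + real k) * x))) * (S x - of_real (R x)))"
      unfolding eq by (rule set_integral_diff(1)[OF LZ(1) LC])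
    show "(LBINT x:{0<..}. of_real (exp (- ((5 / 4 + real k) * x))) * (S x - of_real (R x))) = 0"
      unfolding eq set_integral_diff(2)[OF LZ(1) LC] LZ(2) set_integral_complex_of_real LR(2) by simp
  qed
  hence "S x = of_real (R x)" by simp
  moreover have "(\<lambda>n. exp ((\<rho> (Suc n) - 1 / 2)\<^sup>2 * of_real x)) sums S x"
    unfolding S_def
    by (rule summable_sums[OF summable_norm_cancel[OF laplace_zero_sum(3)[OF rho order_refl x]]])
  \<comment> \<open>Squaring \<open>\<i> * \<alpha>\<close> gives the minus sign; the shift to
    \<open>Suc n\<close> meets the condition \<open>n \<ge> 1\<close> of the assumption.\<close>
  moreover have "(\<rho> (Suc n) - 1 / 2)\<^sup>2 = - (\<alpha> (n + 1))\<^sup>2" for n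
    using assms(2)[of "Suc n"] by (simp add: power_mult_distrib)
  moreover have "R x = - (1 / (2 * sqrt (pi * x))) * mangoldt_gauss x + exp (x / 4) - Phi x"
    unfolding R_def by simp
  ultimately show "(\<lambda>n. exp (- (\<alpha> (n + 1))\<^sup>2 * complex_of_real x)) sums
         complex_of_real
           (- (1 / (2 * sqrt (pi * x)))
               * (\<Sum>n. mangoldt (n + 2) / sqrt (real (n + 2))
                    * exp (- (1 / (4 * x)) * (ln (real (n + 2)))\<^sup>2))
            + exp (x / 4) - Phi x)"
    unfolding mangoldt_gauss_def by (simp only:)
  show "summable (\<lambda>n. mangoldt (n + 2) / sqrt (real (n + 2)) * exp (- (1 / (4 * x)) * (ln (real (n + 2)))\<^sup>2) :: real)"
    by (rule summable_mangoldt_gauss[OF x])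
  show "set_integrable lborel {0<..} (\<lambda>t. exp (- x * t\<^sup>2) * Psi t)" by (rule Phi_eq(1)[OF x])
  show "set_integrable lborel {0<..} (\<lambda>u. exp (- (u\<^sup>2 / (16 * x))) * (1 / u - exp (3 / 4 * u) / (exp u - 1)))"
    by (rule Phi_second_formula(1)[OF x])
  show "Phi x = (euler_mascheroni + ln (16 * pi\<^sup>2 * x)) / (8 * sqrt (pi * x))
         - 1 / (4 * sqrt (pi * x))
           * (LBINT u:{0<..}. exp (- (u\<^sup>2 / (16 * x))) * (1 / u - exp (3 / 4 * u) / (exp u - 1)))"
    by (rule Phi_second_formula(2)[OF x])
qed

end
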